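(* Let $G$ and $H$ be loop-free cactus graphs, let $\mathbb{k}$ be a field, and suppose that the Betti numbers of ungraded minimal free resolutions of the facet ideals $\mathcal{F}(M(G))$ and $\mathcal{F}(M(H))$ (over the polynomial rings over $\mathbb{k}$ with one variable per edge of $G$, resp. $H$) coincide, i.e. the resolutions have the same length and the same ranks $\beta_i$ in each homological degree. Then the higher weight hierarchies of $M(G)$ and $M(H)$ coincide: $d_i(M(G))=d_i(M(H))$ for all $i$.
   Context: A cactus graph is a finite connected graph each of whose blocks is either a cycle or a single edge. $M(G)$ is the cycle matroid of $G$ (ground set the edges, independent sets the forests). For a matroid $N$ with ground set $\{1,\dots,n\}$, its facet ideal $\mathcal{F}(N)\subset\mathbb{k}[x_1,\dots,x_n]$ is generated by the monomials $\prod_{j\in\sigma}x_j$ for $\sigma$ a basis of $N$. The higher weights are $d_i(N)=\min\{|\tau|:\tau\subset E(N),\ |\tau|-\operatorname{rk}(\tau)=i\}$. An ungraded minimal free resolution of a module over $S=\mathbb{k}[x_1,\dots,x_n]$ is an exact (except in degree $0$) complex $0\leftarrow S^{\beta_0}\leftarrow S^{\beta_1}\leftarrow\cdots$ resolving the module, with all maps having image in $\mathfrak{m}$ times the target, $\mathfrak{m}=\langle x_1,\dots,x_n\rangle$. *)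

theory Defs
  imports
    "HOL-Algebra.Ideal"
    "HOL-Algebra.Module"
    "HOL-Library.Poly_Mapping"
    "HOL-Library.Extended_Nat"
begin

section \<open>Multigraphs\<close>

text \<open>
  Finite undirected multigraphs: every edge has a set of one end (a loop) or two ends, and
  different edges may have the same ends.
\<close>

record ('v, 'e) multigraph =
  verts :: "'v set"
  edges :: "'e set"
  ends :: "'e \<Rightarrow> 'v set"

definition graph :: "('v, 'e) multigraph \<Rightarrow> bool" where
  "graph G \<longleftrightarrow> finite (verts G) \<and> verts G \<noteq> {} \<and> finite (edges G) \<and>
     (\<forall>e\<in>edges G. ends G e \<subseteq> verts G \<and> card (ends G e) \<in> {1, 2})"

definition loop_free :: "('v, 'e) multigraph \<Rightarrow> bool" where
  "loop_free G \<longleftrightarrow> (\<forall>e\<in>edges G. card (ends G e) \<noteq> 1)"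

text \<open>
  A subgraph carries the same map \<open>ends\<close> as the whole graph (also off its own edge set), so
  that a subgraph is determined by its vertices and edges.
\<close>

definition subgraph :: "('v, 'e) multigraph \<Rightarrow> ('v, 'e) multigraph \<Rightarrow> bool" where
  "subgraph H G \<longleftrightarrow> graph H \<and> graph G \<and> verts H \<subseteq> verts G \<and> edges H \<subseteq> edges G \<and> ends H = ends G"

definition adjacency :: "('v, 'e) multigraph \<Rightarrow> ('v \<times> 'v) set" where
  "adjacency G = {(u, v). \<exists>e\<in>edges G. ends G e = {u, v}}"

definition connected_graph :: "('v, 'e) multigraph \<Rightarrow> bool" where
  "connected_graph G \<longleftrightarrow> graph G \<and> (\<forall>u\<in>verts G. \<forall>v\<in>verts G. (u, v) \<in> (adjacency G)\<^sup>*)"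

text \<open>
  The cycle through \<open>vs\<close>; length 1 is a loop and length 2 a pair of parallel edges.
\<close>

definition cycle_graph :: "('v, 'e) multigraph \<Rightarrow> bool" where
  "cycle_graph C \<longleftrightarrow> (\<exists>vs es. vs \<noteq> [] \<and> length es = length vs \<and> distinct vs \<and> distinct es \<and>
     verts C = set vs \<and> edges C = set es \<and>
     (\<forall>i<length vs. ends C (es ! i) = {vs ! i, vs ! (Suc i mod length vs)}))"

definition single_edge_graph :: "('v, 'e) multigraph \<Rightarrow> bool" where
  "single_edge_graph K \<longleftrightarrow> (\<exists>e. edges K = {e} \<and> verts K = ends K e \<and> card (ends K e) = 2)"

text \<open>
  \<open>v\<close> separates the connected graph \<open>G\<close> if \<open>G\<close> splits into two connected subgraphs, each with at
  least one edge, that share \<open>v\<close> and nothing else. For loop-free \<open>G\<close> these are the cut vertices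
  (a vertex whose deletion disconnects \<open>G\<close>); with this form a loop is a block of its own.
\<close>

definition separating_vertex :: "('v, 'e) multigraph \<Rightarrow> 'v \<Rightarrow> bool" where
  "separating_vertex G v \<longleftrightarrow> (\<exists>A B. subgraph A G \<and> subgraph B G \<and>
     connected_graph A \<and> connected_graph B \<and> edges A \<noteq> {} \<and> edges B \<noteq> {} \<and>
     edges A \<union> edges B = edges G \<and> edges A \<inter> edges B = {} \<and>
     verts A \<union> verts B = verts G \<and> verts A \<inter> verts B = {v})"

definition nonseparable :: "('v, 'e) multigraph \<Rightarrow> bool" where
  "nonseparable G \<longleftrightarrow> connected_graph G \<and> \<not> (\<exists>v. separating_vertex G v)"

text \<open>
  Blocks are required to contain an edge; a connected graph with an edge has no other maximal
  nonseparable subgraphs, so this only says that the one-vertex graph without edges has no blocks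
  (and hence is a cactus).
\<close>

definition block :: "('v, 'e) multigraph \<Rightarrow> ('v, 'e) multigraph \<Rightarrow> bool" where
  "block B G \<longleftrightarrow> subgraph B G \<and> edges B \<noteq> {} \<and> nonseparable B \<and>
     (\<forall>C. subgraph C G \<and> nonseparable C \<and> subgraph B C \<longrightarrow> C = B)"

definition cactus :: "('v, 'e) multigraph \<Rightarrow> bool" where
  "cactus G \<longleftrightarrow> connected_graph G \<and> (\<forall>B. block B G \<longrightarrow> cycle_graph B \<or> single_edge_graph B)"

definition forest :: "('v, 'e) multigraph \<Rightarrow> 'e set \<Rightarrow> bool" where
  "forest G F \<longleftrightarrow> F \<subseteq> edges G \<and> \<not> (\<exists>C. subgraph C G \<and> cycle_graph C \<and> edges C \<subseteq> F)"


section \<open>Matroids\<close>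

record 'e matroid =
  ground :: "'e set"
  indep :: "'e set set"

definition cycle_matroid :: "('v, 'e) multigraph \<Rightarrow> 'e matroid" where
  "cycle_matroid G = \<lparr>ground = edges G, indep = {F. forest G F}\<rparr>"

definition bases :: "'e matroid \<Rightarrow> 'e set set" where
  "bases N = {B \<in> indep N. \<forall>I\<in>indep N. B \<subseteq> I \<longrightarrow> I = B}"

definition rk :: "'e matroid \<Rightarrow> 'e set \<Rightarrow> nat" where
  "rk N \<tau> = Max (card ` {I \<in> indep N. I \<subseteq> \<tau>})"

text \<open>
  The minimum is taken in \<^typ>\<open>enat\<close>: the value \<open>\<infinity>\<close> says that no set has nullity \<open>i\<close>, i.e. that
  the \<open>i\<close>-th higher weight does not exist. The subtraction does not truncate, as the rank of a set
  is at most its size.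
\<close>

definition higher_weight :: "'e matroid \<Rightarrow> nat \<Rightarrow> enat" where
  "higher_weight N i = (INF \<tau>\<in>{\<tau>. \<tau> \<subseteq> ground N \<and> card \<tau> - rk N \<tau> = i}. enat (card \<tau>))"


section \<open>Polynomial rings and facet ideals\<close>

type_synonym ('e, 'k) mpoly = "('e \<Rightarrow>\<^sub>0 nat) \<Rightarrow>\<^sub>0 'k"

text \<open>The polynomial ring with coefficients in \<open>'k\<close> and set of variables \<open>E\<close>.\<close>

definition poly_ring :: "'k::field itself \<Rightarrow> 'e set \<Rightarrow> ('e, 'k) mpoly ring" where
  "poly_ring _ E = \<lparr>carrier = {p. \<forall>m\<in>Poly_Mapping.keys p. Poly_Mapping.keys m \<subseteq> E},
     mult = (*), one = 1, zero = 0, add = (+)\<rparr>"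

definition indet :: "'e \<Rightarrow> ('e, 'k::field) mpoly" where
  "indet e = Poly_Mapping.single (Poly_Mapping.single e 1) 1"

definition irrelevant_ideal :: "'k::field itself \<Rightarrow> 'e set \<Rightarrow> ('e, 'k) mpoly set" where
  "irrelevant_ideal K E = Idl\<^bsub>poly_ring K E\<^esub> (indet ` E)"

definition facet_ideal :: "'k::field itself \<Rightarrow> 'e matroid \<Rightarrow> ('e, 'k) mpoly set" where
  "facet_ideal K N = Idl\<^bsub>poly_ring K (ground N)\<^esub> ((\<lambda>\<sigma>. \<Prod>j\<in>\<sigma>. indet j) ` bases N)"

lemma cring_poly_ring: "cring (poly_ring K E)"
proof -
  let ?C = "carrier (poly_ring K E)"
  have add: "p + q \<in> ?C" if "p \<in> ?C" "q \<in> ?C" for p q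
    using that Poly_Mapping.keys_add[of p q] by (auto simp: poly_ring_def)
  have mult: "p * q \<in> ?C" if "p \<in> ?C" "q \<in> ?C" for p q
  proof -
    have "Poly_Mapping.keys m \<subseteq> E" if "m \<in> Poly_Mapping.keys (p * q)" for m
    proof -
      obtain a b where m: "m = a + b" "a \<in> Poly_Mapping.keys p" "b \<in> Poly_Mapping.keys q"
        using \<open>m \<in> _\<close> keys_mult[of p q] by blast
      then show ?thesis
        using \<open>p \<in> ?C\<close> \<open>q \<in> ?C\<close> Poly_Mapping.keys_add[of a b]
        unfolding poly_ring_def by fastforce
    qed
    then show ?thesis by (simp add: poly_ring_def)
  qed
  have uminus: "- p \<in> ?C" if "p \<in> ?C" for p
    using that by (simp add: poly_ring_def)
  have zero: "0 \<in> ?C" and one: "1 \<in> ?C"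
    by (auto simp: poly_ring_def)
  have sel: "x \<oplus>\<^bsub>poly_ring K E\<^esub> y = x + y" "x \<otimes>\<^bsub>poly_ring K E\<^esub> y = x * y"
    "\<zero>\<^bsub>poly_ring K E\<^esub> = 0" "\<one>\<^bsub>poly_ring K E\<^esub> = 1" for x y
    by (simp_all add: poly_ring_def)
  show ?thesis
  proof (rule cringI)
    show "abelian_group (poly_ring K E)"
    proof (rule abelian_groupI)
      fix p assume "p \<in> ?C"
      then show "\<exists>q\<in>?C. q \<oplus>\<^bsub>poly_ring K E\<^esub> p = \<zero>\<^bsub>poly_ring K E\<^esub>"
        using uminus[of p] by (auto simp only: sel intro: bexI[where x = "- p"] left_minus)
    qed (simp_all only: sel add zero add_ac add_0_left add_0_right)
    show "Group.comm_monoid (poly_ring K E)"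
      by (rule comm_monoidI) (simp_all only: sel mult one mult_ac mult_1_left mult_1_right)
  qed (simp_all only: sel distrib_right)
qed


section \<open>Minimal free resolutions\<close>

text \<open>The record fields \<open>mult\<close> and \<open>one\<close> play no role for modules.\<close>

definition free_module :: "('a, 'r) ring_scheme \<Rightarrow> nat \<Rightarrow> ('a, nat \<Rightarrow> 'a) module" where
  "free_module R n = \<lparr>carrier = {..<n} \<rightarrow>\<^sub>E carrier R, mult = undefined, one = undefined,
     zero = (\<lambda>i\<in>{..<n}. \<zero>\<^bsub>R\<^esub>), add = (\<lambda>u v. \<lambda>i\<in>{..<n}. u i \<oplus>\<^bsub>R\<^esub> v i),
     smult = (\<lambda>a v. \<lambda>i\<in>{..<n}. a \<otimes>\<^bsub>R\<^esub> v i)\<rparr>"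

definition ideal_module :: "('a, 'r) ring_scheme \<Rightarrow> 'a set \<Rightarrow> ('a, 'a) module" where
  "ideal_module R I = \<lparr>carrier = I, mult = undefined, one = undefined,
     zero = \<zero>\<^bsub>R\<^esub>, add = (\<oplus>\<^bsub>R\<^esub>), smult = (\<otimes>\<^bsub>R\<^esub>)\<rparr>"

definition module_hom ::
  "('a, 'r) ring_scheme \<Rightarrow> ('a, 'b, 'm) module_scheme \<Rightarrow> ('a, 'c, 'n) module_scheme \<Rightarrow> ('b \<Rightarrow> 'c) set"
where
  "module_hom R M N = {f \<in> carrier M \<rightarrow> carrier N.
     (\<forall>x\<in>carrier M. \<forall>y\<in>carrier M. f (x \<oplus>\<^bsub>M\<^esub> y) = f x \<oplus>\<^bsub>N\<^esub> f y) \<and>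
     (\<forall>a\<in>carrier R. \<forall>x\<in>carrier M. f (a \<odot>\<^bsub>M\<^esub> x) = a \<odot>\<^bsub>N\<^esub> f x)}"

text \<open>The submodule \<open>I M\<close> for an ideal \<open>I\<close> and a module \<open>M\<close>: all finite sums of products.\<close>

inductive_set ideal_times :: "'a set \<Rightarrow> ('a, 'b, 'm) module_scheme \<Rightarrow> 'b set"
  for I and M (structure) where
  zero: "\<zero> \<in> ideal_times I M"
| add: "a \<in> I \<Longrightarrow> x \<in> carrier M \<Longrightarrow> y \<in> ideal_times I M \<Longrightarrow> a \<odot> x \<oplus> y \<in> ideal_times I M"

text \<open>
  The complex \<open>0 \<leftarrow> M \<leftarrow> R\<^bsup>\<beta> 0\<^esup> \<leftarrow> R\<^bsup>\<beta> 1\<^esup> \<leftarrow> \<dots>\<close> with augmentation \<open>\<epsilon>\<close> and differentials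
  \<open>\<phi> i : R\<^bsup>\<beta> (i + 1)\<^esup> \<rightarrow> R\<^bsup>\<beta> i\<^esup>\<close> is exact, and every differential (not the augmentation) maps into
  \<open>I\<close> times its target. A resolution of finite length is one with \<open>\<beta> i = 0\<close> for all large \<open>i\<close>.
\<close>

definition minimal_free_resolution ::
  "('a, 'r) ring_scheme \<Rightarrow> 'a set \<Rightarrow> ('a, 'b, 'm) module_scheme \<Rightarrow> (nat \<Rightarrow> nat) \<Rightarrow>
   ((nat \<Rightarrow> 'a) \<Rightarrow> 'b) \<Rightarrow> (nat \<Rightarrow> (nat \<Rightarrow> 'a) \<Rightarrow> (nat \<Rightarrow> 'a)) \<Rightarrow> bool"
where
  "minimal_free_resolution R I M \<beta> \<epsilon> \<phi> \<longleftrightarrow>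
     \<epsilon> \<in> module_hom R (free_module R (\<beta> 0)) M \<and>
     (\<forall>i. \<phi> i \<in> module_hom R (free_module R (\<beta> (Suc i))) (free_module R (\<beta> i))) \<and>
     \<epsilon> ` carrier (free_module R (\<beta> 0)) = carrier M \<and>
     {v \<in> carrier (free_module R (\<beta> 0)). \<epsilon> v = \<zero>\<^bsub>M\<^esub>} =
       \<phi> 0 ` carrier (free_module R (\<beta> (Suc 0))) \<and>
     (\<forall>i. {v \<in> carrier (free_module R (\<beta> (Suc i))). \<phi> i v = \<zero>\<^bsub>free_module R (\<beta> i)\<^esub>} =
       \<phi> (Suc i) ` carrier (free_module R (\<beta> (Suc (Suc i))))) \<and>
     (\<forall>i. \<phi> i ` carrier (free_module R (\<beta> (Suc i))) \<subseteq> ideal_times I (free_module R (\<beta> i)))"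

definition facet_ideal_resolution ::
  "'k::field itself \<Rightarrow> 'e matroid \<Rightarrow> (nat \<Rightarrow> nat) \<Rightarrow>
   ((nat \<Rightarrow> ('e, 'k) mpoly) \<Rightarrow> ('e, 'k) mpoly) \<Rightarrow>
   (nat \<Rightarrow> (nat \<Rightarrow> ('e, 'k) mpoly) \<Rightarrow> (nat \<Rightarrow> ('e, 'k) mpoly)) \<Rightarrow> bool"
where
  "facet_ideal_resolution K N \<beta> \<epsilon> \<phi> \<longleftrightarrow>
     minimal_free_resolution (poly_ring K (ground N)) (irrelevant_ideal K (ground N))
       (ideal_module (poly_ring K (ground N)) (facet_ideal K N)) \<beta> \<epsilon> \<phi>"

lemma module_free_module:
  assumes "cring R"
  shows "Module.module R (free_module R n)"
proof -
  interpret cring R by fact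
  show ?thesis
  proof (rule Module.moduleI)
    show "abelian_group (free_module R n)"
    proof (rule abelian_groupI)
      fix v assume v: "v \<in> carrier (free_module R n)"
      show "\<exists>w\<in>carrier (free_module R n). w \<oplus>\<^bsub>free_module R n\<^esub> v = \<zero>\<^bsub>free_module R n\<^esub>"
        using v by (intro bexI[of _ "\<lambda>i\<in>{..<n}. \<ominus>\<^bsub>R\<^esub> v i"])
          (auto simp: free_module_def PiE_iff l_neg intro!: restrict_ext)
    qed (auto simp: free_module_def PiE_iff a_ac extensional_def restrict_def fun_eq_iff)
  qed (use is_cring in \<open>auto simp: free_module_def PiE_iff l_distr r_distr m_assoc
      extensional_def restrict_def fun_eq_iff\<close>)
qed

lemma module_ideal_module:
  assumes "cring R" "ideal I R"
  shows "Module.module R (ideal_module R I)"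
proof -
  interpret cring R by fact
  interpret ideal I R by fact
  show ?thesis
  proof (rule Module.moduleI)
    show "abelian_group (ideal_module R I)"
    proof (rule abelian_groupI)
      fix x assume "x \<in> carrier (ideal_module R I)"
      then show "\<exists>y\<in>carrier (ideal_module R I). y \<oplus>\<^bsub>ideal_module R I\<^esub> x = \<zero>\<^bsub>ideal_module R I\<^esub>"
        by (intro bexI[of _ "\<ominus>\<^bsub>R\<^esub> x"]) (auto simp: ideal_module_def l_neg)
    qed (auto simp: ideal_module_def a_ac)
  qed (use assms(1) in \<open>auto simp: ideal_module_def l_distr r_distr m_assoc I_l_closed\<close>)
qed

end

theory Submission
  imports Defs "HOL-Library.Function_Algebras" "HOL-Computational_Algebra.Polynomial"
begin

text \<open>
  Two cycles of a cactus that share an edge coincide, since their union is nonseparable and hence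
  lies in a single block. So the cycle matroid is a direct sum of circuits \<open>C\<close> and coloops, and the
  \<open>i\<close>-th higher weight is the sum of the \<open>i\<close> smallest circuit sizes. The facet ideal is, up to a
  monomial, the product of the ideals of the circuits. These live in disjoint sets of variables,
  and the ideal of a circuit with \<open>n\<close> elements has the Hilbert--Burch resolution with Betti numbers
  \<open>n\<close> and \<open>n - 1\<close>. The tensor product of these resolutions is minimal, so by uniqueness of Betti
  numbers \<open>\<Sum>i. \<beta> i * t ^ i\<close> is the product of the factors \<open>card C + (card C - 1) * t\<close>. Unique
  factorisation recovers the circuit sizes.
\<close>

section \<open>Circuits of a cactus\<close>

text \<open>The tensor product is handled without Tor or a Kuenneth formula. Let \<open>J\<close> be
  the ideal of the coloops and of the circuits already treated. A variable \<open>c\<close> of a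
  further circuit occurs in none of the conditions defining \<open>J\<close>, so
  \<open>indet c * q\<close> lies in \<open>J\<close> only if \<open>q\<close> does. Hence a
  relation between the cofactors of the new circuit with coefficients in \<open>J\<close> comes from
  the Hilbert--Burch syzygies with coefficients again in \<open>J\<close>, and exactness follows by
  induction on the list of circuits. This induction keeps all homological degrees in one module,
  because removing a letter from words of one degree leaves words of two different degrees; the
  degrees are separated only afterwards. Minimality acts through constant coefficients alone:
  reduction modulo the irrelevant ideal makes the differentials vanish. A circuit of size 1 would
  contribute the factor 1 and leave no trace in the Betti numbers, although it changes the weights;
  this is why loops are excluded.\<close>

lemma sym_rtrancl_adjacency: "(u, v) \<in> (adjacency G)\<^sup>* \<Longrightarrow> (v, u) \<in> (adjacency G)\<^sup>*"
  by (rule symD[OF sym_rtrancl]) (auto simp: sym_def adjacency_def insert_commute)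

lemma ends_subset_verts: "graph G \<Longrightarrow> e \<in> edges G \<Longrightarrow> ends G e \<subseteq> verts G"
  by (simp add: graph_def)

lemma ends_nonempty: "graph G \<Longrightarrow> e \<in> edges G \<Longrightarrow> ends G e \<noteq> {}"
  by (auto simp: graph_def)

lemma subgraph_trans: "subgraph A B \<Longrightarrow> subgraph B C \<Longrightarrow> subgraph A C"
  by (auto simp: subgraph_def)

lemma adjacency_mono: "edges A \<subseteq> edges B \<Longrightarrow> ends A = ends B \<Longrightarrow> adjacency A \<subseteq> adjacency B"
  by (auto simp: adjacency_def)

section \<open>Nonseparability in terms of partitions of the edge set\<close>

lemma graph_induced:
  assumes "graph P" "X \<subseteq> edges P" "X \<noteq> {}"
  shows "subgraph \<lparr>verts = \<Union>(ends P ` X), edges = X, ends = ends P\<rparr> P"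
proof -
  have "finite (\<Union>(ends P ` X))"
    by (rule finite_subset[of _ "verts P"]) (use assms in \<open>auto simp: graph_def\<close>)
  moreover have "\<Union>(ends P ` X) \<noteq> {}"
    using assms ends_nonempty[of P] by blast
  ultimately show ?thesis
    using assms by (auto simp: subgraph_def graph_def intro: finite_subset)
qed

text \<open>A path in \<open>P\<close> from a vertex of the \<open>X\<close>-side to
  \<open>v\<close> is followed only until it first meets \<open>v\<close>. Before that it cannot
  leave \<open>X\<close>: an edge of \<open>Y\<close> would start at a vertex common to both sides,
  and only \<open>v\<close> is common.\<close>

lemma connected_induced_part:
  assumes P: "connected_graph P" and XY: "edges P = X \<union> Y" "X \<noteq> {}"
    and v: "v \<in> \<Union>(ends P ` X)" "\<Union>(ends P ` X) \<inter> \<Union>(ends P ` Y) \<subseteq> {v}"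
  shows "connected_graph \<lparr>verts = \<Union>(ends P ` X), edges = X, ends = ends P\<rparr>"
proof -
  define A where "A = \<lparr>verts = \<Union>(ends P ` X), edges = X, ends = ends P\<rparr>"
  have gP: "graph P" using P by (simp add: connected_graph_def)
  have sub: "subgraph A P" unfolding A_def using gP XY by (intro graph_induced) auto
  have reach: "(u, v) \<in> (adjacency A)\<^sup>*" if "u \<in> verts A" for u
  proof -
    have "verts A \<subseteq> verts P" "v \<in> verts A" using sub v by (auto simp: subgraph_def A_def)
    then have "(u, v) \<in> (adjacency P)\<^sup>*"
      using P that by (auto simp: connected_graph_def)
    then show ?thesis using that
    proof (induction rule: converse_rtrancl_induct)
      case (step u u')
      show ?case
      proof (cases "u = v")
        case False
        obtain e where e: "e \<in> edges P" "ends P e = {u, u'}"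
          using step.hyps by (auto simp: adjacency_def)
        have "e \<in> X"
        proof (rule ccontr)
          assume "e \<notin> X"
          then have "u \<in> \<Union>(ends P ` Y)" using e XY by auto
          then show False using v False step.prems by (auto simp: A_def)
        qed
        then have "(u, u') \<in> adjacency A" "u' \<in> verts A"
          using e by (auto simp: A_def adjacency_def)
        then show ?thesis using step.IH by (meson converse_rtrancl_into_rtrancl)
      qed simp
    qed simp
  qed
  have "connected_graph A"
    using sub reach sym_rtrancl_adjacency
    unfolding connected_graph_def by (metis rtrancl_trans subgraph_def)
  then show ?thesis by (simp add: A_def)
qed

text \<open>Together with \<open>nonseparableI\<close> this replaces separating subgraphs by
  partitions of the edges. Connectedness forces the ends of the two parts to cover all vertices and
  to have a vertex in common, so "at most one common vertex" becomes "exactly one", as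
  \<open>separating_vertex\<close> demands.\<close>

lemma nonseparable_split:
  assumes P: "nonseparable P" and XY: "edges P = X \<union> Y" "X \<inter> Y = {}" "X \<noteq> {}" "Y \<noteq> {}"
    and v: "\<Union>(ends P ` X) \<inter> \<Union>(ends P ` Y) \<subseteq> {v}"
  shows False
proof -
  let ?VX = "\<Union>(ends P ` X)" and ?VY = "\<Union>(ends P ` Y)"
  have con: "connected_graph P" and gP: "graph P"
    using P by (simp_all add: nonseparable_def connected_graph_def)
  obtain x y where xy: "x \<in> X" "y \<in> Y" using XY by blast
  then have "ends P x \<noteq> {}" "ends P y \<noteq> {}" using ends_nonempty[OF gP] XY by auto
  then obtain a b where ab: "a \<in> ?VX" "b \<in> ?VY" using xy by blast
  have VXY: "?VX \<subseteq> verts P" "?VY \<subseteq> verts P"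
    using XY ends_subset_verts[OF gP] by auto
  \<comment> \<open>The first two conjuncts show that no vertex is isolated; the last one, carried
    along a path from \<open>a\<close> to \<open>b\<close>, shows that the two sides meet.\<close>
  have adj: "u \<in> ?VX \<union> ?VY \<and> w \<in> ?VX \<union> ?VY \<and> (u \<in> ?VX \<longrightarrow> ?VX \<inter> ?VY = {} \<longrightarrow> w \<in> ?VX)"
    if uw: "(u, w) \<in> adjacency P" for u w
  proof -
    obtain e where e: "e \<in> edges P" "ends P e = {u, w}" using uw by (auto simp: adjacency_def)
    show ?thesis
    proof (cases "e \<in> X")
      case True then have "u \<in> ?VX" "w \<in> ?VX" using e by auto
      then show ?thesis by blast
    next
      case False then have "e \<in> Y" using e XY by auto
      then have "u \<in> ?VY" "w \<in> ?VY" using e by auto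
      then show ?thesis by blast
    qed
  qed
  have verts: "verts P = ?VX \<union> ?VY"
  proof
    show "verts P \<subseteq> ?VX \<union> ?VY"
    proof
      fix u assume "u \<in> verts P"
      then have "(u, a) \<in> (adjacency P)\<^sup>*" using con ab VXY by (auto simp: connected_graph_def)
      then show "u \<in> ?VX \<union> ?VY"
      proof (cases rule: converse_rtranclE)
        case base then show ?thesis using ab by blast
      next
        case (step y) show ?thesis using adj[OF step(1)] by blast
      qed
    qed
  qed (use VXY in blast)
  have "?VX \<inter> ?VY \<noteq> {}"
  proof
    assume dis: "?VX \<inter> ?VY = {}"
    have "(a, b) \<in> (adjacency P)\<^sup>*" using con ab VXY by (auto simp: connected_graph_def)
    then have "b \<in> ?VX"
    proof (induction rule: rtrancl_induct)
      case base show ?case by (rule ab(1))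
    next
      case (step y z) show ?case using adj[OF step(2)] step(3) dis by blast
    qed
    then show False using ab dis by blast
  qed
  then have eq: "?VX \<inter> ?VY = {v}" using v by blast
  have "separating_vertex P v"
    unfolding separating_vertex_def
  proof (intro exI conjI)
    let ?A = "\<lparr>verts = ?VX, edges = X, ends = ends P\<rparr>"
    let ?B = "\<lparr>verts = ?VY, edges = Y, ends = ends P\<rparr>"
    show "subgraph ?A P" "subgraph ?B P" using XY gP by (auto intro!: graph_induced)
    show "connected_graph ?A"
      using XY eq by (intro connected_induced_part[OF con, of X Y v]) auto
    show "connected_graph ?B"
      using XY eq by (intro connected_induced_part[OF con, of Y X v]) auto
  qed (use XY eq verts in auto)
  then show False using P by (auto simp: nonseparable_def)
qed

lemma nonseparableI:
  assumes con: "connected_graph P"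
    and split: "\<And>X Y v. edges P = X \<union> Y \<Longrightarrow> X \<inter> Y = {} \<Longrightarrow> X \<noteq> {} \<Longrightarrow> Y \<noteq> {} \<Longrightarrow>
      \<Union>(ends P ` X) \<inter> \<Union>(ends P ` Y) \<subseteq> {v} \<Longrightarrow> False"
  shows "nonseparable P"
  unfolding nonseparable_def
proof (intro conjI notI)
  assume "\<exists>v. separating_vertex P v"
  then obtain v A B where AB: "subgraph A P" "subgraph B P" "edges A \<noteq> {}" "edges B \<noteq> {}"
    "edges A \<union> edges B = edges P" "edges A \<inter> edges B = {}" "verts A \<inter> verts B = {v}"
    unfolding separating_vertex_def by metis
  have "\<Union>(ends P ` edges A) \<subseteq> verts A" "\<Union>(ends P ` edges B) \<subseteq> verts B"
    using AB ends_subset_verts unfolding subgraph_def by (metis UN_least)+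
  then have "\<Union>(ends P ` edges A) \<inter> \<Union>(ends P ` edges B) \<subseteq> {v}" using AB by blast
  then show False using split[of "edges A" "edges B" v] AB by simp
qed (rule con)

text \<open>Consecutive edges of a cycle share a vertex. If that vertex is not \<open>v\<close>,
  they belong to the same part; going once around the cycle from \<open>v\<close>, all edges are
  seen to lie in one part.\<close>

lemma nonseparable_cycle:
  assumes "cycle_graph C" "graph C"
  shows "nonseparable C"
proof -
  obtain vs es where c: "vs \<noteq> []" "length es = length vs" "distinct vs" "distinct es"
    "verts C = set vs" "edges C = set es"
    "\<And>i. i < length vs \<Longrightarrow> ends C (es ! i) = {vs ! i, vs ! (Suc i mod length vs)}"
    using assms(1) unfolding cycle_graph_def by blast
  let ?n = "length vs"
  have n: "?n > 0" using c by simp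
  have reach: "(vs ! 0, vs ! i) \<in> (adjacency C)\<^sup>*" if "i < ?n" for i
    using that
  proof (induction i)
    case (Suc i)
    have "(vs ! i, vs ! Suc i) \<in> adjacency C"
      using c(7)[of i] Suc.prems c(2,6) by (auto simp: adjacency_def intro!: bexI[of _ "es ! i"])
    then show ?case using Suc by (meson Suc_lessD rtrancl.rtrancl_into_rtrancl)
  qed simp
  have con: "connected_graph C"
    unfolding connected_graph_def c(5)
  proof (intro conjI ballI)
    fix u v assume "u \<in> set vs" "v \<in> set vs"
    then show "(u, v) \<in> (adjacency C)\<^sup>*"
      using reach sym_rtrancl_adjacency by (metis in_set_conv_nth rtrancl_trans)
  qed fact
  show ?thesis
  proof (rule nonseparableI[OF con])
    fix X Y v
    assume XY: "edges C = X \<union> Y" "X \<inter> Y = {}" "X \<noteq> {}" "Y \<noteq> {}"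
      and v: "\<Union>(ends C ` X) \<inter> \<Union>(ends C ` Y) \<subseteq> {v}"
    \<comment> \<open>The position of \<open>v\<close> on the cycle, or any position if
      \<open>v\<close> does not lie on it.\<close>
    obtain k where k: "k < ?n" "\<And>i. i < ?n \<Longrightarrow> vs ! i = v \<Longrightarrow> i = k"
      using c(3) n nth_eq_iff_index_eq by metis
    \<comment> \<open>The bound on \<open>j\<close> ensures that the walk does not return to
      position \<open>k\<close>, so the vertices passed on the way differ from
      \<open>v\<close>.\<close>
    have same: "es ! ((k + j) mod ?n) \<in> X \<longleftrightarrow> es ! k \<in> X" if "j < ?n" for j
      using that
    proof (induction j)
      case (Suc j)
      let ?a = "(k + j) mod ?n" and ?b = "(k + Suc j) mod ?n"
      have b: "?b = Suc ?a mod ?n" by (simp add: mod_Suc_eq)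
      have ab: "?a < ?n" "?b < ?n" using n by auto
      have "?b \<noteq> k"
      proof
        assume "?b = k"
        moreover have "?b = (if k + Suc j < ?n then k + Suc j else k + Suc j - ?n)"
          using k(1) Suc.prems by (simp add: le_mod_geq)
        ultimately show False using Suc.prems k(1) by (simp split: if_splits)
      qed
      then have nv: "vs ! ?b \<noteq> v" using k(2) ab by blast
      have "vs ! ?b \<in> ends C (es ! ?a)" "vs ! ?b \<in> ends C (es ! ?b)"
        using c(7)[OF ab(1)] c(7)[OF ab(2)] b by auto
      moreover have "es ! ?a \<in> X \<union> Y" "es ! ?b \<in> X \<union> Y"
        using XY(1) c(2,6) ab by (metis nth_mem)+
      ultimately have "es ! ?a \<in> X \<longleftrightarrow> es ! ?b \<in> X"
        using v nv XY(2) by blast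
      then show ?case using Suc by simp
    qed (use k in simp)
    have all: "e \<in> X \<longleftrightarrow> es ! k \<in> X" if e: "e \<in> set es" for e
    proof -
      obtain i where i: "i < ?n" "e = es ! i" using e c(2) by (metis in_set_conv_nth)
      let ?j = "(i + (?n - k)) mod ?n"
      have "(k + ?j) mod ?n = (k + (i + (?n - k))) mod ?n" by (simp add: mod_simps)
      also have "k + (i + (?n - k)) = i + ?n" using k(1) by simp
      finally have "(k + ?j) mod ?n = i" using i by simp
      moreover have "?j < ?n" using n by simp
      ultimately show ?thesis using same[of ?j] i by simp
    qed
    show False using all XY c(6) by blast
  qed
qed

text \<open>A partition of the edges of the union that separates it would also separate
  \<open>P\<close> or \<open>Q\<close>, unless each of them lies entirely in one part. The common
  edge puts both into the same part, so the other part is empty.\<close>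

lemma nonseparable_union:
  assumes P: "subgraph P G" "nonseparable P" and Q: "subgraph Q G" "nonseparable Q"
    and e: "e \<in> edges P" "e \<in> edges Q"
  defines "U \<equiv> \<lparr>verts = verts P \<union> verts Q, edges = edges P \<union> edges Q, ends = ends G\<rparr>"
  shows "subgraph U G" "nonseparable U"
proof -
  have "ends G d \<subseteq> verts P \<union> verts Q \<and> card (ends G d) \<in> {1, 2}" if "d \<in> edges P \<union> edges Q" for d
    using that P(1) Q(1) unfolding subgraph_def graph_def by (metis Un_iff le_supI1 le_supI2)
  then have "graph U" using P(1) Q(1) by (simp add: U_def subgraph_def graph_def)
  then show sub: "subgraph U G" using P Q by (simp add: U_def subgraph_def)
  have ends: "ends P = ends U" "ends Q = ends U" using P Q by (auto simp: U_def subgraph_def)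
  obtain w where w: "w \<in> ends P e"
    using ends_nonempty e P by (metis ex_in_conv subgraph_def)
  then have wPQ: "w \<in> verts P" "w \<in> verts Q"
    using ends_subset_verts e P Q ends by (metis subgraph_def subsetD)+
  have "(adjacency P)\<^sup>* \<subseteq> (adjacency U)\<^sup>*" "(adjacency Q)\<^sup>* \<subseteq> (adjacency U)\<^sup>*"
    using ends by (intro rtrancl_mono adjacency_mono; simp add: U_def)+
  then have reach: "(u, w) \<in> (adjacency U)\<^sup>*" if "u \<in> verts U" for u
    using that wPQ P(2) Q(2) by (auto simp: U_def nonseparable_def connected_graph_def)
  have con: "connected_graph U"
    using sub reach sym_rtrancl_adjacency
    unfolding connected_graph_def by (metis rtrancl_trans subgraph_def)
  show "nonseparable U"
  proof (rule nonseparableI[OF con])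
    fix X Y v
    assume XY: "edges U = X \<union> Y" "X \<inter> Y = {}" "X \<noteq> {}" "Y \<noteq> {}"
      and v: "\<Union>(ends U ` X) \<inter> \<Union>(ends U ` Y) \<subseteq> {v}"
    have part: "edges R \<subseteq> X \<or> edges R \<subseteq> Y"
      if R: "nonseparable R" "edges R \<subseteq> edges U" "ends R = ends U" for R
    proof (rule ccontr)
      assume "\<not> ?thesis"
      then have "edges R = (edges R \<inter> X) \<union> (edges R \<inter> Y)" "(edges R \<inter> X) \<inter> (edges R \<inter> Y) = {}"
        "edges R \<inter> X \<noteq> {}" "edges R \<inter> Y \<noteq> {}"
        using R(2) XY(1,2) by blast+
      moreover have "\<Union>(ends R ` (edges R \<inter> X)) \<inter> \<Union>(ends R ` (edges R \<inter> Y)) \<subseteq> {v}"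
        using v R(3) by auto
      ultimately show False by (rule nonseparable_split[OF R(1)])
    qed
    have "edges P \<subseteq> X \<or> edges P \<subseteq> Y" "edges Q \<subseteq> X \<or> edges Q \<subseteq> Y"
      using part[OF P(2)] part[OF Q(2)] ends by (auto simp: U_def)
    then show False using e XY unfolding U_def by auto
  qed
qed

text \<open>Among the finitely bounded candidates one with the most vertices plus edges is maximal:
  a subgraph is determined by its vertices and edges, so a larger candidate would have a larger
  count.\<close>

lemma nonseparable_in_block:
  assumes C: "subgraph C G" "nonseparable C" "edges C \<noteq> {}"
  shows "\<exists>B. block B G \<and> subgraph C B"
proof -
  let ?P = "\<lambda>B. subgraph B G \<and> nonseparable B \<and> subgraph C B"
  let ?f = "\<lambda>B :: ('a, 'b) multigraph. card (verts B) + card (edges B)"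
  have fin: "finite (verts G)" "finite (edges G)" using C by (auto simp: subgraph_def graph_def)
  have "subgraph C C" using C by (auto simp: subgraph_def)
  then have PC: "?P C" using C by simp
  have "?f D \<le> ?f G" if "?P D" for D
    using that fin by (intro add_mono card_mono) (auto simp: subgraph_def)
  then obtain B where B: "?P B" "\<And>D. ?P D \<Longrightarrow> ?f D \<le> ?f B"
    using ex_has_greatest_nat[of ?P C ?f "Suc (?f G)", OF PC] by (auto simp: less_Suc_eq_le)
  have "D = B" if D: "subgraph D G" "nonseparable D" "subgraph B D" for D
  proof -
    have "?f D \<le> ?f B" using B D by (meson subgraph_trans)
    moreover have "finite (verts D)" "finite (edges D)" "verts B \<subseteq> verts D" "edges B \<subseteq> edges D"
      using D by (auto simp: subgraph_def graph_def)
    moreover from this have "card (verts B) \<le> card (verts D)" "card (edges B) \<le> card (edges D)"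
      by (auto intro: card_mono)
    ultimately have "verts B = verts D" "edges B = edges D"
      by (intro card_seteq; linarith)+
    then show "D = B" using D by (simp add: subgraph_def)
  qed
  moreover have "edges B \<noteq> {}" using B(1) C(3) by (auto simp: subgraph_def)
  ultimately have "block B G" using B(1) by (auto simp: block_def)
  then show ?thesis using B(1) by blast
qed

section \<open>Vertex degrees in cycles, and cycles inside a cactus\<close>

lemma cycle_graph_length:
  assumes "length es = length vs" "vs \<noteq> []"
    "\<And>i. i < length vs \<Longrightarrow> ends C (es ! i) = {vs ! i, vs ! (Suc i mod length vs)}"
    "edges C = set es" "loop_free C"
  shows "2 \<le> length vs"
proof (rule ccontr)
  assume "\<not> ?thesis"
  moreover have "length vs \<noteq> 0" using assms(2) by simp
  ultimately have "length vs = 1" by linarith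
  then have "card (ends C (es ! 0)) = 1" "es ! 0 \<in> edges C"
    using assms by auto
  then show False using assms(5) by (auto simp: loop_free_def)
qed

lemma cycle_graph_card_edges: "cycle_graph C \<Longrightarrow> loop_free C \<Longrightarrow> 2 \<le> card (edges C)"
  unfolding cycle_graph_def using cycle_graph_length by (metis distinct_card)

text \<open>The vertex is addressed as the successor of position \<open>i\<close>, so that its two
  edges are \<open>es ! i\<close> and the next one in cyclic order, which suits a walk along the
  edges. Length at least 2 makes these edges distinct; for length 2 they are parallel.\<close>

lemma cycle_incident_edges:
  assumes "length es = length vs" "distinct vs" "distinct es" "edges C = set es" "2 \<le> length vs"
    "\<And>i. i < length vs \<Longrightarrow> ends C (es ! i) = {vs ! i, vs ! (Suc i mod length vs)}"
    and i: "i < length vs"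
  shows "{e \<in> edges C. vs ! (Suc i mod length vs) \<in> ends C e} = {es ! i, es ! (Suc i mod length vs)}"
    and "card {e \<in> edges C. vs ! (Suc i mod length vs) \<in> ends C e} = 2"
proof -
  let ?n = "length vs"
  have s: "Suc i mod ?n < ?n" by (rule mod_less_divisor) (use i in linarith)
  have ne: "Suc i mod ?n \<noteq> i" using i assms(5) by (auto simp: mod_Suc)
  have "j = i \<or> j = Suc i mod ?n"
    if j: "j < ?n" and mem: "vs ! (Suc i mod ?n) \<in> ends C (es ! j)" for j
  proof -
    have "Suc i mod ?n = j \<or> Suc i mod ?n = Suc j mod ?n"
    proof -
      have "Suc j mod ?n < ?n" by (rule mod_less_divisor) (use i in linarith)
      then show ?thesis
        using mem assms(6)[OF j] s j assms(2) by (auto simp: nth_eq_iff_index_eq)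
    qed
    then show ?thesis using i j by (auto simp: mod_Suc split: if_splits)
  qed
  then show eq: "{e \<in> edges C. vs ! (Suc i mod ?n) \<in> ends C e} = {es ! i, es ! (Suc i mod ?n)}"
    using assms(6)[OF i] assms(6)[OF s] i s assms(1,4) by (auto simp: in_set_conv_nth)
  show "card {e \<in> edges C. vs ! (Suc i mod ?n) \<in> ends C e} = 2"
    unfolding eq using ne i s assms(1,3) by (simp add: nth_eq_iff_index_eq)
qed

lemma cycle_graph_degree:
  assumes "cycle_graph C" "loop_free C" "u \<in> verts C"
  shows "card {e \<in> edges C. u \<in> ends C e} = 2"
proof -
  obtain vs es where c: "vs \<noteq> []" "length es = length vs" "distinct vs" "distinct es"
    "verts C = set vs" "edges C = set es"
    "\<And>i. i < length vs \<Longrightarrow> ends C (es ! i) = {vs ! i, vs ! (Suc i mod length vs)}"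
    using assms(1) unfolding cycle_graph_def by blast
  have n: "2 \<le> length vs" using c assms by (intro cycle_graph_length[of es vs C]) auto
  obtain j where j: "j < length vs" "u = vs ! j" using assms(3) c(5) by (metis in_set_conv_nth)
  have "\<exists>i<length vs. Suc i mod length vs = j"
    using j n by (intro exI[of _ "if j = 0 then length vs - 1 else j - 1"]) (auto simp: mod_Suc)
  then show ?thesis using cycle_incident_edges(2)[of es vs C] c n j by auto
qed

text \<open>At a vertex of \<open>C\<close> both \<open>C\<close> and \<open>B\<close> have exactly
  two edges, so every edge of \<open>B\<close> there belongs to \<open>C\<close>. Starting from one
  edge of \<open>C\<close>, this propagates around \<open>B\<close>.\<close>

lemma cycle_in_cycle:
  assumes C: "cycle_graph C" and B: "cycle_graph B" and sub: "subgraph C B" and lf: "loop_free B"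
  shows "edges C = edges B"
proof -
  obtain vs es where c: "vs \<noteq> []" "length es = length vs" "distinct vs" "distinct es"
    "verts B = set vs" "edges B = set es"
    "\<And>i. i < length vs \<Longrightarrow> ends B (es ! i) = {vs ! i, vs ! (Suc i mod length vs)}"
    using B unfolding cycle_graph_def by blast
  let ?n = "length vs"
  have n: "2 \<le> ?n" using c lf by (intro cycle_graph_length[of es vs B]) auto
  have s: "ends C = ends B" "edges C \<subseteq> edges B" "graph C" using sub by (auto simp: subgraph_def)
  have lfC: "loop_free C" using lf s by (auto simp: loop_free_def)
  have step: "es ! (Suc i mod ?n) \<in> edges C" if i: "i < ?n" "es ! i \<in> edges C" for i
  proof -
    let ?u = "vs ! (Suc i mod ?n)"
    have "?u \<in> verts C" using ends_subset_verts[OF s(3) i(2)] c(7)[OF i(1)] s(1) by auto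
    then have "card {e \<in> edges C. ?u \<in> ends B e} = card {e \<in> edges B. ?u \<in> ends B e}"
      using cycle_graph_degree[OF C lfC] cycle_incident_edges(2)[of es vs B] c n i s by simp
    moreover have "finite {e \<in> edges B. ?u \<in> ends B e}" using c by simp
    ultimately have "{e \<in> edges C. ?u \<in> ends B e} = {e \<in> edges B. ?u \<in> ends B e}"
      using s by (intro card_subset_eq) auto
    then show ?thesis using cycle_incident_edges(1)[of es vs B i] c n i by blast
  qed
  obtain k where k: "k < ?n" "es ! k \<in> edges C"
    using cycle_graph_card_edges[OF C lfC] s c
    by (metis card.empty ex_in_conv in_set_conv_nth not_numeral_le_zero subsetD)
  have "es ! ((k + j) mod ?n) \<in> edges C" for j
  proof (induction j)
    case (Suc j)
    have "(k + Suc j) mod ?n = Suc ((k + j) mod ?n) mod ?n" by (simp add: mod_Suc_eq)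
    moreover have "(k + j) mod ?n < ?n" by (rule mod_less_divisor) (use k in linarith)
    ultimately show ?case using step[OF _ Suc] by simp
  qed (use k in simp)
  moreover have "\<exists>j. (k + j) mod ?n = i" if "i < ?n" for i
    using that k by (intro exI[of _ "i + (?n - k)"]) simp
  ultimately have "es ! i \<in> edges C" if "i < ?n" for i using that by metis
  then have "set es \<subseteq> edges C" using c(2) by (auto simp: in_set_conv_nth)
  then show ?thesis using s c by auto
qed

definition circuits :: "('v, 'e) multigraph \<Rightarrow> 'e set set" where
  "circuits G = {edges C | C. subgraph C G \<and> cycle_graph C}"

lemma circuits_eqI:
  assumes G: "cactus G" "loop_free G" and XY: "X \<in> circuits G" "Y \<in> circuits G" "e \<in> X" "e \<in> Y"
  shows "X = Y"
proof -
  obtain C D where C: "X = edges C" "subgraph C G" "cycle_graph C"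
    and D: "Y = edges D" "subgraph D G" "cycle_graph D" using XY by (auto simp: circuits_def)
  have ns: "nonseparable C" "nonseparable D"
    using C D by (auto intro: nonseparable_cycle simp: subgraph_def)
  define U where "U = \<lparr>verts = verts C \<union> verts D, edges = edges C \<union> edges D, ends = ends G\<rparr>"
  have U: "subgraph U G" "nonseparable U"
    using nonseparable_union[of C G D e] C D XY ns by (auto simp: U_def)
  then obtain B where B: "block B G" "subgraph U B"
    using nonseparable_in_block[of U G] XY C by (auto simp: U_def)
  have sub: "subgraph C B" "subgraph D B"
    using B(2) C(2) D(2) by (auto simp: subgraph_def U_def)
  have lf: "loop_free B" "loop_free C" using G(2) B(1) C(2)
    unfolding loop_free_def block_def subgraph_def by auto
  \<comment> \<open>\<open>B\<close> contains \<open>C\<close>, and a cycle without loops has at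
    least two edges.\<close>
  have "\<not> single_edge_graph B"
  proof
    assume "single_edge_graph B"
    then have "card (edges B) = 1" by (auto simp: single_edge_graph_def)
    moreover have "card (edges C) \<le> card (edges B)"
      using sub by (auto simp: subgraph_def graph_def intro: card_mono)
    ultimately show False using cycle_graph_card_edges[OF C(3) lf(2)] by simp
  qed
  then have "cycle_graph B" using G(1) B(1) by (auto simp: cactus_def)
  then show ?thesis using cycle_in_cycle C D sub lf by metis
qed

lemma circuits_card: "loop_free G \<Longrightarrow> X \<in> circuits G \<Longrightarrow> 2 \<le> card X"
  using cycle_graph_card_edges by (force simp: circuits_def loop_free_def subgraph_def)

lemma circuits_subset: "X \<in> circuits G \<Longrightarrow> X \<subseteq> edges G"
  by (auto simp: circuits_def subgraph_def)

lemma indep_cycle_matroid: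
  "indep (cycle_matroid G) = {F. F \<subseteq> edges G \<and> (\<forall>C\<in>circuits G. \<not> C \<subseteq> F)}"
  by (auto simp: cycle_matroid_def forest_def circuits_def)

section \<open>Uniqueness of Betti numbers\<close>

text \<open>Polynomials in the variables \<open>E\<close> are only a subset of the type of all
  polynomials, so the homological algebra is carried out over a subset of a commutative
  ring.\<close>

definition is_subring :: "'a::comm_ring_1 set \<Rightarrow> bool" where
  "is_subring R \<longleftrightarrow> 0 \<in> R \<and> 1 \<in> R \<and> (\<forall>x\<in>R. \<forall>y\<in>R. x + y \<in> R \<and> x * y \<in> R) \<and> (\<forall>x\<in>R. - x \<in> R)"

text \<open>Vectors are 0 outside the index set, which makes addition, scaling and sums pointwise.
  Index sets are arbitrary because words will serve as basis elements.\<close>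

definition free_on :: "'a::comm_ring_1 set \<Rightarrow> 'i set \<Rightarrow> ('i \<Rightarrow> 'a) set" where
  "free_on R A = {u. (\<forall>i\<in>A. u i \<in> R) \<and> (\<forall>i. i \<notin> A \<longrightarrow> u i = 0)}"

definition unit_vec :: "'i \<Rightarrow> 'i \<Rightarrow> 'a::comm_ring_1" where
  "unit_vec a = (\<lambda>i. if i = a then 1 else 0)"

definition linear_on ::
  "'a::comm_ring_1 set \<Rightarrow> 'i set \<Rightarrow> 'j set \<Rightarrow> (('i \<Rightarrow> 'a) \<Rightarrow> ('j \<Rightarrow> 'a)) \<Rightarrow> bool"
where
  "linear_on R A B f \<longleftrightarrow> (\<forall>u\<in>free_on R A. f u \<in> free_on R B) \<and>
     (\<forall>u\<in>free_on R A. \<forall>v\<in>free_on R A. f (\<lambda>i. u i + v i) = (\<lambda>j. f u j + f v j)) \<and>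
     (\<forall>r\<in>R. \<forall>u\<in>free_on R A. f (\<lambda>i. r * u i) = (\<lambda>j. r * f u j))"

definition ker_on :: "'a::comm_ring_1 set \<Rightarrow> 'i set \<Rightarrow> (('i \<Rightarrow> 'a) \<Rightarrow> ('j \<Rightarrow> 'a)) \<Rightarrow> ('i \<Rightarrow> 'a) set" where
  "ker_on R A f = {u \<in> free_on R A. f u = (\<lambda>j. 0)}"

section \<open>Linear algebra over a subring\<close>

lemma is_subring_sum: "is_subring R \<Longrightarrow> (\<And>i. i \<in> A \<Longrightarrow> f i \<in> R) \<Longrightarrow> sum f A \<in> R"
  by (induction A rule: infinite_finite_induct) (auto simp: is_subring_def)

lemma free_on_zero: "is_subring R \<Longrightarrow> (\<lambda>i. 0) \<in> free_on R A"
  by (auto simp: free_on_def is_subring_def)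

lemma free_on_add: "is_subring R \<Longrightarrow> u \<in> free_on R A \<Longrightarrow> v \<in> free_on R A \<Longrightarrow> (\<lambda>i. u i + v i) \<in> free_on R A"
  by (auto simp: free_on_def is_subring_def)

lemma free_on_smult: "is_subring R \<Longrightarrow> r \<in> R \<Longrightarrow> u \<in> free_on R A \<Longrightarrow> (\<lambda>i. r * u i) \<in> free_on R A"
  by (auto simp: free_on_def is_subring_def)

lemma free_on_diff: "is_subring R \<Longrightarrow> u \<in> free_on R A \<Longrightarrow> v \<in> free_on R A \<Longrightarrow> (\<lambda>i. u i - v i) \<in> free_on R A"
  unfolding is_subring_def free_on_def by (simp add: diff_conv_add_uminus del: add_uminus_conv_diff)

lemma free_on_sum:
  "is_subring R \<Longrightarrow> (\<And>k. k \<in> K \<Longrightarrow> f k \<in> free_on R A) \<Longrightarrow> (\<lambda>i. \<Sum>k\<in>K. f k i) \<in> free_on R A"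
  by (auto simp: free_on_def intro!: is_subring_sum sum.neutral)

lemma free_onD: "is_subring R \<Longrightarrow> u \<in> free_on R A \<Longrightarrow> u i \<in> R"
  by (cases "i \<in> A") (auto simp: free_on_def is_subring_def)

lemma unit_vec_free: "is_subring R \<Longrightarrow> a \<in> A \<Longrightarrow> unit_vec a \<in> free_on R A"
  by (auto simp: free_on_def unit_vec_def is_subring_def)

lemma linear_on_closed: "linear_on R A B f \<Longrightarrow> u \<in> free_on R A \<Longrightarrow> f u \<in> free_on R B"
  by (simp add: linear_on_def)

lemma linear_on_add:
  "linear_on R A B f \<Longrightarrow> u \<in> free_on R A \<Longrightarrow> v \<in> free_on R A \<Longrightarrow>
    f (\<lambda>i. u i + v i) = (\<lambda>j. f u j + f v j)"
  by (simp add: linear_on_def)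

lemma linear_on_smult:
  "linear_on R A B f \<Longrightarrow> r \<in> R \<Longrightarrow> u \<in> free_on R A \<Longrightarrow> f (\<lambda>i. r * u i) = (\<lambda>j. r * f u j)"
  by (simp add: linear_on_def)

lemma linear_on_zero:
  assumes "is_subring R" "linear_on R A B f"
  shows "f (\<lambda>i. 0) = (\<lambda>j. 0)"
proof -
  have "f (\<lambda>i. 0 * (0 :: 'a)) = (\<lambda>j. 0 * f (\<lambda>i. 0) j)"
    using assms(1) by (intro linear_on_smult[OF assms(2)] free_on_zero) (auto simp: is_subring_def)
  then show ?thesis by simp
qed

lemma linear_on_diff:
  assumes R: "is_subring R" and f: "linear_on R A B f" and uv: "u \<in> free_on R A" "v \<in> free_on R A"
  shows "f (\<lambda>i. u i - v i) = (\<lambda>j. f u j - f v j)"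
proof -
  have "f (\<lambda>i. (u i - v i) + v i) = (\<lambda>j. f (\<lambda>i. u i - v i) j + f v j)"
    by (rule linear_on_add[OF f free_on_diff[OF R uv] uv(2)])
  then show ?thesis by (auto simp: fun_eq_iff)
qed

lemma linear_on_sum:
  assumes R: "is_subring R" and f: "linear_on R A B f"
    and uv: "\<And>k. k \<in> K \<Longrightarrow> r k \<in> R" "\<And>k. k \<in> K \<Longrightarrow> v k \<in> free_on R A"
  shows "f (\<lambda>i. \<Sum>k\<in>K. r k * v k i) = (\<lambda>j. \<Sum>k\<in>K. r k * f (v k) j)"
  using uv
proof (induction K rule: infinite_finite_induct)
  case (insert k K)
  have rv: "(\<lambda>i. r k * v k i) \<in> free_on R A" "(\<lambda>i. \<Sum>k\<in>K. r k * v k i) \<in> free_on R A"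
    using insert.prems R by (auto intro!: free_on_smult free_on_sum)
  have "f (\<lambda>i. \<Sum>k\<in>insert k K. r k * v k i) = f (\<lambda>i. r k * v k i + (\<Sum>k\<in>K. r k * v k i))"
    using insert.hyps by simp
  also have "\<dots> = (\<lambda>j. f (\<lambda>i. r k * v k i) j + f (\<lambda>i. \<Sum>k\<in>K. r k * v k i) j)"
    by (rule linear_on_add[OF f rv])
  also have "f (\<lambda>i. r k * v k i) = (\<lambda>j. r k * f (v k) j)"
    using insert.prems by (intro linear_on_smult[OF f]) auto
  finally show ?case using insert by simp
qed (use linear_on_zero[OF R f] in auto)

lemma free_on_expand:
  assumes "u \<in> free_on R A" "finite A"
  shows "u = (\<lambda>i. \<Sum>a\<in>A. u a * unit_vec a i)"
proof
  fix i
  have "(\<Sum>a\<in>A. u a * unit_vec a i) = (\<Sum>a\<in>A. if i = a then u a else 0)"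
    by (intro sum.cong) (auto simp: unit_vec_def)
  then show "u i = (\<Sum>a\<in>A. u a * unit_vec a i)"
    using assms by (simp add: free_on_def)
qed

lemma linear_on_expand:
  assumes "is_subring R" "linear_on R A B f" "u \<in> free_on R A" "finite A"
  shows "f u = (\<lambda>j. \<Sum>a\<in>A. u a * f (unit_vec a) j)"
proof -
  have "f u = f (\<lambda>i. \<Sum>a\<in>A. u a * unit_vec a i)"
    using free_on_expand[OF assms(3,4)] by simp
  also have "\<dots> = (\<lambda>j. \<Sum>a\<in>A. u a * f (unit_vec a) j)"
    using assms free_onD[OF assms(1,3)] by (intro linear_on_sum) (auto intro: unit_vec_free)
  finally show ?thesis .
qed

lemma linear_on_comp: "linear_on R A B f \<Longrightarrow> linear_on R B C g \<Longrightarrow> linear_on R A C (\<lambda>u. g (f u))"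
  by (auto simp: linear_on_def)

lemma linear_on_minus:
  assumes R: "is_subring R" and f: "linear_on R A B f" "linear_on R A B g"
  shows "linear_on R A B (\<lambda>u j. f u j - g u j)"
  using f unfolding linear_on_def by (auto intro: free_on_diff[OF R] simp: algebra_simps)

lemma linear_on_id: "linear_on R A A (\<lambda>u. u)"
  by (simp add: linear_on_def)

text \<open>Projectivity of a free module of finite rank: preimages are chosen for the unit vectors
  and extended linearly.\<close>

lemma linear_on_lift:
  assumes R: "is_subring R" and fin: "finite A"
    and q: "linear_on R A C q" and p: "linear_on R B C p"
    and im: "\<And>u. u \<in> free_on R A \<Longrightarrow> q u \<in> p ` free_on R B"
  shows "\<exists>h. linear_on R A B h \<and> (\<forall>u\<in>free_on R A. p (h u) = q u)"
proof -
  have "\<exists>b. \<forall>a\<in>A. b a \<in> free_on R B \<and> p (b a) = q (unit_vec a)"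
    by (rule bchoice) (use im unit_vec_free[OF R] in \<open>force simp: image_iff\<close>)
  then obtain b where b: "\<And>a. a \<in> A \<Longrightarrow> b a \<in> free_on R B" "\<And>a. a \<in> A \<Longrightarrow> p (b a) = q (unit_vec a)"
    by blast
  define h where "h u = (\<lambda>j. \<Sum>a\<in>A. u a * b a j)" for u
  have uR: "u a \<in> R" if "u \<in> free_on R A" for u a by (rule free_onD[OF R that])
  have "linear_on R A B h"
    unfolding linear_on_def h_def
    by (auto intro!: free_on_sum free_on_smult R b uR
        simp: distrib_right sum.distrib sum_distrib_left mult.assoc)
  moreover have "p (h u) = q u" if u: "u \<in> free_on R A" for u
  proof -
    have "p (h u) = (\<lambda>j. \<Sum>a\<in>A. u a * p (b a) j)"
      unfolding h_def using b free_onD[OF R u] by (intro linear_on_sum[OF R p]) auto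
    also have "\<dots> = q u" using linear_on_expand[OF R q u fin] b by simp
    finally show ?thesis .
  qed
  ultimately show ?thesis by blast
qed

text \<open>
  The terms of the complex are \<open>free_on R (A i)\<close>; \<open>e\<close> is the augmentation onto \<open>M\<close>, whose target
  \<open>R\<close> is viewed as functions on a one-point set, and \<open>d i\<close> goes from degree \<open>Suc i\<close> to degree \<open>i\<close>.
\<close>

definition resolution ::
  "'a::comm_ring_1 set \<Rightarrow> (nat \<Rightarrow> 'i set) \<Rightarrow> (('i \<Rightarrow> 'a) \<Rightarrow> unit \<Rightarrow> 'a) \<Rightarrow>
    (nat \<Rightarrow> ('i \<Rightarrow> 'a) \<Rightarrow> ('i \<Rightarrow> 'a)) \<Rightarrow> (unit \<Rightarrow> 'a) set \<Rightarrow> bool"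
where
  "resolution R A e d M \<longleftrightarrow> (\<forall>i. finite (A i)) \<and> linear_on R (A 0) UNIV e \<and>
     (\<forall>i. linear_on R (A (Suc i)) (A i) (d i)) \<and> e ` free_on R (A 0) = M \<and>
     d 0 ` free_on R (A (Suc 0)) = ker_on R (A 0) e \<and>
     (\<forall>i. d (Suc i) ` free_on R (A (Suc (Suc i))) = ker_on R (A (Suc i)) (d i))"

text \<open>The kernel of the map leaving degree \<open>n\<close>. The augmentation has a different
  target type from the differentials, so degree 0 needs its own case; later arguments can then treat
  all degrees alike.\<close>

definition cycles_on ::
  "'a::comm_ring_1 set \<Rightarrow> (nat \<Rightarrow> 'i set) \<Rightarrow> (('i \<Rightarrow> 'a) \<Rightarrow> unit \<Rightarrow> 'a) \<Rightarrow>
    (nat \<Rightarrow> ('i \<Rightarrow> 'a) \<Rightarrow> ('i \<Rightarrow> 'a)) \<Rightarrow> nat \<Rightarrow> ('i \<Rightarrow> 'a) set"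
where
  "cycles_on R A e d n = (case n of 0 \<Rightarrow> ker_on R (A 0) e | Suc m \<Rightarrow> ker_on R (A n) (d m))"

section \<open>Comparison of two resolutions of the same module\<close>

lemma resolution_exact: "resolution R A e d M \<Longrightarrow> d n ` free_on R (A (Suc n)) = cycles_on R A e d n"
  by (cases n) (auto simp: resolution_def cycles_on_def)

lemma cycles_on_subset: "cycles_on R A e d n \<subseteq> free_on R (A n)"
  by (cases n) (auto simp: cycles_on_def ker_on_def)

lemma cycles_on_Suc: "cycles_on R A e d (Suc n) = ker_on R (A (Suc n)) (d n)"
  by (simp add: cycles_on_def)

text \<open>The comparison theorem, existence part. The lift in each degree depends on the previous
  one, hence dependent choice. The invariant \<open>?P\<close> records that cycles go to cycles; by
  exactness of the target these are boundaries, which permits the next lift.\<close>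

lemma chain_map_exists:
  assumes R: "is_subring R" and X: "resolution R A e d M" and Y: "resolution R B e' d' M"
  shows "\<exists>f. (\<forall>n. linear_on R (A n) (B n) (f n)) \<and> (\<forall>u\<in>free_on R (A 0). e' (f 0 u) = e u) \<and>
    (\<forall>n. \<forall>u\<in>free_on R (A (Suc n)). d' n (f (Suc n) u) = f n (d n u))"
proof -
  let ?P = "\<lambda>n f. linear_on R (A n) (B n) f \<and> f ` cycles_on R A e d n \<subseteq> cycles_on R B e' d' n \<and>
    (n = 0 \<longrightarrow> (\<forall>u\<in>free_on R (A 0). e' (f u) = e u))"
  let ?Q = "\<lambda>n f g. \<forall>u\<in>free_on R (A (Suc n)). d' n (g u) = f (d n u)"
  have "\<exists>h. linear_on R (A 0) (B 0) h \<and> (\<forall>u\<in>free_on R (A 0). e' (h u) = e u)"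
    using X Y by (intro linear_on_lift[OF R, where C = UNIV]) (auto simp: resolution_def)
  then have P0: "\<exists>f. ?P 0 f"
    by (auto simp: cycles_on_def ker_on_def linear_on_closed)
  have step: "\<exists>g. ?P (Suc n) g \<and> ?Q n f g" if f: "?P n f" for n f
  proof -
    have ld: "linear_on R (A (Suc n)) (A n) (d n)" and ld': "linear_on R (B (Suc n)) (B n) (d' n)"
      and fin: "finite (A (Suc n))"
      using X Y by (auto simp: resolution_def)
    have "f (d n u) \<in> d' n ` free_on R (B (Suc n))" if "u \<in> free_on R (A (Suc n))" for u
      using that f resolution_exact[OF X, of n] resolution_exact[OF Y, of n] by blast
    then obtain g where g: "linear_on R (A (Suc n)) (B (Suc n)) g"
      "\<forall>u\<in>free_on R (A (Suc n)). d' n (g u) = f (d n u)"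
      using linear_on_lift[OF R fin linear_on_comp[OF ld conjunct1[OF f]] ld'] by blast
    have "f (\<lambda>i. 0) = (\<lambda>i. 0)" using f R by (auto intro: linear_on_zero)
    then have "g ` cycles_on R A e d (Suc n) \<subseteq> cycles_on R B e' d' (Suc n)"
      using g by (auto simp: cycles_on_Suc ker_on_def linear_on_closed)
    then show ?thesis using g by blast
  qed
  obtain f where "\<forall>n. ?P n (f n) \<and> ?Q n (f n) (f (Suc n))"
    using dependent_nat_choice[of ?P ?Q, OF P0 step] by blast
  then show ?thesis by (intro exI[of _ f]) auto
qed

text \<open>The comparison theorem, uniqueness part, for a chain map \<open>k\<close> lifting zero.
  On cycles the homotopy equation reduces to \<open>d n (h u) = k n u\<close>, since the term
  through the lower degree vanishes. This is the invariant that makes \<open>?q u\<close> a cycle in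
  the next degree.\<close>

lemma chain_map_null_homotopic:
  assumes R: "is_subring R" and X: "resolution R A e d M"
    and k: "\<And>n. linear_on R (A n) (A n) (k n)" "\<And>u. u \<in> free_on R (A 0) \<Longrightarrow> e (k 0 u) = (\<lambda>j. 0)"
    and kd: "\<And>n u. u \<in> free_on R (A (Suc n)) \<Longrightarrow> d n (k (Suc n) u) = k n (d n u)"
  shows "\<exists>h. (\<forall>n. linear_on R (A n) (A (Suc n)) (h n)) \<and> (\<forall>u\<in>free_on R (A 0). d 0 (h 0 u) = k 0 u) \<and>
    (\<forall>n. \<forall>u\<in>free_on R (A (Suc n)). d (Suc n) (h (Suc n) u) = (\<lambda>i. k (Suc n) u i - h n (d n u) i))"
proof -
  let ?P = "\<lambda>n h. linear_on R (A n) (A (Suc n)) h \<and> (\<forall>u\<in>cycles_on R A e d n. d n (h u) = k n u) \<and>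
    (n = 0 \<longrightarrow> (\<forall>u\<in>free_on R (A 0). d 0 (h u) = k 0 u))"
  let ?Q = "\<lambda>n h g. \<forall>u\<in>free_on R (A (Suc n)). d (Suc n) (g u) = (\<lambda>i. k (Suc n) u i - h (d n u) i)"
  have fin: "finite (A n)" and ld: "linear_on R (A (Suc n)) (A n) (d n)" for n
    using X by (auto simp: resolution_def)
  have "k 0 u \<in> d 0 ` free_on R (A (Suc 0))" if "u \<in> free_on R (A 0)" for u
    using that k linear_on_closed[OF k(1) that] resolution_exact[OF X, of 0]
    by (auto simp: cycles_on_def ker_on_def)
  then have "\<exists>h. linear_on R (A 0) (A (Suc 0)) h \<and> (\<forall>u\<in>free_on R (A 0). d 0 (h u) = k 0 u)"
    by (intro linear_on_lift[OF R fin k(1) ld])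
  then have P0: "\<exists>h. ?P 0 h"
    using cycles_on_subset by blast
  have step: "\<exists>g. ?P (Suc n) g \<and> ?Q n h g" if h: "?P n h" for n h
  proof -
    let ?q = "\<lambda>u i. k (Suc n) u i - h (d n u) i"
    have lq: "linear_on R (A (Suc n)) (A (Suc n)) ?q"
      using h by (intro linear_on_minus[OF R] k linear_on_comp[OF ld]) auto
    have "?q u \<in> d (Suc n) ` free_on R (A (Suc (Suc n)))" if u: "u \<in> free_on R (A (Suc n))" for u
    proof -
      have du: "d n u \<in> cycles_on R A e d n" using resolution_exact[OF X, of n] u by blast
      then have "h (d n u) \<in> free_on R (A (Suc n))"
        using h cycles_on_subset linear_on_closed by blast
      then have "d n (?q u) = (\<lambda>i. d n (k (Suc n) u) i - d n (h (d n u)) i)"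
        using linear_on_closed[OF k(1) u] by (intro linear_on_diff[OF R ld])
      also have "\<dots> = (\<lambda>i. 0)" using kd[OF u] h du by simp
      finally have "?q u \<in> cycles_on R A e d (Suc n)"
        using linear_on_closed[OF lq u] by (simp add: cycles_on_Suc ker_on_def)
      then show ?thesis using resolution_exact[OF X] by blast
    qed
    then obtain g where g: "linear_on R (A (Suc n)) (A (Suc (Suc n))) g"
      "\<forall>u\<in>free_on R (A (Suc n)). d (Suc n) (g u) = ?q u"
      using linear_on_lift[OF R fin lq ld] by blast
    have "h (\<lambda>i. 0) = (\<lambda>i. 0)" using h R by (auto intro: linear_on_zero)
    then have "\<forall>u\<in>cycles_on R A e d (Suc n). d (Suc n) (g u) = k (Suc n) u"
      using g by (auto simp: cycles_on_Suc ker_on_def)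
    then show ?thesis using g by blast
  qed
  obtain h where "\<forall>n. ?P n (h n) \<and> ?Q n (h n) (h (Suc n))"
    using dependent_nat_choice[of ?P ?Q, OF P0 step] by blast
  then show ?thesis by (intro exI[of _ h]) auto
qed

text \<open>Rows of a matrix with a right inverse are linearly independent.\<close>

lemma card_le_if_right_inverse:
  fixes P :: "'i \<Rightarrow> 'j \<Rightarrow> 'k::field"
  assumes fin: "finite A" "finite B"
    and inv: "\<And>a a'. a \<in> A \<Longrightarrow> a' \<in> A \<Longrightarrow> (\<Sum>b\<in>B. P a b * Q b a') = (if a' = a then 1 else 0)"
  shows "card A \<le> card B"
proof -
  interpret V: vector_space "\<lambda>(c::'k) (v :: 'j \<Rightarrow> 'k) j. c * v j"
    by standard (auto simp: fun_eq_iff algebra_simps)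
  define r where "r a = (\<lambda>j. if j \<in> B then P a j else 0)" for a
  define s where "s b = (\<lambda>j. if j = b then 1 else (0::'k))" for b :: 'j
  have rQ: "(\<Sum>b\<in>B. r a b * Q b a') = (if a' = a then 1 else 0)" if "a \<in> A" "a' \<in> A" for a a'
    using inv[OF that] by (simp add: r_def cong: sum.cong)
  have inj: "inj_on r A"
    using rQ by (intro inj_onI) (metis zero_neq_one)
  have sum_apply: "(\<Sum>x\<in>X. f x) j = (\<Sum>x\<in>X. f x j)" for X :: "'x set" and f :: "'x \<Rightarrow> 'j \<Rightarrow> 'k" and j
    by (induction X rule: infinite_finite_induct) auto
  have "V.independent (r ` A)"
  proof (rule V.independent_if_scalars_zero)
    fix f v assume z: "(\<Sum>x\<in>r ` A. (\<lambda>j. f x * x j)) = 0" and v: "v \<in> r ` A"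
    then obtain a' where a': "a' \<in> A" "v = r a'" by blast
    have "(\<Sum>a\<in>A. f (r a) * r a j) = 0" for j
    proof -
      have "(\<Sum>x\<in>r ` A. (\<lambda>j. f x * x j)) j = 0" using z by simp
      then show ?thesis by (simp add: sum_apply sum.reindex[OF inj])
    qed
    then have "0 = (\<Sum>b\<in>B. (\<Sum>a\<in>A. f (r a) * r a b) * Q b a')" by simp
    also have "\<dots> = (\<Sum>b\<in>B. \<Sum>a\<in>A. f (r a) * (r a b * Q b a'))"
      by (simp add: sum_distrib_right mult.assoc)
    also have "\<dots> = (\<Sum>a\<in>A. f (r a) * (\<Sum>b\<in>B. r a b * Q b a'))"
      by (subst sum.swap) (simp add: sum_distrib_left)
    also have "\<dots> = (\<Sum>a\<in>A. if a = a' then f (r a) else 0)"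
      using rQ a' by (intro sum.cong) auto
    also have "\<dots> = f v" using a' fin by simp
    finally show "f v = 0" by simp
  qed (use fin in simp)
  moreover have "r ` A \<subseteq> V.span (s ` B)"
  proof clarify
    fix a
    have "r a = (\<Sum>b\<in>B. (\<lambda>j. r a b * s b j))"
    proof
      fix j
      have "(\<Sum>b\<in>B. r a b * s b j) = (\<Sum>b\<in>B. if b = j then r a b else 0)"
        by (intro sum.cong) (auto simp: s_def)
      then show "r a j = (\<Sum>b\<in>B. (\<lambda>j. r a b * s b j)) j"
        using fin by (simp add: sum_apply) (simp add: r_def)
    qed
    also have "\<dots> \<in> V.span (s ` B)"
      by (intro V.span_sum V.span_scale V.span_base) auto
    finally show "r a \<in> V.span (s ` B)" .
  qed
  ultimately have "card (r ` A) \<le> card (s ` B)"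
    using V.independent_span_bound[of "s ` B" "r ` A"] fin by blast
  then show ?thesis using card_image[OF inj] card_image_le[OF fin(2), of s] by simp
qed

lemma hom_on_sum:
  assumes R: "is_subring R"
    and c: "c 0 = 0" "\<And>x y. x \<in> R \<Longrightarrow> y \<in> R \<Longrightarrow> c (x + y) = c x + c y"
    and f: "\<And>k. k \<in> K \<Longrightarrow> f k \<in> R"
  shows "c (\<Sum>k\<in>K. f k) = (\<Sum>k\<in>K. c (f k) :: 'k::field)"
  using f
proof (induction K rule: infinite_finite_induct)
  case (insert k K)
  then show ?case using c(2)[of "f k" "\<Sum>k\<in>K. f k"] is_subring_sum[OF R, of K f] by simp
qed (use c in auto)

text \<open>
  Modulo the kernel of \<open>c\<close> the differentials vanish, so a homotopy equivalence becomes an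
  isomorphism.
\<close>

lemma minimal_resolution_card_le:
  fixes R :: "'a::comm_ring_1 set" and c :: "'a \<Rightarrow> 'k::field"
  assumes R: "is_subring R" and X: "resolution R A e d M" and Y: "resolution R B e' d' M"
    and c: "c 0 = 0" "c 1 = 1" "\<And>x y. x \<in> R \<Longrightarrow> y \<in> R \<Longrightarrow> c (x + y) = c x + c y"
      "\<And>x y. x \<in> R \<Longrightarrow> y \<in> R \<Longrightarrow> c (x * y) = c x * c y"
    and min: "\<And>n u i. u \<in> free_on R (A (Suc n)) \<Longrightarrow> c (d n u i) = 0"
  shows "card (A n) \<le> card (B n)"
proof -
  have fin: "finite (A n)" "finite (B n)" and ld: "linear_on R (A (Suc n)) (A n) (d n)"
    and le: "linear_on R (A 0) UNIV e" for n
    using X Y by (auto simp: resolution_def)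
  obtain f where f: "\<And>n. linear_on R (A n) (B n) (f n)" "\<And>u. u \<in> free_on R (A 0) \<Longrightarrow> e' (f 0 u) = e u"
    "\<And>n u. u \<in> free_on R (A (Suc n)) \<Longrightarrow> d' n (f (Suc n) u) = f n (d n u)"
    using chain_map_exists[OF R X Y] by blast
  obtain g where g: "\<And>n. linear_on R (B n) (A n) (g n)" "\<And>u. u \<in> free_on R (B 0) \<Longrightarrow> e (g 0 u) = e' u"
    "\<And>n u. u \<in> free_on R (B (Suc n)) \<Longrightarrow> d n (g (Suc n) u) = g n (d' n u)"
    using chain_map_exists[OF R Y X] by blast
  \<comment> \<open>Both the identity and the composite of \<open>f\<close> and \<open>g\<close>
    lift the identity of \<open>M\<close>; their difference is therefore null-homotopic.\<close>
  define k where "k n u = (\<lambda>i. u i - g n (f n u) i)" for n u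
  have lgf: "linear_on R (A n) (A n) (\<lambda>u. g n (f n u))" for n
    by (rule linear_on_comp[OF f(1) g(1)])
  have lk: "linear_on R (A n) (A n) (k n)" for n
    using linear_on_minus[OF R linear_on_id lgf[of n]] by (simp add: k_def[abs_def])
  have ek: "e (k 0 u) = (\<lambda>j. 0)" if u: "u \<in> free_on R (A 0)" for u
    using linear_on_diff[OF R le u linear_on_closed[OF lgf u]] f(2)[OF u]
      g(2)[OF linear_on_closed[OF f(1) u]] by (simp add: k_def)
  have dk: "d n (k (Suc n) u) = k n (d n u)" if u: "u \<in> free_on R (A (Suc n))" for n u
    using linear_on_diff[OF R ld u linear_on_closed[OF lgf u]] f(3)[OF u]
      g(3)[OF linear_on_closed[OF f(1) u]] by (simp add: k_def)
  obtain h where h: "\<And>n. linear_on R (A n) (A (Suc n)) (h n)"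
    "\<And>u. u \<in> free_on R (A 0) \<Longrightarrow> d 0 (h 0 u) = k 0 u"
    "\<And>n u. u \<in> free_on R (A (Suc n)) \<Longrightarrow> d (Suc n) (h (Suc n) u) = (\<lambda>i. k (Suc n) u i - h n (d n u) i)"
    using chain_map_null_homotopic[OF R X lk ek dk] by blast
  \<comment> \<open>In \<open>k = d h + h d\<close> the first term is killed by minimality. The
    second is a combination of values of \<open>h\<close> with coefficients from
    \<open>d m u\<close>, which \<open>c\<close> also sends to 0.\<close>
  have ck: "c (k n u i) = 0" if u: "u \<in> free_on R (A n)" for n u i
  proof (cases n)
    case 0
    then show ?thesis using min[OF linear_on_closed[OF h(1)], of u 0] h(2) u by metis
  next
    case (Suc m)
    let ?v = "d m u"
    have um: "u \<in> free_on R (A (Suc m))" using u Suc by simp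
    have v: "?v \<in> free_on R (A m)" by (rule linear_on_closed[OF ld um])
    have hR: "h m (unit_vec a) i \<in> R" if "a \<in> A m" for a
      by (rule free_onD[OF R linear_on_closed[OF h(1) unit_vec_free[OF R that]]])
    have "c (h m ?v i) = c (\<Sum>a\<in>A m. ?v a * h m (unit_vec a) i)"
      using linear_on_expand[OF R h(1) v fin(1)] by simp
    also have "\<dots> = (\<Sum>a\<in>A m. c (?v a * h m (unit_vec a) i))"
      using R free_onD[OF R v] hR by (intro hom_on_sum[OF R c(1,3)]) (auto simp: is_subring_def)
    also have "\<dots> = 0" using c(4) free_onD[OF R v] hR min[OF um] by (intro sum.neutral) auto
    finally have "c (h m ?v i) = 0" .
    moreover have "c (d (Suc m) (h (Suc m) u) i) = 0"
      by (rule min[OF linear_on_closed[OF h(1) um]])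
    moreover have "k n u i = d (Suc m) (h (Suc m) u) i + h m ?v i"
      using h(3)[OF um] Suc by simp
    moreover have "d (Suc m) (h (Suc m) u) i \<in> R" "h m ?v i \<in> R"
      by (rule free_onD[OF R linear_on_closed[OF ld linear_on_closed[OF h(1) um]]],
          rule free_onD[OF R linear_on_closed[OF h(1) v]])
    ultimately show ?thesis using c(3) by simp
  qed
  show ?thesis
  \<comment> \<open>The matrices of \<open>f n\<close> and \<open>g n\<close> are reduced entrywise
    by \<open>c\<close>. As \<open>k n\<close> reduces to zero, their product is the
    identity.\<close>
  proof (rule card_le_if_right_inverse[OF fin])
    fix a a' assume a: "a \<in> A n" "a' \<in> A n"
    let ?w = "f n (unit_vec a)"
    have e: "unit_vec a \<in> free_on R (A n)" by (rule unit_vec_free[OF R a(1)])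
    have w: "?w \<in> free_on R (B n)" by (rule linear_on_closed[OF f(1) e])
    have gR: "g n (unit_vec b) a' \<in> R" if "b \<in> B n" for b
      by (rule free_onD[OF R linear_on_closed[OF g(1) unit_vec_free[OF R that]]])
    have "(\<Sum>b\<in>B n. c (?w b) * c (g n (unit_vec b) a')) = (\<Sum>b\<in>B n. c (?w b * g n (unit_vec b) a'))"
      using c(4) free_onD[OF R w] gR by (intro sum.cong) auto
    also have "\<dots> = c (\<Sum>b\<in>B n. ?w b * g n (unit_vec b) a')"
      using R free_onD[OF R w] gR by (intro hom_on_sum[OF R c(1,3), symmetric]) (auto simp: is_subring_def)
    also have "(\<Sum>b\<in>B n. ?w b * g n (unit_vec b) a') = g n ?w a'"
      using linear_on_expand[OF R g(1) w fin(2)] by simp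
    also have "c (g n ?w a') = c (unit_vec a a')"
    proof -
      have "k n (unit_vec a) a' + g n ?w a' = unit_vec a a'" by (simp add: k_def)
      moreover have "k n (unit_vec a) a' \<in> R" "g n ?w a' \<in> R"
        by (rule free_onD[OF R linear_on_closed[OF lk e]], rule free_onD[OF R linear_on_closed[OF lgf e]])
      ultimately show ?thesis using c(3) ck[OF e] by (metis add_0)
    qed
    also have "\<dots> = (if a' = a then 1 else 0)" using c by (simp add: unit_vec_def)
    finally show "(\<Sum>b\<in>B n. c (?w b) * c (g n (unit_vec b) a')) = (if a' = a then 1 else 0)" .
  qed
qed

section \<open>Monomial ideals\<close>

lemma exponent_plus_eq_0_iff:
  fixes m n :: "'e \<Rightarrow>\<^sub>0 nat"
  shows "m + n = 0 \<longleftrightarrow> m = 0 \<and> n = 0"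
  by (auto simp: poly_mapping_eq_iff fun_eq_iff lookup_add)

lemma keys_plus_nat:
  fixes m n :: "'e \<Rightarrow>\<^sub>0 nat"
  shows "Poly_Mapping.keys (m + n) = Poly_Mapping.keys m \<union> Poly_Mapping.keys n"
  by (auto simp: in_keys_iff lookup_add)

lemma poly_mapping_expand: "p = (\<Sum>m\<in>Poly_Mapping.keys p. Poly_Mapping.single m (Poly_Mapping.lookup p m))"
  by (rule poly_mapping_eqI) (auto simp: lookup_sum lookup_single when_def in_keys_iff)

lemma lookup_monomial_times:
  fixes p :: "('e, 'k::field) mpoly"
  shows "Poly_Mapping.lookup (Poly_Mapping.single a 1 * p) (a + m) = Poly_Mapping.lookup p m"
proof -
  have "Poly_Mapping.single a 1 * p = (\<Sum>n\<in>Poly_Mapping.keys p. Poly_Mapping.single (a + n) (Poly_Mapping.lookup p n))"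
    by (subst poly_mapping_expand[of p]) (simp add: sum_distrib_left mult_single)
  then show ?thesis by (auto simp: lookup_sum lookup_single when_def in_keys_iff)
qed

lemma keys_monomial_times:
  fixes p :: "('e, 'k::field) mpoly"
  shows "Poly_Mapping.keys (Poly_Mapping.single a 1 * p) = (+) a ` Poly_Mapping.keys p"
proof
  show "Poly_Mapping.keys (Poly_Mapping.single a 1 * p) \<subseteq> (+) a ` Poly_Mapping.keys p"
    using keys_mult[of "Poly_Mapping.single a 1" p] by auto
qed (auto simp: in_keys_iff lookup_monomial_times)

lemma monomial_times_eq_0:
  fixes p :: "('e, 'k::field) mpoly"
  shows "Poly_Mapping.single a 1 * p = 0 \<longleftrightarrow> p = 0"
  using keys_monomial_times[of a p] by (auto simp flip: keys_eq_empty)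

lemma monomial_dividesI:
  fixes p :: "('e, 'k::field) mpoly"
  assumes "\<And>m. m \<in> Poly_Mapping.keys p \<Longrightarrow> \<exists>n. m = a + n"
  shows "\<exists>q. p = Poly_Mapping.single a 1 * q"
proof -
  obtain n where n: "\<And>m. m \<in> Poly_Mapping.keys p \<Longrightarrow> a + n m = m"
    using assms by metis
  have "p = (\<Sum>m\<in>Poly_Mapping.keys p. Poly_Mapping.single (a + n m) (Poly_Mapping.lookup p m))"
    using poly_mapping_expand[of p] n by simp
  also have "\<dots> = Poly_Mapping.single a 1 * (\<Sum>m\<in>Poly_Mapping.keys p. Poly_Mapping.single (n m) (Poly_Mapping.lookup p m))"
    by (simp add: sum_distrib_left mult_single)
  finally show ?thesis by blast
qed

text \<open>The exponent 0 is a sum of two exponents only as 0 + 0. The constant coefficient is thus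
  a ring homomorphism to the field, and it serves as the map \<open>c\<close> of
  \<open>minimal_resolution_card_le\<close>.\<close>

lemma lookup_times_0:
  fixes p q :: "('e, 'k::field) mpoly"
  shows "Poly_Mapping.lookup (p * q) 0 = Poly_Mapping.lookup p 0 * Poly_Mapping.lookup q 0"
proof -
  have "Sum_any (\<lambda>r. Poly_Mapping.lookup q r when 0 = l + r) = (Poly_Mapping.lookup q 0 when l = 0)"
    for l :: "'e \<Rightarrow>\<^sub>0 nat"
  proof -
    have "0 = l + r \<longleftrightarrow> r = 0 \<and> l = 0" for r using exponent_plus_eq_0_iff[of l r] by auto
    then have "(\<lambda>r. Poly_Mapping.lookup q r when 0 = l + r) =
        (\<lambda>r. (Poly_Mapping.lookup q r when l = 0) when r = 0)"
      by (auto simp: when_def fun_eq_iff)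
    then show ?thesis by (simp only:) simp
  qed
  then have "Poly_Mapping.lookup (p * q) 0 =
      Sum_any (\<lambda>l. Poly_Mapping.lookup p l * (Poly_Mapping.lookup q 0 when l = 0))"
    by (simp add: lookup_mult)
  also have "\<dots> = Sum_any (\<lambda>l. (Poly_Mapping.lookup p l * Poly_Mapping.lookup q 0) when l = 0)"
    by (simp add: mult_when)
  finally show ?thesis by simp
qed

section \<open>Squarefree monomials and ideals spanned by monomials\<close>

definition sqfree_exp :: "'e set \<Rightarrow> 'e \<Rightarrow>\<^sub>0 nat" where
  "sqfree_exp S = (\<Sum>j\<in>S. Poly_Mapping.single j 1)"

lemma lookup_sqfree_exp: "finite S \<Longrightarrow> Poly_Mapping.lookup (sqfree_exp S) j = (if j \<in> S then 1 else 0)"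
  by (simp add: sqfree_exp_def lookup_sum lookup_single when_def)

lemma keys_sqfree_exp: "finite S \<Longrightarrow> Poly_Mapping.keys (sqfree_exp S) = S"
  by (auto simp: in_keys_iff lookup_sqfree_exp split: if_splits)

lemma prod_indet: "finite S \<Longrightarrow> (\<Prod>j\<in>S. indet j) = Poly_Mapping.single (sqfree_exp S) (1 :: 'k::field)"
  by (induction S rule: finite_induct) (simp_all add: sqfree_exp_def indet_def mult_single)

lemma sqfree_exp_divides:
  assumes "S \<subseteq> Poly_Mapping.keys m"
  shows "\<exists>n. m = sqfree_exp S + n"
proof -
  have "finite S" by (rule finite_subset[OF assms finite_keys])
  then have "m = sqfree_exp S + (m - sqfree_exp S)"
    using assms
    by (intro poly_mapping_eqI) (auto simp: lookup_add lookup_minus lookup_sqfree_exp in_keys_iff Suc_le_eq)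
  then show ?thesis by blast
qed

text \<open>A monomial ideal is given by the exponents it contains, so membership, multiplication by
  a monomial and cancellation become statements about exponents. The polynomials in given variables
  are described in the same way.\<close>

definition supported_on :: "(('e \<Rightarrow>\<^sub>0 nat) \<Rightarrow> bool) \<Rightarrow> ('e, 'k::field) mpoly set" where
  "supported_on P = {p. \<forall>m\<in>Poly_Mapping.keys p. P m}"

lemma supported_on_zero: "0 \<in> supported_on P"
  by (simp add: supported_on_def)

lemma supported_on_add: "p \<in> supported_on P \<Longrightarrow> q \<in> supported_on P \<Longrightarrow> p + q \<in> supported_on P"
  using Poly_Mapping.keys_add[of p q] by (auto simp: supported_on_def)

lemma supported_on_uminus: "p \<in> supported_on P \<Longrightarrow> - p \<in> supported_on P"
  by (auto simp: supported_on_def in_keys_iff)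

lemma supported_on_sum: "(\<And>i. i \<in> I \<Longrightarrow> f i \<in> supported_on P) \<Longrightarrow> sum f I \<in> supported_on P"
  by (induction I rule: infinite_finite_induct) (auto intro: supported_on_add supported_on_zero)

lemma supported_on_monomial_times:
  "Poly_Mapping.single a 1 * p \<in> supported_on P \<longleftrightarrow> p \<in> supported_on (\<lambda>m. P (a + m))"
  by (simp add: supported_on_def keys_monomial_times)

lemma supported_on_mono: "p \<in> supported_on P \<Longrightarrow> (\<And>m. P m \<Longrightarrow> Q m) \<Longrightarrow> p \<in> supported_on Q"
  by (simp add: supported_on_def)

text \<open>
  The exponents of the monomials of the facet ideal of the direct sum of the circuits \<open>Cs\<close> and
  the coloops \<open>L\<close>: a basis omits exactly one element of every circuit.
\<close>

definition circuit_exps :: "'e set \<Rightarrow> 'e set \<Rightarrow> 'e set list \<Rightarrow> ('e \<Rightarrow>\<^sub>0 nat) \<Rightarrow> bool" where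
  "circuit_exps E L Cs m \<longleftrightarrow> Poly_Mapping.keys m \<subseteq> E \<and> L \<subseteq> Poly_Mapping.keys m \<and>
     (\<forall>C\<in>set Cs. \<exists>c\<in>C. C - {c} \<subseteq> Poly_Mapping.keys m)"

abbreviation cofactor :: "'e set \<Rightarrow> 'e \<Rightarrow> ('e, 'k::field) mpoly" where
  "cofactor C c \<equiv> Poly_Mapping.single (sqfree_exp (C - {c})) 1"

text \<open>The product does not depend on \<open>c\<close>; the differences of these products are
  the Hilbert--Burch syzygies.\<close>

lemma cofactor_times_indet:
  assumes "finite C" "c \<in> C"
  shows "cofactor C c * indet c = (Poly_Mapping.single (sqfree_exp C) 1 :: ('e, 'k::field) mpoly)"
proof -
  have "sqfree_exp (C - {c}) + Poly_Mapping.single c 1 = sqfree_exp C"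
    using assms unfolding sqfree_exp_def by (subst (2) sum.remove) (auto simp: add.commute)
  then show ?thesis by (simp add: indet_def mult_single)
qed

text \<open>Neither the coloops nor the circuits in \<open>Cs\<close> involve \<open>c\<close>, so
  the variable contributes nothing towards membership. This is where disjointness of the circuits
  enters the analysis of syzygies.\<close>

lemma circuit_exps_cancel:
  assumes "circuit_exps E L Cs (Poly_Mapping.single c 1 + m)" "c \<notin> L" "\<forall>C\<in>set Cs. c \<notin> C"
  shows "circuit_exps E L Cs m"
  using assms unfolding circuit_exps_def keys_plus_nat by (auto 4 4)

text \<open>
  The coefficient at \<open>c\<close> is divisible by the variable \<open>c\<close> because all other cofactors are.
\<close>

lemma cofactor_syzygy:
  fixes p :: "'e \<Rightarrow> ('e, 'k::field) mpoly"
  assumes C: "finite C" "C \<inter> L = {}" "\<forall>D\<in>set Cs. C \<inter> D = {}"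
    and p: "\<And>c. c \<in> C \<Longrightarrow> p c \<in> supported_on (circuit_exps E L Cs)"
    and syz: "(\<Sum>c\<in>C. cofactor C c * p c) = 0"
  shows "\<exists>q. (\<forall>c\<in>C. q c \<in> supported_on (circuit_exps E L Cs) \<and> p c = indet c * q c) \<and> (\<Sum>c\<in>C. q c) = 0"
proof -
  have key: "c \<in> Poly_Mapping.keys m" if c: "c \<in> C" and m: "m \<in> Poly_Mapping.keys (p c)" for c m
  proof (rule ccontr)
    assume nc: "c \<notin> Poly_Mapping.keys m"
    let ?M = "sqfree_exp (C - {c}) + m"
    have M: "Poly_Mapping.lookup ?M c = 0"
      using nc C by (simp add: lookup_add lookup_sqfree_exp in_keys_iff)
    have other: "Poly_Mapping.lookup (cofactor C b * p b) ?M = 0" if b: "b \<in> C - {c}" for b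
    proof (rule ccontr)
      assume "Poly_Mapping.lookup (cofactor C b * p b) ?M \<noteq> 0"
      then have "?M \<in> Poly_Mapping.keys (cofactor C b * p b)" by (simp add: in_keys_iff)
      then obtain n where "?M = sqfree_exp (C - {b}) + n"
        by (auto simp only: keys_monomial_times)
      then have "Poly_Mapping.lookup ?M c \<ge> 1"
        using b c C(1) by (auto simp: lookup_add lookup_sqfree_exp)
      then show False using M by simp
    qed
    have "0 = Poly_Mapping.lookup (\<Sum>b\<in>C. cofactor C b * p b) ?M" using syz by simp
    also have "\<dots> = Poly_Mapping.lookup (cofactor C c * p c) ?M + (\<Sum>b\<in>C - {c}. Poly_Mapping.lookup (cofactor C b * p b) ?M)"
      unfolding lookup_sum by (rule sum.remove[OF C(1) c])
    also have "\<dots> = Poly_Mapping.lookup (p c) m" using other by (simp add: lookup_monomial_times)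
    finally show False using m by (simp add: in_keys_iff)
  qed
  have "\<exists>q. p c = indet c * q" if "c \<in> C" for c
    unfolding indet_def
  proof (rule monomial_dividesI)
    fix m assume "m \<in> Poly_Mapping.keys (p c)"
    then show "\<exists>n. m = Poly_Mapping.single c 1 + n"
      using key[OF that] sqfree_exp_divides[of "{c}" m] by (simp add: sqfree_exp_def)
  qed
  then obtain q where q: "\<And>c. c \<in> C \<Longrightarrow> p c = indet c * q c" by metis
  have qJ: "q c \<in> supported_on (circuit_exps E L Cs)" if c: "c \<in> C" for c
  proof -
    have "q c \<in> supported_on (\<lambda>m. circuit_exps E L Cs (Poly_Mapping.single c 1 + m))"
      using p[OF c] q[OF c] by (simp add: indet_def supported_on_monomial_times)
    then show ?thesis
      by (rule supported_on_mono) (erule circuit_exps_cancel, use c C in auto)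
  qed
  \<comment> \<open>With \<open>p c = indet c * q c\<close> every term of the relation acquires the
    same monomial factor, which can be cancelled.\<close>
  have "Poly_Mapping.single (sqfree_exp C) 1 * (\<Sum>c\<in>C. q c) = (\<Sum>c\<in>C. cofactor C c * p c)"
    unfolding sum_distrib_left
  proof (rule sum.cong)
    fix c assume c: "c \<in> C"
    show "Poly_Mapping.single (sqfree_exp C) 1 * q c = cofactor C c * p c"
      using cofactor_times_indet[OF C(1) c] q[OF c] by (metis mult.assoc)
  qed simp
  then have "(\<Sum>c\<in>C. q c) = 0" using syz monomial_times_eq_0 by metis
  then show ?thesis using q qJ by blast
qed

text \<open>Each monomial of \<open>p\<close> is assigned to one \<open>c\<close> for which
  \<open>C - {c}\<close> divides it, and the monomials are grouped accordingly. Dividing by the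
  cofactor removes only variables of \<open>C\<close>, which affect neither \<open>L\<close> nor the
  circuits in \<open>Cs\<close>.\<close>

lemma circuit_exps_decompose:
  fixes p :: "('e, 'k::field) mpoly"
  assumes C: "finite C" "C \<inter> L = {}" "\<forall>D\<in>set Cs. C \<inter> D = {}"
    and p: "p \<in> supported_on (circuit_exps E L (C # Cs))"
  shows "\<exists>q. (\<forall>c\<in>C. q c \<in> supported_on (circuit_exps E L Cs)) \<and> p = (\<Sum>c\<in>C. cofactor C c * q c)"
proof -
  let ?K = "Poly_Mapping.keys p"
  have "\<forall>m\<in>?K. \<exists>c. c \<in> C \<and> C - {c} \<subseteq> Poly_Mapping.keys m"
    using p by (auto simp: supported_on_def circuit_exps_def)
  then obtain g where g: "\<And>m. m \<in> ?K \<Longrightarrow> g m \<in> C" "\<And>m. m \<in> ?K \<Longrightarrow> C - {g m} \<subseteq> Poly_Mapping.keys m"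
    by metis
  define r where "r c = (\<Sum>m\<in>{m\<in>?K. g m = c}. Poly_Mapping.single m (Poly_Mapping.lookup p m))" for c
  have keys_r: "Poly_Mapping.keys (r c) \<subseteq> {m\<in>?K. g m = c}" for c
    unfolding r_def using keys_sum[of "\<lambda>m. Poly_Mapping.single m (Poly_Mapping.lookup p m)" "{m\<in>?K. g m = c}"]
    by (auto split: if_splits)
  have "\<exists>q. r c = cofactor C c * q" for c
    by (rule monomial_dividesI, rule sqfree_exp_divides) (use keys_r g in blast)
  then obtain q where q: "\<And>c. r c = cofactor C c * q c" by metis
  have "p = (\<Sum>m\<in>?K. Poly_Mapping.single m (Poly_Mapping.lookup p m))" by (rule poly_mapping_expand)
  also have "\<dots> = (\<Sum>c\<in>C. r c)"
    unfolding r_def using g(1) C(1) by (intro sum.group[symmetric]) auto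
  finally have "p = (\<Sum>c\<in>C. cofactor C c * q c)" by (simp add: q)
  moreover have "q c \<in> supported_on (circuit_exps E L Cs)" if c: "c \<in> C" for c
  proof -
    have "r c \<in> supported_on (circuit_exps E L (C # Cs))"
      using p keys_r unfolding supported_on_def by blast
    then have "q c \<in> supported_on (\<lambda>m. circuit_exps E L (C # Cs) (sqfree_exp (C - {c}) + m))"
      by (simp add: q supported_on_monomial_times)
    then show ?thesis
    proof (rule supported_on_mono)
      fix m assume m: "circuit_exps E L (C # Cs) (sqfree_exp (C - {c}) + m)"
      have k: "Poly_Mapping.keys (sqfree_exp (C - {c}) + m) = (C - {c}) \<union> Poly_Mapping.keys m"
        using C(1) by (simp add: keys_plus_nat keys_sqfree_exp)
      have sub: "X \<subseteq> Poly_Mapping.keys m"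
        if "X \<subseteq> (C - {c}) \<union> Poly_Mapping.keys m" "C \<inter> X = {}" for X using that by blast
      have "D - {d} \<subseteq> Poly_Mapping.keys m"
        if "D \<in> set Cs" "D - {d} \<subseteq> (C - {c}) \<union> Poly_Mapping.keys m" for D d
        using that C(3) by (intro sub) auto
      then show "circuit_exps E L Cs m"
        using m sub[of L] C(2) unfolding circuit_exps_def k by simp meson
    qed
  qed
  ultimately show ?thesis by blast
qed

lemma circuit_exps_Cons:
  assumes "finite C" "C \<subseteq> E" "c \<in> C" "circuit_exps E L Cs m"
  shows "circuit_exps E L (C # Cs) (sqfree_exp (C - {c}) + m)"
proof -
  have k: "Poly_Mapping.keys (sqfree_exp (C - {c}) + m) = (C - {c}) \<union> Poly_Mapping.keys m"
    using assms(1) by (simp add: keys_plus_nat keys_sqfree_exp)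
  have "\<exists>d\<in>D. D - {d} \<subseteq> (C - {c}) \<union> Poly_Mapping.keys m" if "D \<in> set Cs" for D
    using assms(4) that unfolding circuit_exps_def by (meson le_supI2)
  then show ?thesis using assms unfolding circuit_exps_def k by auto
qed

section \<open>The resolution of a direct sum of circuits\<close>

text \<open>
  The tensor product of the Hilbert--Burch resolutions of the circuits \<open>Cs\<close>. A basis element is a
  word with one letter per circuit \<open>C\<close>: either \<open>Inl c\<close>, standing for the generator \<open>cofactor C c\<close>,
  or \<open>Inr c\<close> with \<open>c \<noteq> base_elt C\<close>, standing for the syzygy between the generators at \<open>c\<close> and at
  \<open>base_elt C\<close>. The homological degree is the number of syzygies. All degrees are treated at once,
  and the sign in \<open>res_diff\<close> at \<open>Inr\<close> makes the differentials of the factors anticommute.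
\<close>

definition base_elt :: "'e set \<Rightarrow> 'e" where
  "base_elt C = (SOME c. c \<in> C)"

fun res_words :: "'e set list \<Rightarrow> ('e + 'e) list set" where
  "res_words [] = {[]}"
| "res_words (C # Cs) = (\<lambda>(c, w). Inl c # w) ` (C \<times> res_words Cs) \<union>
     (\<lambda>(c, w). Inr c # w) ` ((C - {base_elt C}) \<times> res_words Cs)"

definition word_degree :: "('e + 'e) list \<Rightarrow> nat" where
  "word_degree w = length (filter (\<lambda>x. \<not> isl x) w)"

text \<open>
  The image of the syzygy part of \<open>u\<close> has the coefficient \<open>indet c * syz_coeff C u c\<close> at the
  generator \<open>cofactor C c\<close>.
\<close>

definition syz_coeff ::
  "'e set \<Rightarrow> (('e + 'e) list \<Rightarrow> ('e, 'k::field) mpoly) \<Rightarrow> 'e \<Rightarrow> ('e + 'e) list \<Rightarrow> ('e, 'k) mpoly"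
where
  "syz_coeff C u c w = (if c = base_elt C then - (\<Sum>b\<in>C - {base_elt C}. u (Inr b # w)) else u (Inr c # w))"

fun res_diff ::
  "'e set list \<Rightarrow> (('e + 'e) list \<Rightarrow> ('e, 'k::field) mpoly) \<Rightarrow> ('e + 'e) list \<Rightarrow> ('e, 'k) mpoly"
where
  "res_diff (C # Cs) u (Inl c # w) = res_diff Cs (\<lambda>v. u (Inl c # v)) w + indet c * syz_coeff C u c w"
| "res_diff (C # Cs) u (Inr c # w) = - res_diff Cs (\<lambda>v. u (Inr c # v)) w"
| "res_diff _ u _ = 0"

text \<open>Only words without syzygy letters are read, so the augmentation is zero in positive
  degrees. The coloops lie in every basis and contribute a common monomial factor.\<close>

fun res_aug ::
  "'e set \<Rightarrow> 'e set list \<Rightarrow> (('e + 'e) list \<Rightarrow> ('e, 'k::field) mpoly) \<Rightarrow> ('e, 'k) mpoly"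
where
  "res_aug L [] u = Poly_Mapping.single (sqfree_exp L) 1 * u []"
| "res_aug L (C # Cs) u = (\<Sum>c\<in>C. cofactor C c * res_aug L Cs (\<lambda>v. u (Inl c # v)))"

section \<open>Linearity of the maps, and the complex property\<close>

lemma res_diff_empty_word [simp]: "res_diff Cs u [] = 0"
  by (cases Cs) auto

lemma res_diff_no_circuit [simp]: "res_diff [] u = (\<lambda>w. 0)"
  by (rule ext) simp

lemma syz_coeff_add: "syz_coeff C (\<lambda>w. u w + v w) c w = syz_coeff C u c w + syz_coeff C v c w"
  by (simp add: syz_coeff_def sum.distrib)

lemma syz_coeff_mult: "syz_coeff C (\<lambda>w. r * u w) c w = r * syz_coeff C u c w"
  by (simp add: syz_coeff_def sum_distrib_left)

lemma res_diff_add: "res_diff Cs (\<lambda>w. u w + v w) = (\<lambda>w. res_diff Cs u w + res_diff Cs v w)"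
proof
  fix w show "res_diff Cs (\<lambda>w. u w + v w) w = res_diff Cs u w + res_diff Cs v w"
  proof (induction Cs u w arbitrary: v rule: res_diff.induct)
    case (1 C Cs u c w)
    show ?case by (simp only: res_diff.simps 1 syz_coeff_add) (simp add: algebra_simps)
  next
    case (2 C Cs u c w)
    show ?case by (simp only: res_diff.simps 2) simp
  qed auto
qed

lemma res_diff_mult: "res_diff Cs (\<lambda>w. r * u w) = (\<lambda>w. r * res_diff Cs u w)"
proof
  fix w show "res_diff Cs (\<lambda>w. r * u w) w = r * res_diff Cs u w"
    by (induction Cs u w rule: res_diff.induct) (auto simp: syz_coeff_mult algebra_simps)
qed

lemma res_diff_uminus: "res_diff Cs (\<lambda>w. - u w) = (\<lambda>w. - res_diff Cs u w)"
  using res_diff_mult[of Cs "- 1" u] by simp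

lemma res_diff_zero: "res_diff Cs (\<lambda>w. 0) = (\<lambda>w. 0)"
  using res_diff_mult[of Cs 0 "\<lambda>w. 0"] by simp

lemma res_diff_diff: "res_diff Cs (\<lambda>w. u w - v w) = (\<lambda>w. res_diff Cs u w - res_diff Cs v w)"
  using res_diff_add[of Cs u "\<lambda>w. - v w"] by (simp add: res_diff_uminus)

lemma res_diff_sum: "res_diff Cs (\<lambda>w. \<Sum>i\<in>I. f i w) = (\<lambda>w. \<Sum>i\<in>I. res_diff Cs (f i) w)"
  by (induction I rule: infinite_finite_induct) (simp_all add: res_diff_zero res_diff_add)

lemma res_aug_add: "res_aug L Cs (\<lambda>w. u w + v w) = res_aug L Cs u + res_aug L Cs v"
proof (induction L Cs u arbitrary: v rule: res_aug.induct)
  case (2 L C Cs u)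
  show ?case by (simp add: 2 distrib_left sum.distrib)
qed (simp add: distrib_left)

lemma res_aug_mult: "res_aug L Cs (\<lambda>w. r * u w) = r * res_aug L Cs u"
  by (induction L Cs u rule: res_aug.induct) (auto simp: algebra_simps sum_distrib_left)

lemma res_aug_uminus: "res_aug L Cs (\<lambda>w. - u w) = - res_aug L Cs u"
  using res_aug_mult[of L Cs "- 1" u] by simp

lemma res_aug_zero: "res_aug L Cs (\<lambda>w. 0) = 0"
  using res_aug_mult[of L Cs 0 "\<lambda>w. 0"] by simp

lemma res_aug_diff: "res_aug L Cs (\<lambda>w. u w - v w) = res_aug L Cs u - res_aug L Cs v"
  using res_aug_add[of L Cs u "\<lambda>w. - v w"] by (simp add: res_aug_uminus)

lemma res_aug_sum: "res_aug L Cs (\<lambda>w. \<Sum>i\<in>I. f i w) = (\<Sum>i\<in>I. res_aug L Cs (f i))"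
  by (induction I rule: infinite_finite_induct) (simp_all add: res_aug_zero res_aug_add)

lemma res_diff_syz_coeff:
  "res_diff Cs (syz_coeff C u c) w =
    (if c = base_elt C then - (\<Sum>b\<in>C - {base_elt C}. res_diff Cs (\<lambda>v. u (Inr b # v)) w)
     else res_diff Cs (\<lambda>v. u (Inr c # v)) w)"
  by (simp add: syz_coeff_def[abs_def] res_diff_uminus res_diff_sum)

lemma base_elt_in: "C \<noteq> {} \<Longrightarrow> base_elt C \<in> C"
  by (metis base_elt_def some_in_eq)

lemma sum_syz_coeff: "finite C \<Longrightarrow> C \<noteq> {} \<Longrightarrow> (\<Sum>c\<in>C. syz_coeff C u c w) = 0"
  by (subst sum.remove[OF _ base_elt_in]) (auto simp: syz_coeff_def)

text \<open>The minus sign is the anticommutation of the differential of \<open>C\<close> with that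
  of the remaining circuits; it cancels the mixed terms when \<open>res_diff\<close> is applied
  twice.\<close>

lemma syz_coeff_res_diff: "syz_coeff C (res_diff (C # Cs) u) c w = - res_diff Cs (syz_coeff C u c) w"
  by (simp add: res_diff_syz_coeff) (simp add: syz_coeff_def sum_negf)

lemma res_diff_res_diff: "res_diff Cs (res_diff Cs u) = (\<lambda>w. 0)"
proof
  fix w show "res_diff Cs (res_diff Cs u) w = 0"
  proof (induction Cs u w rule: res_diff.induct)
    case (1 C Cs u c w)
    have "res_diff Cs (\<lambda>v. res_diff (C # Cs) u (Inl c # v)) w =
        res_diff Cs (res_diff Cs (\<lambda>v. u (Inl c # v))) w + indet c * res_diff Cs (syz_coeff C u c) w"
      by (simp add: res_diff_add res_diff_mult)
    then show ?case using 1 by (simp add: syz_coeff_res_diff)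
  next
    case (2 C Cs u c w)
    then show ?case by (simp add: res_diff_uminus)
  qed auto
qed

text \<open>After multiplication by \<open>indet c\<close> all cofactors become the monomial of
  \<open>C\<close>, and the syzygy coefficients sum to zero. The part from the remaining circuits
  vanishes by induction.\<close>

lemma res_aug_res_diff:
  assumes "\<forall>C\<in>set Cs. finite C \<and> C \<noteq> {}"
  shows "res_aug L Cs (res_diff Cs u) = (0 :: ('e, 'k::field) mpoly)"
  using assms
proof (induction Cs arbitrary: u)
  case (Cons C Cs)
  then have C: "finite C" "C \<noteq> {}" by auto
  have "res_aug L (C # Cs) (res_diff (C # Cs) u) =
      (\<Sum>c\<in>C. cofactor C c * (indet c * res_aug L Cs (syz_coeff C u c)))"
    using Cons by (simp add: res_aug_add res_aug_mult)
  also have "\<dots> = (\<Sum>c\<in>C. Poly_Mapping.single (sqfree_exp C) 1 * res_aug L Cs (syz_coeff C u c))"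
    using C(1) by (intro sum.cong) (simp_all add: cofactor_times_indet flip: mult.assoc)
  also have "\<dots> = Poly_Mapping.single (sqfree_exp C) 1 * res_aug L Cs (\<lambda>w. \<Sum>c\<in>C. syz_coeff C u c w)"
    by (simp add: res_aug_sum sum_distrib_left)
  also have "\<dots> = 0" by (simp add: sum_syz_coeff[OF C] res_aug_zero)
  finally show ?case .
qed (simp add: res_aug_zero)

section \<open>The modules of the tensor product\<close>

abbreviation polys :: "'e set \<Rightarrow> ('e, 'k::field) mpoly set" where
  "polys E \<equiv> supported_on (\<lambda>m. Poly_Mapping.keys m \<subseteq> E)"

lemma is_subring_polys: "is_subring (polys E :: ('e, 'k::field) mpoly set)"
proof -
  have "p * q \<in> polys E" if "p \<in> polys E" "q \<in> polys E" for p q :: "('e, 'k) mpoly"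
    unfolding supported_on_def
  proof safe
    fix m e assume "m \<in> Poly_Mapping.keys (p * q)" "e \<in> Poly_Mapping.keys m"
    then show "e \<in> E"
      using keys_mult[of p q] that unfolding supported_on_def by (fastforce simp: keys_plus_nat)
  qed
  then show ?thesis
    by (auto simp: is_subring_def supported_on_add supported_on_uminus supported_on_zero)
      (simp add: supported_on_def)
qed

lemma indet_polys: "c \<in> E \<Longrightarrow> indet c \<in> polys E"
  by (simp add: indet_def supported_on_def)

text \<open>The direct sum of the terms of the resolution over all homological degrees.\<close>

definition res_module :: "'e set \<Rightarrow> 'e set list \<Rightarrow> (('e + 'e) list \<Rightarrow> ('e, 'k::field) mpoly) set" where
  "res_module E Cs = free_on (polys E) (res_words Cs)"

lemma res_words_Cons:
  "[] \<notin> res_words (C # Cs)"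
  "Inl c # w \<in> res_words (C # Cs) \<longleftrightarrow> c \<in> C \<and> w \<in> res_words Cs"
  "Inr c # w \<in> res_words (C # Cs) \<longleftrightarrow> c \<in> C - {base_elt C} \<and> w \<in> res_words Cs"
  by auto

lemma res_module_Cons:
  "u \<in> res_module E (C # Cs) \<longleftrightarrow> u [] = 0 \<and>
    (\<forall>c\<in>C. (\<lambda>w. u (Inl c # w)) \<in> res_module E Cs) \<and>
    (\<forall>c. c \<notin> C \<longrightarrow> (\<lambda>w. u (Inl c # w)) = (\<lambda>w. 0)) \<and>
    (\<forall>c\<in>C - {base_elt C}. (\<lambda>w. u (Inr c # w)) \<in> res_module E Cs) \<and>
    (\<forall>c. c \<notin> C - {base_elt C} \<longrightarrow> (\<lambda>w. u (Inr c # w)) = (\<lambda>w. 0))"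
  (is "?l \<longleftrightarrow> ?r")
proof
  assume ?l
  then show ?r by (simp add: res_module_def free_on_def fun_eq_iff res_words_Cons del: res_words.simps(2))
next
  assume r: ?r
  show ?l unfolding res_module_def free_on_def
  proof (intro CollectI conjI ballI allI impI)
    fix w assume "w \<in> res_words (C # Cs)"
    then show "u w \<in> polys E" using r by (auto simp: res_module_def free_on_def)
  next
    fix w assume w: "w \<notin> res_words (C # Cs)"
    show "u w = 0"
    proof (cases w)
      case Nil then show ?thesis using r by simp
    next
      case (Cons x v)
      show ?thesis
      proof (cases x)
        case (Inl c)
        then show ?thesis
          using r w Cons by (auto simp: res_words_Cons res_module_def free_on_def fun_eq_iff
              simp del: res_words.simps(2))
      next
        case (Inr c)
        then show ?thesis
          using r w Cons by (cases "c \<in> C - {base_elt C}")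
            (auto simp: res_words_Cons res_module_def free_on_def fun_eq_iff simp del: res_words.simps(2))
      qed
    qed
  qed
qed

lemma res_module_zero: "(\<lambda>w. 0) \<in> res_module E Cs"
  unfolding res_module_def by (rule free_on_zero[OF is_subring_polys])

lemma res_module_add:
  "u \<in> res_module E Cs \<Longrightarrow> v \<in> res_module E Cs \<Longrightarrow> (\<lambda>w. u w + v w) \<in> res_module E Cs"
  unfolding res_module_def by (rule free_on_add[OF is_subring_polys])

lemma res_module_diff:
  "u \<in> res_module E Cs \<Longrightarrow> v \<in> res_module E Cs \<Longrightarrow> (\<lambda>w. u w - v w) \<in> res_module E Cs"
  unfolding res_module_def by (rule free_on_diff[OF is_subring_polys])

lemma res_module_mult:
  "r \<in> polys E \<Longrightarrow> u \<in> res_module E Cs \<Longrightarrow> (\<lambda>w. r * u w) \<in> res_module E Cs"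
  unfolding res_module_def by (rule free_on_smult[OF is_subring_polys])

lemma res_module_sum:
  "(\<And>i. i \<in> I \<Longrightarrow> f i \<in> res_module E Cs) \<Longrightarrow> (\<lambda>w. \<Sum>i\<in>I. f i w) \<in> res_module E Cs"
  unfolding res_module_def by (rule free_on_sum[OF is_subring_polys])

lemma res_module_uminus: "u \<in> res_module E Cs \<Longrightarrow> (\<lambda>w. - u w) \<in> res_module E Cs"
  using res_module_diff[OF res_module_zero, of u E Cs] by simp

lemma syz_coeff_res_module:
  "u \<in> res_module E (C # Cs) \<Longrightarrow> c \<in> C \<Longrightarrow> syz_coeff C u c \<in> res_module E Cs"
  by (cases "c = base_elt C")
    (auto simp: syz_coeff_def[abs_def] res_module_Cons intro!: res_module_uminus res_module_sum)

lemma res_diff_res_module: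
  assumes "u \<in> res_module E Cs" "\<forall>C\<in>set Cs. C \<noteq> {} \<and> C \<subseteq> E"
  shows "res_diff Cs u \<in> res_module E Cs"
  using assms
proof (induction Cs arbitrary: u)
  case (Cons C Cs)
  have "(\<lambda>w. indet c * syz_coeff C u c w) \<in> res_module E Cs" if "c \<in> C" for c
    using Cons.prems that by (intro res_module_mult syz_coeff_res_module indet_polys) auto
  moreover have "syz_coeff C u c = (\<lambda>w. 0)" if "c \<notin> C" for c
  proof -
    have "c \<noteq> base_elt C" using that Cons.prems(2) base_elt_in[of C] by auto
    then show ?thesis using Cons.prems(1) that by (simp add: syz_coeff_def[abs_def] res_module_Cons)
  qed
  moreover have "res_diff Cs (\<lambda>v. u (Inr c # v)) \<in> res_module E Cs" if "c \<in> C - {base_elt C}" for c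
    using Cons.prems that by (intro Cons.IH) (simp_all add: res_module_Cons)
  moreover have "res_diff Cs (\<lambda>v. u (Inl c # v)) \<in> res_module E Cs" if "c \<in> C" for c
    using Cons.prems that by (intro Cons.IH) (simp_all add: res_module_Cons)
  ultimately show ?case
    using Cons.prems(1) unfolding res_module_Cons[of "res_diff (C # Cs) u"]
    by (simp add: res_module_Cons res_diff_zero res_module_add res_module_uminus)
qed (simp add: res_module_zero)

lemma res_aug_supported:
  assumes "u \<in> res_module E Cs" "\<forall>C\<in>set Cs. finite C \<and> C \<subseteq> E" "finite L" "L \<subseteq> E"
  shows "res_aug L Cs u \<in> supported_on (circuit_exps E L Cs)"
  using assms
proof (induction Cs arbitrary: u)
  case Nil
  then have "u [] \<in> polys E" by (simp add: res_module_def free_on_def)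
  then show ?case using Nil.prems
    by (auto simp: supported_on_monomial_times circuit_exps_def keys_plus_nat keys_sqfree_exp
        elim!: supported_on_mono)
next
  case (Cons C Cs)
  have "cofactor C c * res_aug L Cs (\<lambda>v. u (Inl c # v)) \<in> supported_on (circuit_exps E L (C # Cs))"
    if c: "c \<in> C" for c
  proof -
    have "res_aug L Cs (\<lambda>v. u (Inl c # v)) \<in> supported_on (circuit_exps E L Cs)"
      using Cons c by (auto simp: res_module_Cons)
    then have "res_aug L Cs (\<lambda>v. u (Inl c # v)) \<in>
        supported_on (\<lambda>m. circuit_exps E L (C # Cs) (sqfree_exp (C - {c}) + m))"
      by (rule supported_on_mono) (use Cons.prems c in \<open>auto intro!: circuit_exps_Cons\<close>)
    then show ?thesis by (simp only: supported_on_monomial_times)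
  qed
  then show ?case by (auto intro: supported_on_sum)
qed

section \<open>Surjectivity of the augmentation, and exactness\<close>

definition assemble ::
  "'e set \<Rightarrow> ('e \<Rightarrow> ('e + 'e) list \<Rightarrow> ('e, 'k::field) mpoly) \<Rightarrow>
    ('e \<Rightarrow> ('e + 'e) list \<Rightarrow> ('e, 'k) mpoly) \<Rightarrow> ('e + 'e) list \<Rightarrow> ('e, 'k) mpoly"
where
  "assemble C a b w = (case w of Inl c # v \<Rightarrow> if c \<in> C then a c v else 0
     | Inr c # v \<Rightarrow> if c \<in> C - {base_elt C} then b c v else 0 | [] \<Rightarrow> 0)"

lemma assemble_simps [simp]:
  "assemble C a b [] = 0"
  "assemble C a b (Inl c # v) = (if c \<in> C then a c v else 0)"
  "assemble C a b (Inr c # v) = (if c \<in> C - {base_elt C} then b c v else 0)"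
  by (simp_all add: assemble_def)

lemma assemble_res_module:
  assumes "\<And>c. c \<in> C \<Longrightarrow> a c \<in> res_module E Cs" "\<And>c. c \<in> C - {base_elt C} \<Longrightarrow> b c \<in> res_module E Cs"
  shows "assemble C a b \<in> res_module E (C # Cs)"
  using assms by (auto simp: res_module_Cons)

text \<open>A word stores no syzygy letter for \<open>base_elt C\<close>; a family with sum zero is
  nevertheless recovered completely, its missing member being minus the sum of the others.\<close>

lemma syz_coeff_assemble:
  assumes "finite C" "c \<in> C" "(\<Sum>c\<in>C. b c w) = 0"
  shows "syz_coeff C (assemble C a b) c w = b c w"
proof (cases "c = base_elt C")
  case True
  then have "b c w + (\<Sum>c\<in>C - {base_elt C}. b c w) = 0"
    using assms sum.remove[of C c "\<lambda>c. b c w"] by simp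
  moreover have "(\<Sum>x\<in>C - {c}. assemble C a b (Inr x # w)) = (\<Sum>x\<in>C - {c}. b x w)"
    using True by (intro sum.cong) auto
  ultimately show ?thesis using True by (simp add: syz_coeff_def neg_eq_iff_add_eq_0 add.commute)
qed (use assms in \<open>simp add: syz_coeff_def\<close>)

definition circuit_data :: "'e set \<Rightarrow> 'e set \<Rightarrow> 'e set list \<Rightarrow> bool" where
  "circuit_data E L Cs \<longleftrightarrow> finite L \<and> L \<subseteq> E \<and> (\<forall>C\<in>set Cs. finite C \<and> C \<noteq> {} \<and> C \<subseteq> E \<and> C \<inter> L = {}) \<and>
     sorted_wrt (\<lambda>C D. C \<inter> D = {}) Cs"

lemma circuit_data_Cons:
  assumes "circuit_data E L (C # Cs)"
  shows "circuit_data E L Cs" "finite C" "C \<noteq> {}" "C \<subseteq> E" "C \<inter> L = {}" "\<forall>D\<in>set Cs. C \<inter> D = {}"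
  using assms by (auto simp: circuit_data_def)

lemma indet_times_eq_0: "indet c * p = 0 \<Longrightarrow> p = 0"
  by (simp add: indet_def monomial_times_eq_0)

text \<open>Preimages of a family with sum zero, chosen one by one, need not have sum zero.
  Replacing the choice at \<open>base_elt C\<close> by minus the sum of the others repairs this, and
  by linearity it is still a preimage.\<close>

definition complete_family :: "'e set \<Rightarrow> ('e \<Rightarrow> 'w \<Rightarrow> 'a::comm_ring_1) \<Rightarrow> 'e \<Rightarrow> 'w \<Rightarrow> 'a" where
  "complete_family C f c = (if c = base_elt C then (\<lambda>w. - (\<Sum>b\<in>C - {base_elt C}. f b w)) else f c)"

lemma sum_complete_family: "finite C \<Longrightarrow> C \<noteq> {} \<Longrightarrow> (\<Sum>c\<in>C. complete_family C f c w) = 0"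
  by (subst sum.remove[OF _ base_elt_in]) (auto simp: complete_family_def)

lemma complete_family_res_module:
  "(\<And>c. c \<in> C - {base_elt C} \<Longrightarrow> f c \<in> res_module E Cs) \<Longrightarrow> c \<in> C \<Longrightarrow> complete_family C f c \<in> res_module E Cs"
  by (auto simp: complete_family_def intro!: res_module_uminus res_module_sum)

lemma complete_family_eq:
  assumes "finite C" "C \<noteq> {}" "c \<in> C" "(\<Sum>c\<in>C. g c) = 0" "\<And>c. c \<in> C - {base_elt C} \<Longrightarrow> f c = g c"
  shows "(if c = base_elt C then - (\<Sum>b\<in>C - {base_elt C}. f b) else f c) = (g c :: 'a::comm_ring_1)"
proof (cases "c = base_elt C")
  case True
  have "g (base_elt C) + (\<Sum>b\<in>C - {base_elt C}. g b) = 0"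
    using assms sum.remove[OF assms(1) base_elt_in[OF assms(2)], of g] by simp
  moreover have "(\<Sum>b\<in>C - {base_elt C}. f b) = (\<Sum>b\<in>C - {base_elt C}. g b)"
    using assms(5) by (intro sum.cong) auto
  ultimately show ?thesis using True by (simp add: neg_eq_iff_add_eq_0 add.commute)
qed (use assms in simp)

lemma res_diff_complete_family:
  assumes "finite C" "C \<noteq> {}" "c \<in> C" "\<And>w. (\<Sum>c\<in>C. g c w) = 0"
    and "\<And>c. c \<in> C - {base_elt C} \<Longrightarrow> res_diff Cs (f c) = g c"
  shows "res_diff Cs (complete_family C f c) = g c"
proof
  fix w
  show "res_diff Cs (complete_family C f c) w = g c w"
    using complete_family_eq[of C c "\<lambda>c. g c w" "\<lambda>c. res_diff Cs (f c) w"] assms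
    by (simp add: complete_family_def res_diff_uminus res_diff_sum split: if_splits)
qed

lemma res_aug_complete_family:
  assumes "finite C" "C \<noteq> {}" "c \<in> C" "(\<Sum>c\<in>C. g c) = 0"
    and "\<And>c. c \<in> C - {base_elt C} \<Longrightarrow> res_aug L Cs (f c) = g c"
  shows "res_aug L Cs (complete_family C f c) = g c"
  using complete_family_eq[of C c g "\<lambda>c. res_aug L Cs (f c)"] assms
  by (simp add: complete_family_def res_aug_uminus res_aug_sum split: if_splits)

text \<open>The preimage uses only words without syzygy letters, where the differential vanishes.
  That it is a cycle matters in \<open>res_exact\<close>, where it is subtracted from a cycle and
  the result has to remain one.\<close>

lemma res_aug_surj:
  assumes "circuit_data E L Cs" "p \<in> supported_on (circuit_exps E L Cs)"
  shows "\<exists>u\<in>res_module E Cs. res_diff Cs u = (\<lambda>w. 0) \<and> res_aug L Cs u = p"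
  using assms
proof (induction Cs arbitrary: p)
  case Nil
  have "\<exists>q. p = Poly_Mapping.single (sqfree_exp L) 1 * q"
    by (rule monomial_dividesI, rule sqfree_exp_divides)
      (use Nil in \<open>auto simp: supported_on_def circuit_exps_def\<close>)
  then obtain q where q: "p = Poly_Mapping.single (sqfree_exp L) 1 * q" by blast
  have "q \<in> supported_on (\<lambda>m. circuit_exps E L [] (sqfree_exp L + m))"
    using Nil.prems(2) unfolding q by (simp only: supported_on_monomial_times)
  then have "q \<in> polys E"
    by (rule supported_on_mono) (simp add: circuit_exps_def keys_plus_nat)
  then show ?case using q
    by (intro bexI[of _ "\<lambda>w. if w = [] then q else 0"]) (auto simp: res_module_def free_on_def)
next
  case (Cons C Cs)
  note C = circuit_data_Cons[OF Cons.prems(1)]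
  obtain q where q: "\<And>c. c \<in> C \<Longrightarrow> q c \<in> supported_on (circuit_exps E L Cs)"
    "p = (\<Sum>c\<in>C. cofactor C c * q c)"
    using circuit_exps_decompose[OF C(2,5,6) Cons.prems(2)] by blast
  have "\<exists>y. \<forall>c\<in>C. y c \<in> res_module E Cs \<and> res_diff Cs (y c) = (\<lambda>w. 0) \<and> res_aug L Cs (y c) = q c"
    by (rule bchoice) (use Cons.IH[OF C(1)] q in blast)
  then obtain y where y: "\<And>c. c \<in> C \<Longrightarrow> y c \<in> res_module E Cs"
    "\<And>c. c \<in> C \<Longrightarrow> res_diff Cs (y c) = (\<lambda>w. 0)" "\<And>c. c \<in> C \<Longrightarrow> res_aug L Cs (y c) = q c"
    by blast
  let ?u = "assemble C y (\<lambda>c w. 0)"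
  have "?u \<in> res_module E (C # Cs)"
    using y by (intro assemble_res_module res_module_zero) auto
  moreover have "res_diff (C # Cs) ?u = (\<lambda>w. 0)"
  proof
    fix w show "res_diff (C # Cs) ?u w = 0"
    proof (cases "(C # Cs, ?u, w)" rule: res_diff.cases)
      case (1 D Ds v c w')
      then show ?thesis
        using y(2) by (cases "c \<in> C") (simp_all add: syz_coeff_def res_diff_zero)
    next
      case (2 D Ds v c w')
      then show ?thesis by (auto simp: res_diff_zero cong: if_cong)
    qed auto
  qed
  moreover have "res_aug L (C # Cs) ?u = p"
    using y(3) q(2) by simp
  ultimately show ?case by blast
qed

text \<open>Let \<open>u\<close> have generator parts \<open>a c\<close> and syzygy parts
  \<open>s c\<close>. A preimage with parts \<open>z c\<close> and \<open>t c\<close> has to satisfy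
  \<open>res_diff Cs (z c) + indet c * t c = a c\<close> and
  \<open>- res_diff Cs (t c) = s c\<close>. The second equation is solved by induction up to a
  choice of cycles \<open>y c\<close>; these are chosen by means of \<open>cofactor_syzygy\<close>
  so that the first becomes solvable by induction too.\<close>

lemma res_exact:
  assumes "circuit_data E L Cs" "u \<in> res_module E Cs" "res_diff Cs u = (\<lambda>w. 0)" "res_aug L Cs u = 0"
  shows "\<exists>v\<in>res_module E Cs. res_diff Cs v = u"
  using assms
proof (induction Cs arbitrary: u)
  case Nil
  have "u w = 0" for w
    using Nil.prems(2,4) by (cases w) (auto simp: monomial_times_eq_0 res_module_def free_on_def)
  then have "u = (\<lambda>w. 0)" by auto
  then show ?case by (intro bexI[of _ "\<lambda>w. 0"]) (auto simp: res_module_zero)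
next
  case (Cons C Cs)
  note C = circuit_data_Cons[OF Cons.prems(1)]
  have ne: "\<forall>D\<in>set Cs. finite D \<and> D \<noteq> {}" "\<forall>D\<in>set Cs. finite D \<and> D \<subseteq> E" "finite L" "L \<subseteq> E"
    using C(1) by (auto simp: circuit_data_def)
  define a where "a c = (\<lambda>w. u (Inl c # w))" for c
  define s where "s = syz_coeff C u"
  have a: "a c \<in> res_module E Cs" and s: "s c \<in> res_module E Cs" if "c \<in> C" for c
    using that Cons.prems(2) syz_coeff_res_module[OF Cons.prems(2)]
    by (auto simp: a_def s_def res_module_Cons)
  have sum_s: "(\<Sum>c\<in>C. s c w) = 0" for w
    using sum_syz_coeff[OF C(2,3)] by (simp add: s_def)
  have D0: "res_diff (C # Cs) u w = 0" for w using Cons.prems(3) by simp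
  have Da: "res_diff Cs (a c) w + indet c * s c w = 0" for c w
    using D0[of "Inl c # w"] by (simp add: a_def s_def)
  have "res_diff Cs (\<lambda>v. u (Inr c # v)) w = 0" for c w
    using D0[of "Inr c # w"] by simp
  then have Ds: "res_diff Cs (s c) = (\<lambda>w. 0)" for c
    by (simp add: s_def fun_eq_iff res_diff_syz_coeff)
  \<comment> \<open>Augmenting the equation \<open>Da\<close> removes the boundary, and the variable
    \<open>c\<close> can be cancelled.\<close>
  have es: "res_aug L Cs (s c) = 0" for c
  proof -
    have "res_aug L Cs (\<lambda>w. res_diff Cs (a c) w + indet c * s c w) = 0"
      by (simp add: Da res_aug_zero)
    then have "indet c * res_aug L Cs (s c) = 0"
      by (simp add: res_aug_add res_aug_mult res_aug_res_diff[OF ne(1)])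
    then show ?thesis by (rule indet_times_eq_0)
  qed
  have "\<exists>\<beta>. \<forall>c\<in>C. \<beta> c \<in> res_module E Cs \<and> res_diff Cs (\<beta> c) = s c"
    by (rule bchoice) (use Cons.IH[OF C(1) s Ds es] in blast)
  then obtain \<beta>' where \<beta>': "\<And>c. c \<in> C \<Longrightarrow> \<beta>' c \<in> res_module E Cs" "\<And>c. c \<in> C \<Longrightarrow> res_diff Cs (\<beta>' c) = s c"
    by blast
  \<comment> \<open>Sum zero is needed twice: for the augmentations of the \<open>x c\<close> to
    form a relation between the cofactors, and for \<open>t\<close> to be the full syzygy family of
    an assembled vector.\<close>
  define \<beta> where "\<beta> = complete_family C \<beta>'"
  have \<beta>: "\<beta> c \<in> res_module E Cs" "res_diff Cs (\<beta> c) = s c" if "c \<in> C" for c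
    using that \<beta>' sum_s C(2,3) unfolding \<beta>_def
    by (auto intro!: complete_family_res_module res_diff_complete_family)
  have sum_\<beta>: "(\<Sum>c\<in>C. \<beta> c w) = 0" for w
    unfolding \<beta>_def by (rule sum_complete_family[OF C(2,3)])
  \<comment> \<open>With the provisional solution \<open>- \<beta> c\<close> of the second equation,
    \<open>x c\<close> is what \<open>res_diff Cs (z c)\<close> would have to be. It is a cycle, but
    its augmentation need not vanish.\<close>
  define x where "x c = (\<lambda>w. a c w + indet c * \<beta> c w)" for c
  have x: "x c \<in> res_module E Cs" if "c \<in> C" for c
    unfolding x_def using that a \<beta> C(4) by (intro res_module_add res_module_mult indet_polys) auto
  have Dx: "res_diff Cs (x c) = (\<lambda>w. 0)" if "c \<in> C" for c
    using Da \<beta>(2)[OF that] by (simp add: x_def res_diff_add res_diff_mult)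
  have "(\<Sum>c\<in>C. cofactor C c * res_aug L Cs (x c)) =
      (\<Sum>c\<in>C. cofactor C c * res_aug L Cs (a c)) + (\<Sum>c\<in>C. cofactor C c * indet c * res_aug L Cs (\<beta> c))"
    by (simp add: x_def res_aug_add res_aug_mult algebra_simps sum.distrib)
  also have "(\<Sum>c\<in>C. cofactor C c * res_aug L Cs (a c)) = 0"
    using Cons.prems(4) by (simp add: a_def)
  also have "(\<Sum>c\<in>C. cofactor C c * indet c * res_aug L Cs (\<beta> c)) =
      (\<Sum>c\<in>C. Poly_Mapping.single (sqfree_exp C) 1 * res_aug L Cs (\<beta> c))"
    using C(2) by (intro sum.cong) (simp_all add: cofactor_times_indet)
  also have "\<dots> = Poly_Mapping.single (sqfree_exp C) 1 * res_aug L Cs (\<lambda>w. \<Sum>c\<in>C. \<beta> c w)"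
    by (simp add: res_aug_sum sum_distrib_left)
  also have "\<dots> = 0" by (simp add: sum_\<beta> res_aug_zero)
  finally have "(\<Sum>c\<in>C. cofactor C c * res_aug L Cs (x c)) = 0" by simp
  moreover have "res_aug L Cs (x c) \<in> supported_on (circuit_exps E L Cs)" if "c \<in> C" for c
    by (rule res_aug_supported[OF x[OF that] ne(2-4)])
  ultimately obtain q where q: "\<And>c. c \<in> C \<Longrightarrow> q c \<in> supported_on (circuit_exps E L Cs)"
    "\<And>c. c \<in> C \<Longrightarrow> res_aug L Cs (x c) = indet c * q c" "(\<Sum>c\<in>C. q c) = 0"
    using cofactor_syzygy[OF C(2,5,6), of "\<lambda>c. res_aug L Cs (x c)" E] by blast
  have "\<exists>y. \<forall>c\<in>C. y c \<in> res_module E Cs \<and> res_diff Cs (y c) = (\<lambda>w. 0) \<and> res_aug L Cs (y c) = q c"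
    by (rule bchoice) (use res_aug_surj[OF C(1)] q in blast)
  then obtain y' where y': "\<And>c. c \<in> C \<Longrightarrow> y' c \<in> res_module E Cs"
    "\<And>c. c \<in> C \<Longrightarrow> res_diff Cs (y' c) = (\<lambda>w. 0)" "\<And>c. c \<in> C \<Longrightarrow> res_aug L Cs (y' c) = q c"
    by blast
  define y where "y = complete_family C y'"
  have y: "y c \<in> res_module E Cs" "res_diff Cs (y c) = (\<lambda>w. 0)" "res_aug L Cs (y c) = q c" if "c \<in> C" for c
    using that y' q(3) C(2,3) unfolding y_def
    by (auto intro!: complete_family_res_module res_diff_complete_family[where g = "\<lambda>_ _. 0"]
        res_aug_complete_family)
  have sum_y: "(\<Sum>c\<in>C. y c w) = 0" for w
    unfolding y_def by (rule sum_complete_family[OF C(2,3)])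
  \<comment> \<open>The augmentation of \<open>x c\<close> is \<open>indet c * q c\<close>, and
    \<open>y c\<close> is a cycle with augmentation \<open>q c\<close>; subtracting
    \<open>indet c * y c\<close> removes the obstruction.\<close>
  have "\<exists>z\<in>res_module E Cs. res_diff Cs z = (\<lambda>w. x c w - indet c * y c w)" if c: "c \<in> C" for c
  proof (rule Cons.IH[OF C(1)])
    show "(\<lambda>w. x c w - indet c * y c w) \<in> res_module E Cs"
      using c x y C(4) by (intro res_module_diff res_module_mult indet_polys) auto
    show "res_diff Cs (\<lambda>w. x c w - indet c * y c w) = (\<lambda>w. 0)"
      using Dx[OF c] y(2)[OF c] by (simp add: res_diff_diff res_diff_mult)
    show "res_aug L Cs (\<lambda>w. x c w - indet c * y c w) = 0"
      using q(2)[OF c] y(3)[OF c] by (simp add: res_aug_diff res_aug_mult)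
  qed
  then have "\<exists>z. \<forall>c\<in>C. z c \<in> res_module E Cs \<and> res_diff Cs (z c) = (\<lambda>w. x c w - indet c * y c w)"
    by (intro bchoice) blast
  then obtain z where z: "\<And>c. c \<in> C \<Longrightarrow> z c \<in> res_module E Cs"
    "\<And>c. c \<in> C \<Longrightarrow> res_diff Cs (z c) = (\<lambda>w. x c w - indet c * y c w)"
    by blast
  define t where "t c = (\<lambda>w. y c w - \<beta> c w)" for c
  have sum_t: "(\<Sum>c\<in>C. t c w) = 0" for w
    by (simp add: t_def sum_subtractf sum_y sum_\<beta>)
  define v where "v = assemble C z t"
  have "v \<in> res_module E (C # Cs)"
    unfolding v_def t_def using z y \<beta> by (intro assemble_res_module res_module_diff) auto
  moreover have "res_diff (C # Cs) v = u"
  proof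
    fix w show "res_diff (C # Cs) v w = u w"
    proof (cases w)
      case Nil
      then show ?thesis using Cons.prems(2) by (simp add: res_module_Cons)
    next
      case (Cons l w')
      show ?thesis
      proof (cases l)
        case (Inl c)
        show ?thesis
        proof (cases "c \<in> C")
          case True
          have "res_diff (C # Cs) v w = res_diff Cs (z c) w' + indet c * t c w'"
            using True Cons Inl syz_coeff_assemble[OF C(2) True sum_t] by (simp add: v_def)
          also have "\<dots> = a c w'" using z(2)[OF True] by (simp add: x_def t_def algebra_simps)
          finally show ?thesis by (simp add: a_def Cons Inl)
        next
          case False
          then have "c \<noteq> base_elt C" "u w = 0"
            using base_elt_in[OF C(3)] \<open>u \<in> res_module E (C # Cs)\<close> Cons Inl
            by (auto simp: res_module_Cons fun_eq_iff)
          then show ?thesis using False Cons Inl by (simp add: v_def syz_coeff_def res_diff_zero)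
        qed
      next
        case (Inr c)
        show ?thesis
        proof (cases "c \<in> C - {base_elt C}")
          case True
          have "res_diff (C # Cs) v w = - res_diff Cs (t c) w'"
            using True Cons Inr by (simp add: v_def)
          also have "\<dots> = s c w'" using True y(2) \<beta>(2) by (simp add: t_def res_diff_diff)
          finally show ?thesis using True by (simp add: s_def syz_coeff_def Cons Inr)
        next
          case False
          then have "u w = 0"
            using \<open>u \<in> res_module E (C # Cs)\<close> Cons Inr by (auto simp: res_module_Cons fun_eq_iff)
          then show ?thesis using False Cons Inr by (auto simp: v_def res_diff_zero)
        qed
      qed
    qed
  qed
  ultimately show ?case by blast
qed

section \<open>Minimality, and separation of the homological degrees\<close>

lemma lookup_indet_0: "Poly_Mapping.lookup (indet c) 0 = 0"
proof -
  have "Poly_Mapping.keys (Poly_Mapping.single c (1 :: nat)) \<noteq> {}" by simp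
  then have "Poly_Mapping.single c (1 :: nat) \<noteq> 0" by (metis keys_zero)
  then show ?thesis by (simp add: indet_def lookup_single)
qed

text \<open>All nonzero matrix entries of the differential are variables up to sign.\<close>

lemma res_diff_minimal: "Poly_Mapping.lookup (res_diff Cs u w) 0 = 0"
  by (induction Cs u w rule: res_diff.induct) (auto simp: lookup_add lookup_times_0 lookup_indet_0)

lemma word_degree_simps [simp]:
  "word_degree [] = 0" "word_degree (Inl c # w) = word_degree w"
  "word_degree (Inr c # w) = Suc (word_degree w)"
  by (simp_all add: word_degree_def)

lemma finite_res_words: "\<forall>C\<in>set Cs. finite C \<Longrightarrow> finite (res_words Cs)"
  by (induction Cs) auto

definition res_basis :: "'e set list \<Rightarrow> nat \<Rightarrow> ('e + 'e) list set" where
  "res_basis Cs n = {w \<in> res_words Cs. word_degree w = n}"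

text \<open>In other words, the differential lowers the word degree by exactly one.\<close>

lemma res_diff_cong:
  "(\<And>v. word_degree v = Suc (word_degree w) \<Longrightarrow> u v = u' v) \<Longrightarrow> res_diff Cs u w = res_diff Cs u' w"
proof (induction Cs u w arbitrary: u' rule: res_diff.induct)
  case (1 C Cs u c w)
  have "res_diff Cs (\<lambda>v. u (Inl c # v)) w = res_diff Cs (\<lambda>v. u' (Inl c # v)) w"
    by (rule "1.IH") (simp add: "1.prems")
  then show ?case by (simp add: syz_coeff_def "1.prems")
next
  case (2 C Cs u c w)
  have "res_diff Cs (\<lambda>v. u (Inr c # v)) w = res_diff Cs (\<lambda>v. u' (Inr c # v)) w"
    by (rule "2.IH") (simp add: "2.prems")
  then show ?case by simp
qed auto

lemma res_aug_cong:
  "(\<And>v. word_degree v = 0 \<Longrightarrow> u v = u' v) \<Longrightarrow> res_aug L Cs u = res_aug L Cs u'"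
proof (induction L Cs u arbitrary: u' rule: res_aug.induct)
  case (2 L C Cs u)
  have "res_aug L Cs (\<lambda>v. u (Inl c # v)) = res_aug L Cs (\<lambda>v. u' (Inl c # v))" if "c \<in> C" for c
    by (rule "2.IH"[OF that]) (simp add: "2.prems")
  then show ?case by simp
qed simp

definition homog :: "nat \<Rightarrow> (('e + 'e) list \<Rightarrow> ('e, 'k::field) mpoly) \<Rightarrow> ('e + 'e) list \<Rightarrow> ('e, 'k) mpoly" where
  "homog n u = (\<lambda>w. if word_degree w = n then u w else 0)"

lemma res_diff_homog_Suc: "res_diff Cs (homog (Suc n) u) = homog n (res_diff Cs u)"
proof
  fix w
  have "res_diff Cs (homog (Suc n) u) w = res_diff Cs (if word_degree w = n then u else (\<lambda>w. 0)) w"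
    by (rule res_diff_cong) (simp add: homog_def)
  then show "res_diff Cs (homog (Suc n) u) w = homog n (res_diff Cs u) w"
    by (simp add: homog_def res_diff_zero)
qed

lemma res_diff_homog_0: "res_diff Cs (homog 0 u) = (\<lambda>w. 0)"
proof
  fix w
  have "res_diff Cs (homog 0 u) w = res_diff Cs (\<lambda>w. 0) w"
    by (rule res_diff_cong) (simp add: homog_def)
  then show "res_diff Cs (homog 0 u) w = 0" by (simp add: res_diff_zero)
qed

lemma res_aug_homog: "res_aug L Cs (homog n u) = (if n = 0 then res_aug L Cs u else 0)"
proof -
  have "res_aug L Cs (homog n u) = res_aug L Cs (if n = 0 then u else (\<lambda>w. 0))"
    by (rule res_aug_cong) (simp add: homog_def)
  then show ?thesis by (simp add: res_aug_zero)
qed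

lemma free_on_res_basis:
  "u \<in> free_on (polys E) (res_basis Cs n) \<longleftrightarrow> u \<in> res_module E Cs \<and> homog n u = u"
proof
  assume u: "u \<in> free_on (polys E) (res_basis Cs n)"
  then have "u \<in> res_module E Cs"
    using free_onD[OF is_subring_polys u] by (auto simp: res_module_def free_on_def res_basis_def)
  moreover have "homog n u = u"
    using u by (auto simp: homog_def free_on_def res_basis_def fun_eq_iff)
  ultimately show "u \<in> res_module E Cs \<and> homog n u = u" by simp
next
  assume u: "u \<in> res_module E Cs \<and> homog n u = u"
  then have "u w = 0" if "word_degree w \<noteq> n" for w
  proof -
    have "homog n u w = u w" using u by simp
    then show ?thesis using that by (simp add: homog_def)
  qed
  then show "u \<in> free_on (polys E) (res_basis Cs n)"
    using u by (auto simp: res_module_def free_on_def res_basis_def)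
qed

lemma homog_free: "u \<in> res_module E Cs \<Longrightarrow> homog n u \<in> free_on (polys E) (res_basis Cs n)"
  by (auto simp: homog_def free_on_def res_basis_def res_module_def)

text \<open>Exactness in one degree follows from exactness of the total module: the homogeneous
  component of a preimage is again a preimage.\<close>

lemma resolution_circuits:
  assumes dat: "circuit_data E L Cs"
  shows "resolution (polys E :: ('e, 'k::field) mpoly set) (res_basis Cs) (\<lambda>u _. res_aug L Cs u)
    (\<lambda>n. res_diff Cs) ((\<lambda>p _. p) ` supported_on (circuit_exps E L Cs))"
proof -
  have C: "\<forall>C\<in>set Cs. C \<noteq> {} \<and> C \<subseteq> E" "\<forall>C\<in>set Cs. finite C \<and> C \<subseteq> E"
    "\<forall>C\<in>set Cs. finite C \<and> C \<noteq> {}" "\<forall>C\<in>set Cs. finite C" "finite L" "L \<subseteq> E"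
    using dat by (auto simp: circuit_data_def)
  let ?R = "polys E :: ('e, 'k) mpoly set"
  let ?F = "\<lambda>n. free_on ?R (res_basis Cs n)"
  have aug: "res_aug L Cs u \<in> supported_on (circuit_exps E L Cs)" if "u \<in> ?F n" for u n
    using that C by (intro res_aug_supported) (auto simp: free_on_res_basis)
  have diff: "res_diff Cs u \<in> ?F n" if "u \<in> ?F (Suc n)" for u n
    using that res_diff_res_module[OF _ C(1), of u] res_diff_homog_Suc[of Cs n u]
    by (simp add: free_on_res_basis)
  have exact: "\<exists>v\<in>?F (Suc n). res_diff Cs v = u"
    if u: "u \<in> ?F n" "res_diff Cs u = (\<lambda>w. 0)" "res_aug L Cs u = 0" for u n
  proof -
    have "u \<in> res_module E Cs" "homog n u = u" using u(1) by (simp_all add: free_on_res_basis)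
    moreover obtain v where v: "v \<in> res_module E Cs" "res_diff Cs v = u"
      using res_exact[OF dat _ u(2,3)] calculation by blast
    ultimately have "homog (Suc n) v \<in> ?F (Suc n)" "res_diff Cs (homog (Suc n) v) = u"
      by (simp_all add: homog_free res_diff_homog_Suc)
    then show ?thesis by blast
  qed
  \<comment> \<open>\<open>res_exact\<close> asks for a cycle with augmentation 0. The first
    condition is automatic in degree 0, the second in positive degrees.\<close>
  have closed0: "res_diff Cs u = (\<lambda>w. 0)" if "u \<in> ?F 0" for u
    using that res_diff_homog_0[of Cs u] by (simp add: free_on_res_basis)
  have augSuc: "res_aug L Cs u = 0" if "u \<in> ?F (Suc n)" for u n
    using that res_aug_homog[of L Cs "Suc n" u] by (simp add: free_on_res_basis)
  show ?thesis
    unfolding resolution_def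
  proof (intro conjI allI)
    show "finite (res_basis Cs i)" for i
      using finite_res_words[OF C(4)] by (simp add: res_basis_def)
    show "linear_on ?R (res_basis Cs 0) UNIV (\<lambda>u (_ :: unit). res_aug L Cs u)"
    proof -
      have "(\<lambda>_ :: unit. res_aug L Cs u) \<in> free_on ?R UNIV" if "u \<in> ?F 0" for u
        using supported_on_mono[OF aug[OF that]] by (simp add: free_on_def circuit_exps_def)
      then show ?thesis by (simp add: linear_on_def res_aug_add res_aug_mult)
    qed
    show "linear_on ?R (res_basis Cs (Suc i)) (res_basis Cs i) (res_diff Cs)" for i
      using diff by (auto simp: linear_on_def res_diff_add res_diff_mult)
    show "(\<lambda>u _. res_aug L Cs u) ` ?F 0 = (\<lambda>p _. p) ` supported_on (circuit_exps E L Cs)"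
    proof safe
      fix u :: "('e + 'e) list \<Rightarrow> ('e, 'k) mpoly" assume "u \<in> ?F 0"
      then show "(\<lambda>_. res_aug L Cs u) \<in> (\<lambda>p _. p) ` supported_on (circuit_exps E L Cs)"
        using aug by blast
    next
      fix p :: "('e, 'k) mpoly" assume "p \<in> supported_on (circuit_exps E L Cs)"
      then obtain u where "u \<in> res_module E Cs" "res_aug L Cs u = p"
        using res_aug_surj[OF dat] by blast
      then have "homog 0 u \<in> ?F 0" "res_aug L Cs (homog 0 u) = p"
        by (simp_all add: homog_free res_aug_homog)
      then show "(\<lambda>_. p) \<in> (\<lambda>u _. res_aug L Cs u) ` ?F 0" by blast
    qed
    show "res_diff Cs ` ?F (Suc 0) = ker_on ?R (res_basis Cs 0) (\<lambda>u (_ :: unit). res_aug L Cs u)"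
    proof safe
      fix u :: "('e + 'e) list \<Rightarrow> ('e, 'k) mpoly" assume "u \<in> ?F (Suc 0)"
      then show "res_diff Cs u \<in> ker_on ?R (res_basis Cs 0) (\<lambda>u (_ :: unit). res_aug L Cs u)"
        by (simp add: ker_on_def diff res_aug_res_diff[OF C(3)])
    next
      fix u :: "('e + 'e) list \<Rightarrow> ('e, 'k) mpoly" assume "u \<in> ker_on ?R (res_basis Cs 0) (\<lambda>u (_ :: unit). res_aug L Cs u)"
      then have "u \<in> ?F 0" "res_aug L Cs u = 0" by (simp_all add: ker_on_def fun_eq_iff)
      then show "u \<in> res_diff Cs ` ?F (Suc 0)" using exact[of u 0] closed0 by blast
    qed
    show "res_diff Cs ` ?F (Suc (Suc i)) = ker_on ?R (res_basis Cs (Suc i)) (res_diff Cs)" for i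
    proof safe
      fix u :: "('e + 'e) list \<Rightarrow> ('e, 'k) mpoly" assume "u \<in> ?F (Suc (Suc i))"
      then show "res_diff Cs u \<in> ker_on ?R (res_basis Cs (Suc i)) (res_diff Cs)"
        by (simp add: ker_on_def diff res_diff_res_diff)
    next
      fix u :: "('e + 'e) list \<Rightarrow> ('e, 'k) mpoly" assume "u \<in> ker_on ?R (res_basis Cs (Suc i)) (res_diff Cs)"
      then have "u \<in> ?F (Suc i)" "res_diff Cs u = (\<lambda>w. 0)" by (simp_all add: ker_on_def)
      then show "u \<in> res_diff Cs ` ?F (Suc (Suc i))" using exact[of u "Suc i"] augSuc by blast
    qed
  qed
qed

text \<open>The generating polynomial of the ranks is multiplicative: each circuit offers
  \<open>card C\<close> letters of degree 0 and \<open>card C - 1\<close> of degree 1. Real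
  coefficients avoid truncated subtraction and provide the roots used for comparing factors.\<close>

lemma sum_monom_word_degree:
  assumes "\<forall>C\<in>set Cs. finite C \<and> C \<noteq> {}"
  shows "(\<Sum>w\<in>res_words Cs. monom (1::real) (word_degree w)) =
    (\<Prod>C\<leftarrow>Cs. [:real (card C), real (card C) - 1:])"
  using assms
proof (induction Cs)
  case (Cons C Cs)
  then have C: "finite C" "C \<noteq> {}" and fin: "finite (res_words Cs)"
    by (auto intro: finite_res_words)
  let ?P = "\<Sum>w\<in>res_words Cs. monom (1::real) (word_degree w)"
  let ?l = "\<lambda>(c, w). Inl c # w" and ?r = "\<lambda>(c, w). Inr c # w"
  have inj: "inj_on ?l (C \<times> res_words Cs)" "inj_on ?r ((C - {base_elt C}) \<times> res_words Cs)"
    by (auto simp: inj_on_def)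
  have "(\<Sum>w\<in>res_words (C # Cs). monom (1::real) (word_degree w)) =
      (\<Sum>w\<in>?l ` (C \<times> res_words Cs). monom 1 (word_degree w)) +
      (\<Sum>w\<in>?r ` ((C - {base_elt C}) \<times> res_words Cs). monom 1 (word_degree w))"
    unfolding res_words.simps using C fin by (intro sum.union_disjoint) auto
  also have "(\<Sum>w\<in>?l ` (C \<times> res_words Cs). monom (1::real) (word_degree w)) = (\<Sum>c\<in>C. ?P)"
    unfolding sum.reindex[OF inj(1)] sum.cartesian_product by (intro sum.cong) auto
  also have "(\<Sum>w\<in>?r ` ((C - {base_elt C}) \<times> res_words Cs). monom (1::real) (word_degree w)) =
      (\<Sum>c\<in>C - {base_elt C}. monom 1 1 * ?P)"
    unfolding sum.reindex[OF inj(2)] sum_distrib_left sum.cartesian_product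
    by (intro sum.cong) (auto simp: mult_monom)
  also have "(\<Sum>c\<in>C. ?P) + (\<Sum>c\<in>C - {base_elt C}. monom 1 1 * ?P) =
      (of_nat (card C) + of_nat (card (C - {base_elt C})) * monom 1 1) * ?P"
    by (simp add: algebra_simps)
  also have "of_nat (card C) + of_nat (card (C - {base_elt C})) * monom 1 1 =
      [:real (card C), real (card C) - 1:]"
  proof -
    have "real (card (C - {base_elt C})) = real (card C) - 1"
      using C base_elt_in[of C] card_gt_0_iff[of C] by (simp add: of_nat_diff)
    then show ?thesis by (simp add: of_nat_poly monom_altdef)
  qed
  finally show ?case using Cons by simp
qed simp

lemma card_res_basis:
  assumes "\<forall>C\<in>set Cs. finite C \<and> C \<noteq> {}"
  shows "real (card (res_basis Cs n)) = coeff (\<Prod>C\<leftarrow>Cs. [:real (card C), real (card C) - 1:]) n"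
proof -
  have "finite (res_words Cs)" using assms by (simp add: finite_res_words)
  then have "real (card (res_basis Cs n)) = (\<Sum>w\<in>res_words Cs. if word_degree w = n then 1 else 0)"
    by (simp add: res_basis_def flip: sum.inter_filter)
  then show ?thesis by (simp add: coeff_sum flip: sum_monom_word_degree[OF assms])
qed

text \<open>
  The factor \<open>n + (n - 1) t\<close> is recognised by its root \<open>- n / (n - 1)\<close>, which determines \<open>n\<close>.
\<close>

lemma linear_factors_bij:
  fixes f :: "'x \<Rightarrow> nat" and g :: "'y \<Rightarrow> nat"
  assumes "finite X" "finite Y" "\<And>x. x \<in> X \<Longrightarrow> 2 \<le> f x" "\<And>y. y \<in> Y \<Longrightarrow> 2 \<le> g y"
    and "(\<Prod>x\<in>X. [:real (f x), real (f x) - 1:]) = (\<Prod>y\<in>Y. [:real (g y), real (g y) - 1:])"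
  shows "\<exists>h. bij_betw h X Y \<and> (\<forall>x\<in>X. g (h x) = f x)"
  using assms
proof (induction X arbitrary: Y rule: finite_induct)
  case empty
  have "Y = {}"
  proof (rule ccontr)
    assume "Y \<noteq> {}"
    then obtain y where y: "y \<in> Y" by blast
    have "[:real (g y), real (g y) - 1:] dvd (\<Prod>y\<in>Y. [:real (g y), real (g y) - 1:])"
      by (rule dvd_prodI[OF empty.prems(1) y])
    also have "\<dots> = 1" using empty by simp
    finally have "degree [:real (g y), real (g y) - 1:] \<le> degree (1 :: real poly)"
      by (rule dvd_imp_degree_le) simp
    then show False using empty.prems(3)[OF y] by (simp split: if_splits)
  qed
  then show ?case by (auto simp: bij_betw_def)
next
  case (insert x X)
  let ?q = "\<lambda>n. [:real n, real n - 1:]"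
  let ?r = "- real (f x) / (real (f x) - 1)"
  have fx: "real (f x) \<ge> 2" using insert.prems(2)[of x] by simp
  have "poly (\<Prod>x\<in>insert x X. ?q (f x)) ?r = 0"
    using insert.hyps fx by (simp add: poly_prod field_simps)
  then have "(\<Prod>y\<in>Y. poly (?q (g y)) ?r) = 0"
    using insert.prems(4) by (simp add: poly_prod)
  then obtain y0 where y0: "y0 \<in> Y" "poly (?q (g y0)) ?r = 0"
    using insert.prems(1) by (auto simp: prod_zero_iff)
  then have "real (g y0) * (real (f x) - 1) = real (f x) * (real (g y0) - 1)"
    using fx by (simp add: field_simps)
  then have "\<exists>y\<in>Y. g y = f x"
    using y0(1) by (intro bexI[of _ y0]) (simp_all add: algebra_simps)
  then obtain y where y: "y \<in> Y" "g y = f x" by blast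
  have "?q (f x) * (\<Prod>x\<in>X. ?q (f x)) = ?q (g y) * (\<Prod>y\<in>Y - {y}. ?q (g y))"
    using insert.prems(4) insert.hyps prod.remove[OF insert.prems(1) y(1), of "\<lambda>y. ?q (g y)"] by simp
  moreover have "?q (f x) \<noteq> 0" using insert.prems(2)[of x] by simp
  ultimately have "(\<Prod>x\<in>X. ?q (f x)) = (\<Prod>y\<in>Y - {y}. ?q (g y))"
    unfolding y(2) by (rule mult_left_cancel[THEN iffD1, rotated])
  then have "\<exists>h. bij_betw h X (Y - {y}) \<and> (\<forall>x\<in>X. g (h x) = f x)"
    using insert.prems(1-3) by (intro insert.IH) auto
  then obtain h where h: "bij_betw h X (Y - {y})" "\<forall>x\<in>X. g (h x) = f x"
    by blast
  have "bij_betw (h(x := y)) (insert x X) (insert y (Y - {y}))"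
    using h(1) insert.hyps(2) by (auto simp: bij_betw_def inj_on_def)
  moreover have "insert y (Y - {y}) = Y" using y by blast
  moreover have "\<forall>a\<in>insert x X. g ((h(x := y)) a) = f a"
    using h(2) y(2) insert.hyps(2) by auto
  ultimately show ?case by metis
qed

section \<open>Higher weights and facet ideals\<close>

text \<open>\<open>N\<close> is the direct sum of the circuits in \<open>\<C>\<close> and of coloops.\<close>

definition disjoint_circuits :: "'e matroid \<Rightarrow> 'e set set \<Rightarrow> bool" where
  "disjoint_circuits N \<C> \<longleftrightarrow> finite (ground N) \<and> (\<forall>C\<in>\<C>. C \<subseteq> ground N \<and> 2 \<le> card C) \<and>
     (\<forall>C\<in>\<C>. \<forall>D\<in>\<C>. \<forall>e. e \<in> C \<longrightarrow> e \<in> D \<longrightarrow> C = D) \<and>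
     indep N = {F. F \<subseteq> ground N \<and> (\<forall>C\<in>\<C>. \<not> C \<subseteq> F)}"

lemma disjoint_circuits_cycle_matroid:
  assumes "cactus G" "loop_free G"
  shows "disjoint_circuits (cycle_matroid G) (circuits G)"
proof -
  have "finite (edges G)" using assms by (simp add: cactus_def connected_graph_def graph_def)
  then show ?thesis
    unfolding disjoint_circuits_def indep_cycle_matroid
    using circuits_subset[of _ G] circuits_card[OF assms(2)] circuits_eqI[OF assms]
    by (auto simp: cycle_matroid_def)
qed

section \<open>Nullity and higher weights\<close>

lemma disjoint_circuitsD:
  assumes "disjoint_circuits N \<C>"
  shows "finite (ground N)" "finite \<C>"
    "\<And>C. C \<in> \<C> \<Longrightarrow> C \<subseteq> ground N" "\<And>C. C \<in> \<C> \<Longrightarrow> 2 \<le> card C" "\<And>C. C \<in> \<C> \<Longrightarrow> finite C"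
    "\<And>C. C \<in> \<C> \<Longrightarrow> C \<noteq> {}"
    "\<And>C D e. C \<in> \<C> \<Longrightarrow> D \<in> \<C> \<Longrightarrow> e \<in> C \<Longrightarrow> e \<in> D \<Longrightarrow> C = D"
    "\<And>F. F \<in> indep N \<longleftrightarrow> F \<subseteq> ground N \<and> (\<forall>C\<in>\<C>. \<not> C \<subseteq> F)"
proof -
  show fin: "finite (ground N)" and sub: "\<And>C. C \<in> \<C> \<Longrightarrow> C \<subseteq> ground N"
    and card: "\<And>C. C \<in> \<C> \<Longrightarrow> 2 \<le> card C"
    using assms by (auto simp: disjoint_circuits_def)
  show "finite \<C>" by (rule finite_subset[of \<C> "Pow (ground N)"]) (use fin sub in auto)
  show "finite C" if "C \<in> \<C>" for C by (rule finite_subset[OF sub[OF that] fin])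
  show "C \<noteq> {}" if "C \<in> \<C>" for C using card[OF that] by auto
  show "C = D" if "C \<in> \<C>" "D \<in> \<C>" "e \<in> C" "e \<in> D" for C D e
    using assms that by (simp add: disjoint_circuits_def)
  show "F \<in> indep N \<longleftrightarrow> F \<subseteq> ground N \<and> (\<forall>C\<in>\<C>. \<not> C \<subseteq> F)" for F
    using assms by (simp add: disjoint_circuits_def)
qed

text \<open>An independent subset of \<open>\<tau>\<close> misses an element of every circuit inside
  \<open>\<tau>\<close>, and these elements differ as the circuits are disjoint. Omitting just
  \<open>base_elt C\<close> from each such circuit attains the bound.\<close>

lemma nullity_disjoint_circuits:
  assumes N: "disjoint_circuits N \<C>" and t: "\<tau> \<subseteq> ground N"
  shows "card \<tau> - rk N \<tau> = card {C\<in>\<C>. C \<subseteq> \<tau>}"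
proof -
  note D = disjoint_circuitsD[OF N]
  let ?K = "{C\<in>\<C>. C \<subseteq> \<tau>}"
  have fin: "finite \<tau>" "finite ?K" using t D(1,2) finite_subset by auto
  have bound: "card I + card ?K \<le> card \<tau>" if I: "I \<in> indep N" "I \<subseteq> \<tau>" for I
  proof -
    have "\<forall>C\<in>?K. \<exists>x. x \<in> C - I"
      using D(8)[of I] I(1) by auto
    then obtain f where f: "\<And>C. C \<in> ?K \<Longrightarrow> f C \<in> C - I" by metis
    have "inj_on f ?K"
    proof (rule inj_onI)
      fix C C' assume "C \<in> ?K" "C' \<in> ?K" "f C = f C'"
      then show "C = C'" using f[of C] f[of C'] D(7)[of C C' "f C"] by auto
    qed
    then have "card ?K = card (f ` ?K)" by (simp add: card_image)
    also have "\<dots> \<le> card (\<tau> - I)" using f fin by (intro card_mono) auto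
    finally show ?thesis using I fin card_mono[of \<tau> I] by (simp add: card_Diff_subset finite_subset)
  qed
  let ?I = "\<tau> - base_elt ` ?K"
  have base: "base_elt C \<in> C" if "C \<in> \<C>" for C using base_elt_in D(6)[OF that] by metis
  have "?I \<in> indep N"
    unfolding D(8)
  proof (intro conjI ballI notI)
    fix C assume C: "C \<in> \<C>" "C \<subseteq> ?I"
    then have "base_elt C \<in> base_elt ` ?K" by auto
    then show False using base[OF C(1)] C(2) by blast
  qed (use t in auto)
  moreover have cardI: "card ?I + card ?K = card \<tau>"
  proof -
    have "inj_on base_elt ?K"
    proof (rule inj_onI)
      fix C C' assume "C \<in> ?K" "C' \<in> ?K" "base_elt C = base_elt C'"
      then show "C = C'" using base[of C] base[of C'] D(7)[of C C' "base_elt C"] by auto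
    qed
    moreover have "base_elt ` ?K \<subseteq> \<tau>" using base by auto
    moreover have "card (base_elt ` ?K) \<le> card \<tau>" using calculation fin by (intro card_mono)
    ultimately show ?thesis using fin by (simp add: card_Diff_subset card_image)
  qed
  moreover have "finite {I \<in> indep N. I \<subseteq> \<tau>}" using fin by simp
  ultimately have "rk N \<tau> = card ?I"
    unfolding rk_def using bound by (intro Max_eqI) (auto simp flip: cardI)
  then show ?thesis using cardI by simp
qed

text \<open>Shrinking \<open>\<tau>\<close> to the union of the circuits it contains keeps the
  nullity, so unions of circuits suffice; by disjointness their sizes add up. If there are fewer
  than \<open>i\<close> circuits, both infima are over the empty set.\<close>

lemma higher_weight_disjoint_circuits:
  assumes N: "disjoint_circuits N \<C>"
  shows "higher_weight N i = (INF K\<in>{K. K \<subseteq> \<C> \<and> card K = i}. enat (\<Sum>C\<in>K. card C))"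
proof -
  note D = disjoint_circuitsD[OF N]
  have Union: "card (\<Union>K) = (\<Sum>C\<in>K. card C)" if "K \<subseteq> \<C>" for K
  proof (rule card_Union_disjoint)
    show "pairwise disjnt K"
      unfolding pairwise_def disjnt_iff using that D(7) by blast
  qed (use that D(5) in blast)
  show ?thesis
  proof (rule antisym)
    show "higher_weight N i \<le> (INF K\<in>{K. K \<subseteq> \<C> \<and> card K = i}. enat (\<Sum>C\<in>K. card C))"
    proof (rule INF_greatest)
      fix K assume K: "K \<in> {K. K \<subseteq> \<C> \<and> card K = i}"
      \<comment> \<open>A union of some of the circuits contains no further one, because any element
        of a circuit determines that circuit.\<close>
      have "{C\<in>\<C>. C \<subseteq> \<Union>K} = K"
      proof
        show "{C\<in>\<C>. C \<subseteq> \<Union>K} \<subseteq> K"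
        proof clarify
          fix C assume C: "C \<in> \<C>" "C \<subseteq> \<Union>K"
          obtain e where "e \<in> C" using D(6)[OF C(1)] by blast
          moreover then obtain C' where "C' \<in> K" "e \<in> C'" using C(2) by blast
          ultimately show "C \<in> K" using D(7)[of C C' e] C K by blast
        qed
      qed (use K in blast)
      moreover have "\<Union>K \<subseteq> ground N" using K D(3) by blast
      ultimately show "higher_weight N i \<le> enat (\<Sum>C\<in>K. card C)"
        unfolding higher_weight_def using K Union[of K] nullity_disjoint_circuits[OF N, of "\<Union>K"]
        by (intro INF_lower2[of "\<Union>K"]) auto
    qed
  next
    show "(INF K\<in>{K. K \<subseteq> \<C> \<and> card K = i}. enat (\<Sum>C\<in>K. card C)) \<le> higher_weight N i"
      unfolding higher_weight_def
    proof (rule INF_greatest)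
      fix \<tau> assume t: "\<tau> \<in> {\<tau>. \<tau> \<subseteq> ground N \<and> card \<tau> - rk N \<tau> = i}"
      let ?K = "{C\<in>\<C>. C \<subseteq> \<tau>}"
      have "card ?K = i" using t nullity_disjoint_circuits[OF N, of \<tau>] by auto
      moreover have "(\<Sum>C\<in>?K. card C) \<le> card \<tau>"
        using t D(1) finite_subset unfolding Union[of ?K, OF Collect_restrict, symmetric]
        by (intro card_mono) auto
      ultimately show "(INF K\<in>{K. K \<subseteq> \<C> \<and> card K = i}. enat (\<Sum>C\<in>K. card C)) \<le> enat (card \<tau>)"
        by (intro INF_lower2[of ?K]) auto
    qed
  qed
qed

lemma higher_weight_le_if_inj:
  assumes N: "disjoint_circuits N \<C>" and N': "disjoint_circuits N' \<D>"
    and h: "inj_on h \<C>" "h ` \<C> \<subseteq> \<D>" "\<And>C. C \<in> \<C> \<Longrightarrow> card (h C) = card C"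
  shows "higher_weight N' i \<le> higher_weight N i"
  unfolding higher_weight_disjoint_circuits[OF N] higher_weight_disjoint_circuits[OF N']
proof (rule INF_greatest)
  fix K assume K: "K \<in> {K. K \<subseteq> \<C> \<and> card K = i}"
  have "inj_on h K" using K h(1) inj_on_subset by blast
  then have "card (h ` K) = i" "(\<Sum>C\<in>h ` K. card C) = (\<Sum>C\<in>K. card C)"
    using K h(3) by (auto simp: card_image sum.reindex intro!: sum.cong)
  then show "(INF K\<in>{K. K \<subseteq> \<D> \<and> card K = i}. enat (\<Sum>C\<in>K. card C)) \<le> enat (\<Sum>C\<in>K. card C)"
    using K h(2) by (intro INF_lower2[of "h ` K"]) auto
qed

lemma higher_weight_eq_if_bij:
  assumes N: "disjoint_circuits N \<C>" and N': "disjoint_circuits N' \<D>"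
    and h: "bij_betw h \<C> \<D>" "\<And>C. C \<in> \<C> \<Longrightarrow> card (h C) = card C"
  shows "higher_weight N i = higher_weight N' i"
proof (rule antisym)
  show "higher_weight N' i \<le> higher_weight N i"
    using h by (intro higher_weight_le_if_inj[OF N N', of h]) (auto simp: bij_betw_def)
  have "bij_betw (inv_into \<C> h) \<D> \<C>" using h(1) by (rule bij_betw_inv_into)
  moreover have "card (inv_into \<C> h D) = card D" if "D \<in> \<D>" for D
    using h that by (metis bij_betw_def f_inv_into_f inv_into_into)
  ultimately show "higher_weight N i \<le> higher_weight N' i"
    by (intro higher_weight_le_if_inj[OF N' N, of "inv_into \<C> h"]) (auto simp: bij_betw_def)
qed

text \<open>The bases are the complements of the sets consisting of one element from each circuit,
  so a support that contains a basis is one that contains all coloops and all but one element of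
  every circuit.\<close>

lemma bases_disjoint_circuits:
  assumes N: "disjoint_circuits N \<C>" and Cs: "set Cs = \<C>"
  shows "circuit_exps (ground N) (ground N - \<Union>\<C>) Cs m \<longleftrightarrow>
    Poly_Mapping.keys m \<subseteq> ground N \<and> (\<exists>\<sigma>\<in>bases N. \<sigma> \<subseteq> Poly_Mapping.keys m)"
proof -
  note D = disjoint_circuitsD[OF N]
  have insert_indep: "insert e \<sigma> \<in> indep N"
    if "\<sigma> \<in> indep N" "e \<in> ground N" "\<And>C. C \<in> \<C> \<Longrightarrow> e \<in> C \<Longrightarrow> \<not> C \<subseteq> insert e \<sigma>" for e \<sigma>
    using that unfolding D(8) by (metis insert_subset subset_insert)
  show ?thesis
  proof
    assume m: "circuit_exps (ground N) (ground N - \<Union>\<C>) Cs m"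
    then have "\<forall>C\<in>\<C>. \<exists>c. c \<in> C \<and> C - {c} \<subseteq> Poly_Mapping.keys m"
      using Cs by (auto simp: circuit_exps_def)
    then obtain f where f: "\<And>C. C \<in> \<C> \<Longrightarrow> f C \<in> C" "\<And>C. C \<in> \<C> \<Longrightarrow> C - {f C} \<subseteq> Poly_Mapping.keys m"
      by metis
    let ?B = "ground N - f ` \<C>"
    have B: "?B \<in> indep N" unfolding D(8) using f(1) by blast
    \<comment> \<open>A strictly larger \<open>I\<close> contains some \<open>f C\<close>. The rest
      of \<open>C\<close> is already in \<open>?B\<close>, so \<open>I\<close> would contain the
      circuit \<open>C\<close>.\<close>
    have "I = ?B" if I: "I \<in> indep N" "?B \<subseteq> I" for I
    proof (rule ccontr)
      assume "I \<noteq> ?B"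
      then obtain C where C: "C \<in> \<C>" "f C \<in> I" using I D(8) by auto
      have "C \<subseteq> I"
      proof
        fix e assume e: "e \<in> C"
        show "e \<in> I"
        proof (cases "e \<in> f ` \<C>")
          case True
          then obtain C' where "C' \<in> \<C>" "e = f C'" by blast
          then show ?thesis using D(7)[of C C' e] f(1)[of C'] C e by auto
        next
          case False then show ?thesis using e C(1) D(3) I(2) by blast
        qed
      qed
      then show False using I(1) C(1) D(8) by blast
    qed
    then have "?B \<in> bases N" using B by (simp add: bases_def)
    moreover have "?B \<subseteq> Poly_Mapping.keys m"
    proof
      fix e assume e: "e \<in> ?B"
      show "e \<in> Poly_Mapping.keys m"
      proof (cases "e \<in> \<Union>\<C>")
        case True then show ?thesis using f(2) e by blast
      next
        case False then show ?thesis using e m by (auto simp: circuit_exps_def)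
      qed
    qed
    ultimately show "Poly_Mapping.keys m \<subseteq> ground N \<and> (\<exists>\<sigma>\<in>bases N. \<sigma> \<subseteq> Poly_Mapping.keys m)"
      using m by (auto simp: circuit_exps_def)
  next
    assume m: "Poly_Mapping.keys m \<subseteq> ground N \<and> (\<exists>\<sigma>\<in>bases N. \<sigma> \<subseteq> Poly_Mapping.keys m)"
    then obtain \<sigma> where s: "\<sigma> \<in> indep N" "\<And>I. I \<in> indep N \<Longrightarrow> \<sigma> \<subseteq> I \<Longrightarrow> I = \<sigma>"
      "\<sigma> \<subseteq> Poly_Mapping.keys m" by (auto simp: bases_def)
    \<comment> \<open>Maximality of \<open>\<sigma>\<close>: an element stays out of a basis only if
      adding it completes a circuit through it.\<close>
    have max: "e \<in> \<sigma>" if "e \<in> ground N" "\<And>C. C \<in> \<C> \<Longrightarrow> e \<in> C \<Longrightarrow> \<not> C \<subseteq> insert e \<sigma>" for e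
      using s(2)[OF insert_indep[OF s(1) that]] by blast
    have "ground N - \<Union>\<C> \<subseteq> \<sigma>"
    proof
      fix e assume "e \<in> ground N - \<Union>\<C>"
      then show "e \<in> \<sigma>" by (intro max) auto
    qed
    moreover have "\<exists>c\<in>C. C - {c} \<subseteq> \<sigma>" if C: "C \<in> \<C>" for C
    proof -
      obtain c where c: "c \<in> C" "c \<notin> \<sigma>" using s(1) C D(8)[of \<sigma>] by auto
      have "C - {c} \<subseteq> \<sigma>"
      proof
        fix e assume e: "e \<in> C - {c}"
        show "e \<in> \<sigma>"
        proof (rule max)
          fix C' assume "C' \<in> \<C>" "e \<in> C'"
          then have "C' = C" using D(7)[of C C' e] C e by auto
          then show "\<not> C' \<subseteq> insert e \<sigma>" using c e by auto
        qed (use e C D(3) in blast)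
      qed
      then show ?thesis using c by blast
    qed
    ultimately show "circuit_exps (ground N) (ground N - \<Union>\<C>) Cs m"
      using m s(3) Cs unfolding circuit_exps_def by (meson order_trans)
  qed
qed

section \<open>The facet ideal as an ideal spanned by monomials\<close>

lemma poly_ring_simps [simp]:
  "carrier (poly_ring K E) = polys E" "x \<oplus>\<^bsub>poly_ring K E\<^esub> y = x + y"
  "x \<otimes>\<^bsub>poly_ring K E\<^esub> y = x * y" "\<zero>\<^bsub>poly_ring K E\<^esub> = 0" "\<one>\<^bsub>poly_ring K E\<^esub> = 1"
  by (simp_all add: poly_ring_def supported_on_def)

lemma ideal_poly_ringI:
  assumes sub: "I \<subseteq> polys E" and closed: "0 \<in> I" "\<And>p q. p \<in> I \<Longrightarrow> q \<in> I \<Longrightarrow> p + q \<in> I"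
    "\<And>p q. p \<in> I \<Longrightarrow> q \<in> polys E \<Longrightarrow> q * p \<in> I"
  shows "ideal I (poly_ring TYPE('k::field) E)"
proof -
  interpret cring "poly_ring TYPE('k) E" by (rule cring_poly_ring)
  have neg: "\<ominus>\<^bsub>poly_ring TYPE('k) E\<^esub> p \<in> I" if "p \<in> I" for p
  proof -
    have "p \<in> polys E" "- p \<in> polys E" using that sub by (auto intro: supported_on_uminus)
    then have "\<ominus>\<^bsub>poly_ring TYPE('k) E\<^esub> p = - p" by (intro minus_equality) simp_all
    also have "\<dots> = (- 1) * p" by simp
    also have "\<dots> \<in> I"
      using that by (intro closed(3) supported_on_uminus) (simp_all add: supported_on_def)
    finally show ?thesis .
  qed
  show ?thesis
  proof (rule idealI)
    show "ring (poly_ring TYPE('k) E)" by (rule ring_axioms)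
    show "subgroup I (add_monoid (poly_ring TYPE('k) E))"
    proof (rule subgroup.intro)
      show "inv\<^bsub>add_monoid (poly_ring TYPE('k) E)\<^esub> p \<in> I" if "p \<in> I" for p
        using neg[OF that] by (simp only: a_inv_def)
    qed (use sub closed in auto)
  qed (use closed in \<open>auto simp: mult.commute\<close>)
qed

lemma supported_on_up_closed_mult:
  assumes "p \<in> supported_on P" "q \<in> supported_on Q" "\<And>m n. P m \<Longrightarrow> Q n \<Longrightarrow> P (n + m)"
  shows "q * p \<in> supported_on P"
  using assms keys_mult[of q p] unfolding supported_on_def by blast

text \<open>The right-hand side is an ideal containing the generators. Conversely each of its terms
  is a multiple of the monomial of a basis, and a polynomial is the sum of its terms.\<close>

lemma facet_ideal_disjoint_circuits:
  assumes N: "disjoint_circuits N \<C>" and Cs: "set Cs = \<C>"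
  shows "facet_ideal TYPE('k::field) N = supported_on (circuit_exps (ground N) (ground N - \<Union>\<C>) Cs)"
proof -
  let ?E = "ground N" and ?P = "circuit_exps (ground N) (ground N - \<Union>\<C>) Cs"
  let ?R = "poly_ring TYPE('k) ?E" and ?J = "supported_on ?P :: ('a, 'k) mpoly set"
  let ?S = "(\<lambda>\<sigma>. \<Prod>j\<in>\<sigma>. indet j) ` bases N :: ('a, 'k) mpoly set"
  note P = bases_disjoint_circuits[OF N Cs]
  interpret cring ?R by (rule cring_poly_ring)
  have basis: "finite \<sigma>" "\<sigma> \<subseteq> ?E" if "\<sigma> \<in> bases N" for \<sigma>
    using that disjoint_circuitsD(1,8)[OF N] finite_subset by (auto simp: bases_def)
  have "?S \<subseteq> ?J"
    using basis(1) by (auto simp: prod_indet supported_on_def P keys_sqfree_exp dest: basis(2)[THEN subsetD])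
  moreover have "ideal ?J ?R"
  proof (rule ideal_poly_ringI)
    show "?J \<subseteq> polys ?E" by (auto simp: P elim!: supported_on_mono)
    show "q * p \<in> ?J" if "p \<in> ?J" "q \<in> polys ?E" for p q
      using that by (rule supported_on_up_closed_mult) (auto simp: P keys_plus_nat)
  qed (simp_all add: supported_on_zero supported_on_add)
  ultimately have sub: "facet_ideal TYPE('k) N \<subseteq> ?J"
    unfolding facet_ideal_def by (intro genideal_minimal)
  have "?S \<subseteq> carrier ?R"
    using basis(1) by (auto simp: prod_indet supported_on_def keys_sqfree_exp dest: basis(2)[THEN subsetD])
  then interpret I: ideal "facet_ideal TYPE('k) N" ?R
    unfolding facet_ideal_def by (rule genideal_ideal)
  have S: "?S \<subseteq> facet_ideal TYPE('k) N"
    unfolding facet_ideal_def by (rule genideal_self) fact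
  have monom: "Poly_Mapping.single m k \<in> facet_ideal TYPE('k) N" if m: "?P m" for m k
  proof -
    obtain \<sigma> where s: "\<sigma> \<in> bases N" "\<sigma> \<subseteq> Poly_Mapping.keys m" "Poly_Mapping.keys m \<subseteq> ?E"
      using m P by blast
    then obtain n where n: "m = sqfree_exp \<sigma> + n" using sqfree_exp_divides by blast
    have "Poly_Mapping.single m k = Poly_Mapping.single n k * (\<Prod>j\<in>\<sigma>. indet j)"
      using basis[OF s(1)] by (simp add: n prod_indet mult_single add.commute)
    moreover have "Poly_Mapping.single n k \<in> polys ?E"
      using s(3) by (auto simp: n supported_on_def keys_plus_nat)
    moreover have "(\<Prod>j\<in>\<sigma>. indet j) \<in> facet_ideal TYPE('k) N" using S s(1) by blast
    ultimately show ?thesis using I.I_l_closed by fastforce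
  qed
  have "p \<in> facet_ideal TYPE('k) N" if p: "p \<in> ?J" for p
  proof -
    have "(\<Sum>m\<in>M. Poly_Mapping.single m (Poly_Mapping.lookup p m)) \<in> facet_ideal TYPE('k) N"
      if "finite M" "\<forall>m\<in>M. ?P m" for M
      using that
    proof (induction M rule: finite_induct)
      case empty
      show ?case using I.zero_closed by simp
    next
      case (insert m M)
      then show ?case using I.a_closed monom by fastforce
    qed
    from this[of "Poly_Mapping.keys p"] show ?thesis
      using p by (simp add: supported_on_def flip: poly_mapping_expand)
  qed
  then show ?thesis using sub by blast
qed

text \<open>The polynomials without constant term form an ideal that contains the variables. This
  turns minimality into the vanishing of constant coefficients required by
  \<open>minimal_resolution_card_le\<close>.\<close>

lemma irrelevant_ideal_const_coeff:
  assumes "p \<in> irrelevant_ideal TYPE('k::field) E"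
  shows "Poly_Mapping.lookup p 0 = 0"
proof -
  let ?I = "{p \<in> polys E. Poly_Mapping.lookup p 0 = 0} :: ('a, 'k) mpoly set"
  interpret cring "poly_ring TYPE('k) E" by (rule cring_poly_ring)
  have "ideal ?I (poly_ring TYPE('k) E)"
    using is_subring_polys[of E]
    by (intro ideal_poly_ringI) (auto simp: is_subring_def lookup_add lookup_times_0)
  moreover have "indet ` E \<subseteq> ?I" by (auto simp: indet_polys lookup_indet_0)
  ultimately have "irrelevant_ideal TYPE('k) E \<subseteq> ?I"
    unfolding irrelevant_ideal_def by (rule genideal_minimal)
  then show ?thesis using assms by blast
qed

section \<open>Translation of module-theoretic resolutions, and the Betti numbers\<close>

lemma free_module_simps:
  "carrier (free_module (poly_ring K E) n) = {..<n} \<rightarrow>\<^sub>E polys E"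
  "\<zero>\<^bsub>free_module (poly_ring K E) n\<^esub> = (\<lambda>i\<in>{..<n}. 0)"
  "u \<oplus>\<^bsub>free_module (poly_ring K E) n\<^esub> v = (\<lambda>i\<in>{..<n}. u i + v i)"
  "a \<odot>\<^bsub>free_module (poly_ring K E) n\<^esub> v = (\<lambda>i\<in>{..<n}. a * v i)"
  by (simp_all add: free_module_def)

text \<open>
  Passes between the two conventions for vectors of length \<open>n\<close>: \<open>undefined\<close> or \<open>0\<close> outside of
  \<open>{..<n}\<close>.
\<close>

definition zero_extend :: "nat \<Rightarrow> (nat \<Rightarrow> 'a) \<Rightarrow> nat \<Rightarrow> 'a::zero" where
  "zero_extend n v = (\<lambda>i. if i < n then v i else 0)"

lemma restrict_free_on:
  "u \<in> free_on (polys E) {..<n} \<Longrightarrow> restrict u {..<n} \<in> carrier (free_module (poly_ring K E) n)"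
  by (auto simp: free_on_def free_module_simps)

lemma zero_extend_free_module:
  "v \<in> carrier (free_module (poly_ring K E) n) \<Longrightarrow> zero_extend n v \<in> free_on (polys E) {..<n}"
  by (auto simp: free_on_def free_module_simps zero_extend_def)

lemma zero_extend_restrict: "u \<in> free_on (polys E) {..<n} \<Longrightarrow> zero_extend n (restrict u {..<n}) = u"
  by (auto simp: free_on_def zero_extend_def)

lemma restrict_zero_extend:
  "v \<in> carrier (free_module (poly_ring K E) n) \<Longrightarrow> restrict (zero_extend n v) {..<n} = v"
  by (auto simp: free_module_simps zero_extend_def restrict_def fun_eq_iff PiE_def extensional_def)

lemma ideal_times_free_module:
  assumes "x \<in> ideal_times I (free_module (poly_ring TYPE('k::field) E) n)"
    "\<And>p. p \<in> I \<Longrightarrow> Poly_Mapping.lookup p 0 = 0" "i < n"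
  shows "Poly_Mapping.lookup (x i) 0 = 0"
  using assms by induction (auto simp: free_module_simps lookup_add lookup_times_0)

text \<open>\<open>restrict\<close> and \<open>zero_extend\<close> are mutually inverse isomorphisms
  between the two models of a free module, so composing the maps with them preserves kernels and
  images. \<open>JE\<close> lets the augmentation be read as a map into the polynomials.\<close>

lemma facet_ideal_resolution_imp_resolution:
  assumes "facet_ideal_resolution TYPE('k::field) N \<beta> \<epsilon> \<phi>"
    and JE: "facet_ideal TYPE('k) N \<subseteq> polys (ground N)"
  defines "d \<equiv> \<lambda>i u. zero_extend (\<beta> i) (\<phi> i (restrict u {..<\<beta> (Suc i)}))"
  shows "resolution (polys (ground N)) (\<lambda>i. {..<\<beta> i}) (\<lambda>u _. \<epsilon> (restrict u {..<\<beta> 0})) d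
      ((\<lambda>p _. p) ` facet_ideal TYPE('k) N)"
    and "u \<in> free_on (polys (ground N)) {..<\<beta> (Suc i)} \<Longrightarrow> Poly_Mapping.lookup (d i u j) 0 = 0"
proof -
  let ?E = "ground N" and ?J = "facet_ideal TYPE('k) N"
  let ?R = "poly_ring TYPE('k) ?E"
  let ?F = "\<lambda>n. free_module ?R n" and ?U = "\<lambda>n. free_on (polys ?E :: ('a, 'k) mpoly set) {..<n}"
  let ?M = "ideal_module ?R ?J"
  have M: "carrier ?M = ?J" "\<zero>\<^bsub>?M\<^esub> = 0" "x \<oplus>\<^bsub>?M\<^esub> y = x + y" "x \<odot>\<^bsub>?M\<^esub> y = x * y" for x y
    by (simp_all add: ideal_module_def)
  note res = assms(1)[unfolded facet_ideal_resolution_def minimal_free_resolution_def]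
  have e: "\<epsilon> \<in> module_hom ?R (?F (\<beta> 0)) ?M"
    and phi: "\<phi> i \<in> module_hom ?R (?F (\<beta> (Suc i))) (?F (\<beta> i))"
    and surj: "\<epsilon> ` carrier (?F (\<beta> 0)) = carrier ?M"
    and ex0: "{v \<in> carrier (?F (\<beta> 0)). \<epsilon> v = \<zero>\<^bsub>?M\<^esub>} = \<phi> 0 ` carrier (?F (\<beta> (Suc 0)))"
    and ex: "{v \<in> carrier (?F (\<beta> (Suc i))). \<phi> i v = \<zero>\<^bsub>?F (\<beta> i)\<^esub>} =
      \<phi> (Suc i) ` carrier (?F (\<beta> (Suc (Suc i))))"
    and min: "\<phi> i ` carrier (?F (\<beta> (Suc i))) \<subseteq> ideal_times (irrelevant_ideal TYPE('k) ?E) (?F (\<beta> i))"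
    for i
    by (simp_all only: res)
  have r_add: "restrict (\<lambda>i. u i + v i) {..<n} = restrict u {..<n} \<oplus>\<^bsub>?F n\<^esub> restrict v {..<n}"
    for u v n by (auto simp: free_module_simps)
  have r_mult: "restrict (\<lambda>i. r * u i) {..<n} = r \<odot>\<^bsub>?F n\<^esub> restrict u {..<n}"
    for u r n by (auto simp: free_module_simps)
  have z_add: "zero_extend n (u \<oplus>\<^bsub>?F n\<^esub> v) = (\<lambda>i. zero_extend n u i + zero_extend n v i)"
    for u v n by (auto simp: free_module_simps zero_extend_def)
  have z_mult: "zero_extend n (r \<odot>\<^bsub>?F n\<^esub> v) = (\<lambda>i. r * zero_extend n v i)"
    for r v n by (auto simp: free_module_simps zero_extend_def)
  have z_zero: "zero_extend n \<zero>\<^bsub>?F n\<^esub> = (\<lambda>i. 0)" for n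
    by (auto simp: free_module_simps zero_extend_def)
  have z_eq_0: "v = \<zero>\<^bsub>?F n\<^esub>" if "v \<in> carrier (?F n)" "zero_extend n v = (\<lambda>i. 0)" for v n
    using restrict_zero_extend[OF that(1)] that(2) by (simp add: free_module_simps)
  have rU: "restrict u {..<n} \<in> carrier (?F n)" if "u \<in> ?U n" for u n
    by (rule restrict_free_on[OF that])
  have imU: "(\<lambda>u. restrict u {..<n}) ` ?U n = carrier (?F n)" for n
  proof
    show "carrier (?F n) \<subseteq> (\<lambda>u. restrict u {..<n}) ` ?U n"
    proof
      fix v assume v: "v \<in> carrier (?F n)"
      show "v \<in> (\<lambda>u. restrict u {..<n}) ` ?U n"
        by (rule image_eqI[where x = "zero_extend n v"])
          (simp_all only: restrict_zero_extend[OF v] zero_extend_free_module[OF v])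
    qed
  qed (use rU in blast)
  have phiC: "\<phi> i v \<in> carrier (?F (\<beta> i))" if "v \<in> carrier (?F (\<beta> (Suc i)))" for i v
    using phi[of i] that by (auto simp: module_hom_def)
  have dimg: "d i ` ?U (\<beta> (Suc i)) = zero_extend (\<beta> i) ` \<phi> i ` carrier (?F (\<beta> (Suc i)))" for i
    unfolding d_def imU[symmetric] by (simp add: image_image)
  show "resolution (polys ?E) (\<lambda>i. {..<\<beta> i}) (\<lambda>u _. \<epsilon> (restrict u {..<\<beta> 0})) d ((\<lambda>p _. p) ` ?J)"
    unfolding resolution_def
  proof (intro conjI allI)
    show "linear_on (polys ?E) {..<\<beta> 0} UNIV (\<lambda>u (_ :: unit). \<epsilon> (restrict u {..<\<beta> 0}))"
      using e rU JE unfolding linear_on_def r_add r_mult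
      by (auto simp: module_hom_def M free_on_def[of _ UNIV])
    show "linear_on (polys ?E) {..<\<beta> (Suc i)} {..<\<beta> i} (d i)" for i
    proof -
      have "zero_extend (\<beta> i) (\<phi> i (restrict u {..<\<beta> (Suc i)})) \<in> ?U (\<beta> i)" if "u \<in> ?U (\<beta> (Suc i))" for u
        by (rule zero_extend_free_module[OF phiC[OF rU[OF that]]])
      then show ?thesis
        using phi[of i] rU unfolding linear_on_def d_def r_add r_mult
        by (auto simp: module_hom_def z_add z_mult)
    qed
    show "(\<lambda>u (_ :: unit). \<epsilon> (restrict u {..<\<beta> 0})) ` ?U (\<beta> 0) = (\<lambda>p _. p) ` ?J"
    proof -
      have "(\<lambda>u (_ :: unit). \<epsilon> (restrict u {..<\<beta> 0})) ` ?U (\<beta> 0) =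
          (\<lambda>p _. p) ` \<epsilon> ` (\<lambda>u. restrict u {..<\<beta> 0}) ` ?U (\<beta> 0)"
        by (simp add: image_image)
      then show ?thesis unfolding imU surj M .
    qed
    show "d 0 ` ?U (\<beta> (Suc 0)) = ker_on (polys ?E) {..<\<beta> 0} (\<lambda>u (_ :: unit). \<epsilon> (restrict u {..<\<beta> 0}))"
      unfolding dimg ex0[symmetric] ker_on_def
    proof safe
      fix v assume v: "v \<in> carrier (?F (\<beta> 0))" "\<epsilon> v = \<zero>\<^bsub>?M\<^esub>"
      show "zero_extend (\<beta> 0) v \<in> ?U (\<beta> 0)" by (rule zero_extend_free_module[OF v(1)])
      show "(\<lambda>_ :: unit. \<epsilon> (restrict (zero_extend (\<beta> 0) v) {..<\<beta> 0})) = (\<lambda>_. 0)"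
        using v(2) by (simp add: restrict_zero_extend[OF v(1)] M)
    next
      fix u assume u: "u \<in> ?U (\<beta> 0)" "(\<lambda>_ :: unit. \<epsilon> (restrict u {..<\<beta> 0})) = (\<lambda>_. 0)"
      then show "u \<in> zero_extend (\<beta> 0) ` {v \<in> carrier (?F (\<beta> 0)). \<epsilon> v = \<zero>\<^bsub>?M\<^esub>}"
        using rU[OF u(1)] zero_extend_restrict[OF u(1)]
        by (intro image_eqI[of _ _ "restrict u {..<\<beta> 0}"]) (simp_all add: M fun_eq_iff)
    qed
    show "d (Suc i) ` ?U (\<beta> (Suc (Suc i))) = ker_on (polys ?E) {..<\<beta> (Suc i)} (d i)" for i
      unfolding dimg ex[symmetric] ker_on_def
    proof safe
      fix v assume v: "v \<in> carrier (?F (\<beta> (Suc i)))" "\<phi> i v = \<zero>\<^bsub>?F (\<beta> i)\<^esub>"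
      show "zero_extend (\<beta> (Suc i)) v \<in> ?U (\<beta> (Suc i))" by (rule zero_extend_free_module[OF v(1)])
      show "d i (zero_extend (\<beta> (Suc i)) v) = (\<lambda>_. 0)"
        unfolding d_def restrict_zero_extend[OF v(1)] v(2) by (rule z_zero)
    next
      fix u assume u: "u \<in> ?U (\<beta> (Suc i))" "d i u = (\<lambda>_. 0)"
      then have "\<phi> i (restrict u {..<\<beta> (Suc i)}) = \<zero>\<^bsub>?F (\<beta> i)\<^esub>"
        by (intro z_eq_0 phiC rU) (simp_all add: d_def)
      then show "u \<in> zero_extend (\<beta> (Suc i)) ` {v \<in> carrier (?F (\<beta> (Suc i))). \<phi> i v = \<zero>\<^bsub>?F (\<beta> i)\<^esub>}"
        using rU[OF u(1)] zero_extend_restrict[OF u(1)]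
        by (intro image_eqI[of _ _ "restrict u {..<\<beta> (Suc i)}"]) simp_all
    qed
  qed simp
  show "Poly_Mapping.lookup (d i u j) 0 = 0" if u: "u \<in> ?U (\<beta> (Suc i))"
  proof (cases "j < \<beta> i")
    case True
    have "\<phi> i (restrict u {..<\<beta> (Suc i)}) \<in> ideal_times (irrelevant_ideal TYPE('k) ?E) (?F (\<beta> i))"
      using min[of i] rU[OF u] by blast
    then show ?thesis
      using ideal_times_free_module[OF _ irrelevant_ideal_const_coeff True] True
      by (simp add: d_def zero_extend_def)
  qed (simp add: d_def zero_extend_def)
qed

lemma betti_numbers_disjoint_circuits:
  assumes N: "disjoint_circuits N \<C>" and res: "facet_ideal_resolution TYPE('k::field) N \<beta> \<epsilon> \<phi>"
  shows "real (\<beta> i) = coeff (\<Prod>C\<in>\<C>. [:real (card C), real (card C) - 1:]) i"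
proof -
  note D = disjoint_circuitsD[OF N]
  \<comment> \<open>The construction recurses along a list. Distinctness makes its members pairwise
    disjoint and lets the product over the list be read as one over \<open>\<C>\<close>.\<close>
  obtain Cs where Cs: "set Cs = \<C>" "distinct Cs" using finite_distinct_list[OF D(2)] by blast
  let ?E = "ground N" and ?L = "ground N - \<Union>\<C>"
  have "sorted_wrt (\<lambda>C D. C \<inter> D = {}) Cs"
    unfolding sorted_wrt_iff_nth_less
  proof (intro allI impI)
    fix i j assume ij: "i < j" "j < length Cs"
    then have "Cs ! i \<noteq> Cs ! j" "Cs ! i \<in> \<C>" "Cs ! j \<in> \<C>"
      using Cs by (auto simp: nth_eq_iff_index_eq)
    then show "Cs ! i \<inter> Cs ! j = {}" using D(7) by blast
  qed
  then have dat: "circuit_data ?E ?L Cs"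
    using D Cs(1) by (auto simp: circuit_data_def)
  have X: "resolution (polys ?E :: ('a, 'k) mpoly set) (res_basis Cs) (\<lambda>u _. res_aug ?L Cs u)
      (\<lambda>n. res_diff Cs) ((\<lambda>p _. p) ` facet_ideal TYPE('k) N)"
    using resolution_circuits[OF dat] by (simp add: facet_ideal_disjoint_circuits[OF N Cs(1)])
  have "facet_ideal TYPE('k) N \<subseteq> polys ?E"
    unfolding facet_ideal_disjoint_circuits[OF N Cs(1)]
    by (auto simp: circuit_exps_def elim!: supported_on_mono)
  note Y = facet_ideal_resolution_imp_resolution[OF res this]
  let ?c = "\<lambda>p :: ('a, 'k) mpoly. Poly_Mapping.lookup p 0"
  \<comment> \<open>Each inequality rests on minimality of the resolution whose rank is on the left;
    both resolutions are minimal, so equality follows.\<close>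
  have "card (res_basis Cs i) \<le> card {..<\<beta> i}"
    by (rule minimal_resolution_card_le[OF is_subring_polys X Y(1), where c = ?c])
      (simp_all add: lookup_add lookup_times_0 res_diff_minimal)
  moreover have "card {..<\<beta> i} \<le> card (res_basis Cs i)"
    by (rule minimal_resolution_card_le[OF is_subring_polys Y(1) X, where c = ?c])
      (simp_all add: lookup_add lookup_times_0 Y(2))
  ultimately have "\<beta> i = card (res_basis Cs i)" by simp
  also have "real \<dots> = coeff (\<Prod>C\<leftarrow>Cs. [:real (card C), real (card C) - 1:]) i"
    using D Cs(1) by (intro card_res_basis) auto
  also have "(\<Prod>C\<leftarrow>Cs. [:real (card C), real (card C) - 1:]) = (\<Prod>C\<in>\<C>. [:real (card C), real (card C) - 1:])"
    by (simp add: prod.distinct_set_conv_list[OF Cs(2)] flip: Cs(1))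
  finally show ?thesis .
qed

theorem theorem3:
  fixes G :: "('v, 'e) multigraph" and H :: "('w, 'f) multigraph"
    and \<beta> \<beta>' :: "nat \<Rightarrow> nat"
    and \<epsilon> :: "(nat \<Rightarrow> ('e, 'k::field) mpoly) \<Rightarrow> ('e, 'k) mpoly"
    and \<phi> :: "nat \<Rightarrow> (nat \<Rightarrow> ('e, 'k) mpoly) \<Rightarrow> (nat \<Rightarrow> ('e, 'k) mpoly)"
    and \<epsilon>' :: "(nat \<Rightarrow> ('f, 'k) mpoly) \<Rightarrow> ('f, 'k) mpoly"
    and \<phi>' :: "nat \<Rightarrow> (nat \<Rightarrow> ('f, 'k) mpoly) \<Rightarrow> (nat \<Rightarrow> ('f, 'k) mpoly)"
  assumes "cactus G" and "loop_free G"
    and "cactus H" and "loop_free H"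
    and "facet_ideal_resolution TYPE('k) (cycle_matroid G) \<beta> \<epsilon> \<phi>"
    and "facet_ideal_resolution TYPE('k) (cycle_matroid H) \<beta>' \<epsilon>' \<phi>'"
    and "\<forall>i. \<beta> i = \<beta>' i"
  shows "\<forall>i. higher_weight (cycle_matroid G) i = higher_weight (cycle_matroid H) i"
proof
  fix i
  have N: "disjoint_circuits (cycle_matroid G) (circuits G)"
    and N': "disjoint_circuits (cycle_matroid H) (circuits H)"
    using assms by (auto intro: disjoint_circuits_cycle_matroid)
  have "(\<Prod>C\<in>circuits G. [:real (card C), real (card C) - 1:]) =
      (\<Prod>C\<in>circuits H. [:real (card C), real (card C) - 1:])"
    using betti_numbers_disjoint_circuits[OF N assms(5)] betti_numbers_disjoint_circuits[OF N' assms(6)]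
      assms(7) by (intro poly_eqI) metis
  then obtain h where "bij_betw h (circuits G) (circuits H)" "\<forall>C\<in>circuits G. card (h C) = card C"
    using linear_factors_bij[of "circuits G" "circuits H" card card]
      disjoint_circuitsD(2,4)[OF N] disjoint_circuitsD(2,4)[OF N'] by blast
  then show "higher_weight (cycle_matroid G) i = higher_weight (cycle_matroid H) i"
    using higher_weight_eq_if_bij[OF N N'] by blast
qed

end
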